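(* For each odd integer $k \geq 7$, there exists $n_0$ such that if $n\geq n_0$ and $G$ is a $C_{k-2}$-free graph on $n$ vertices maximising the number of $k$-cycles (among all $C_{k-2}$-free graphs on $n$ vertices), then $G$ is a balanced blow-up of $C_k$. In particular, for each $n\geq n_0$, we have $\mathrm{ex}(n,C_k,C_{k-2})\leq (n/k)^k$.
   Context: $C_m$ denotes the cycle of length $m$; the number of $k$-cycles of a graph is the number of its subgraphs isomorphic to $C_k$. For graphs $T,H$, $\mathrm{ex}(n,T,H)$ is the maximum number of copies of $T$ in an $H$-free graph on $n$ vertices. A balanced blow-up of a graph $F$ on $n$ vertices is obtained by replacing the vertices of $F$ by independent sets whose sizes sum to $n$ and differ by at most one from each other, and replacing each edge of $F$ by the complete bipartite graph between the corresponding independent sets. *)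

theory Defs
  imports Complex_Main
begin

type_synonym 'a graph = "'a set \<times> 'a set set"

abbreviation verts :: "'a graph \<Rightarrow> 'a set" where "verts \<equiv> fst"
abbreviation edges :: "'a graph \<Rightarrow> 'a set set" where "edges \<equiv> snd"

definition simple_graph :: "'a graph \<Rightarrow> bool" where
  "simple_graph G \<longleftrightarrow> finite (verts G) \<and> (\<forall>e\<in>edges G. e \<subseteq> verts G \<and> card e = 2)"

definition subgraph :: "'a graph \<Rightarrow> 'a graph \<Rightarrow> bool" where
  "subgraph S G \<longleftrightarrow> simple_graph S \<and> verts S \<subseteq> verts G \<and> edges S \<subseteq> edges G"

definition graph_iso :: "'a graph \<Rightarrow> 'b graph \<Rightarrow> bool" where
  "graph_iso G H \<longleftrightarrow> (\<exists>f. bij_betw f (verts G) (verts H) \<and> edges H = (\<lambda>e. f ` e) ` edges G)"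

text \<open>Subgraphs are not required to be induced.\<close>

definition copies :: "'b graph \<Rightarrow> 'a graph \<Rightarrow> 'a graph set" where
  "copies T G = {S. subgraph S G \<and> graph_iso T S}"

definition num_copies :: "'b graph \<Rightarrow> 'a graph \<Rightarrow> nat" where
  "num_copies T G = card (copies T G)"

definition graph_free :: "'b graph \<Rightarrow> 'a graph \<Rightarrow> bool" where
  "graph_free H G \<longleftrightarrow> copies H G = {}"

text \<open>Meaningful for \<open>m \<ge> 3\<close> only.\<close>

definition cycle_graph :: "nat \<Rightarrow> nat graph" where
  "cycle_graph m = ({..<m}, {{i, Suc i mod m} |i. i < m})"

text \<open>The generalised Turan number \<open>ex(n, T, H)\<close>. Both counting copies and being \<open>H\<close>-free are
  isomorphism invariant, so it suffices to range over the finitely many graphs with vertex set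
  \<open>{..<n}\<close>.\<close>

definition gen_turan :: "nat \<Rightarrow> 'b graph \<Rightarrow> 'c graph \<Rightarrow> nat" where
  "gen_turan n T H =
     Max {num_copies T G |G :: nat graph. simple_graph G \<and> verts G = {..<n} \<and> graph_free H G}"

text \<open>\<open>A v\<close> is the independent set that replaces the vertex \<open>v\<close> of \<open>F\<close>.\<close>

definition balanced_blowup :: "'b graph \<Rightarrow> 'a graph \<Rightarrow> bool" where
  "balanced_blowup F G \<longleftrightarrow>
     (\<exists>A :: 'b \<Rightarrow> 'a set.
        (\<forall>v\<in>verts F. finite (A v)) \<and>
        (\<forall>u\<in>verts F. \<forall>v\<in>verts F. u \<noteq> v \<longrightarrow> A u \<inter> A v = {}) \<and>
        (\<forall>u\<in>verts F. \<forall>v\<in>verts F. card (A u) \<le> card (A v) + 1) \<and>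
        verts G = (\<Union>v\<in>verts F. A v) \<and>
        edges G = {{x, y} |u v x y. {u, v} \<in> edges F \<and> x \<in> A u \<and> y \<in> A v})"

end

theory Submission
  imports Defs
begin

text \<open>
  Let \<open>G\<close> have no \<open>C\<^sub>k\<^sub>-\<^sub>2\<close>. Deleting \<open>o(n\<^sup>2)\<close> edges destroys all odd cycles shorter than \<open>k\<close>. In the
  remaining graph a vertex has at most two neighbours on a \<open>k\<close>-cycle, and these are at distance two.
  Choose the vertices of a \<open>k\<close>-cycle at random in the order \<open>v\<^sub>0, v\<^sub>1, v\<^sub>3, v\<^sub>2, v\<^sub>4, \<dots>\<close>: as \<open>k \<ge> 7\<close>, the
  vertex \<open>v\<^sub>3\<close> fixes the orientation, being reachable from \<open>v\<^sub>1\<close> in two steps but not adjacent to \<open>v\<^sub>0\<close>.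
  The probabilities of the cycles sum to at most 1, and the sizes of the sets chosen from, summed over
  all rotations of a cycle, are controlled by counting how often each single vertex occurs. This
  bounds the number of \<open>k\<close>-cycles by \<open>(n/k)\<^sup>k\<close>, and near equality forces a \<open>k\<close>-cycle on which almost
  all vertices have exactly two neighbours. Their positions define a partition close to a blow-up
  of \<open>C\<^sub>k\<close>. Once vertices on few \<open>k\<close>-cycles are discarded, a vertex or an edge not fitting this partition
  would complete a \<open>C\<^sub>k\<^sub>-\<^sub>2\<close>, so \<open>G\<close> is a subgraph of a blow-up and comparing products of part sizes
  finishes the proof.
\<close>

section \<open>Walks in a cycle\<close>

text \<open>Only one odd length is forbidden, so \<open>R\<close> may contain shorter odd cycles,
  and a closed walk of length \<open>k - 2\<close> in it is no contradiction by itself. In the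
  cleaned graph all odd closed walks shorter than \<open>k\<close> are excluded, and the structural
  claims reduce to finding a walk of prescribed length between two positions of \<open>C_k\<close>:
  as \<open>k\<close> is odd, the two arcs between them have opposite parity, and one of them has
  the right one. The deleted edges still count, however, so the exact result is proved for
  \<open>R\<close> itself, where walks must be lifted to genuine paths through large, almost
  completely joined classes. Cycles are counted as lists with a start and a direction,
  \<open>2 * k\<close> for each copy. In a blow-up with parts of size \<open>n/k\<close> such a list
  has probability \<open>(k/n)^(k-1) / (2n)\<close>: \<open>n\<close> choices for the start, two
  parts for the second vertex, one part for every later one. Hence the bound
  \<open>2k (n/k)^k\<close> on the number of lists, and the halving of the second candidate
  set.\<close>

definition cadj :: "nat \<Rightarrow> (nat \<times> nat) set" where
  "cadj k = {(i, j). i < k \<and> j < k \<and> (j = Suc i mod k \<or> i = Suc j mod k)}"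

text \<open>Labelled cycles: the start and the direction are part of the list, so for
  \<open>m >= 3\<close> every copy of \<open>C_m\<close> is counted \<open>2 * m\<close>
  times.\<close>

definition cycles :: "nat \<Rightarrow> 'a rel \<Rightarrow> 'a list set" where
  "cycles m R = {xs. length xs = m \<and> distinct xs \<and> (\<forall>i<m. (xs ! i, xs ! (Suc i mod m)) \<in> R)}"

lemma sym_relpow:
  assumes "sym R" shows "sym (R ^^ n)"
proof (induction n)
  case (Suc n)
  show ?case
  proof (rule symI)
    fix x z assume "(x, z) \<in> R ^^ Suc n"
    then obtain y where "(x, y) \<in> R ^^ n" "(y, z) \<in> R" by auto
    then have "(z, y) \<in> R" "(y, x) \<in> R ^^ n" using assms Suc by (auto dest: symD)
    then show "(z, x) \<in> R ^^ Suc n" by (rule relpow_Suc_I2)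
  qed
qed (simp add: sym_Id)

text \<open>Walking back and forth along one edge at the end adds two steps.\<close>

lemma relpow_pad:
  assumes "sym R" "(x, y) \<in> R ^^ n" "(y, z) \<in> R"
  shows "(x, y) \<in> R ^^ (n + 2 * m)"
proof (induction m)
  case (Suc m)
  then have "(x, z) \<in> R ^^ Suc (n + 2 * m)" using assms(3) by (rule relpow_Suc_I)
  then have "(x, y) \<in> R ^^ Suc (Suc (n + 2 * m))" using assms(1,3) by (blast intro: relpow_Suc_I dest: symD)
  then show ?case by simp
qed (use assms in simp)

lemma relpow_hom:
  assumes "(i, j) \<in> S ^^ n" "\<And>i j. (i, j) \<in> S \<Longrightarrow> (f i, f j) \<in> R"
  shows "(f i, f j) \<in> R ^^ n"
  using assms(1)
proof (induction n arbitrary: j)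
  case (Suc n)
  then obtain l where "(i, l) \<in> S ^^ n" "(l, j) \<in> S" by auto
  then show ?case using Suc.IH assms(2) by (blast intro: relpow_Suc_I)
qed simp

lemma sym_cadj: "sym (cadj k)"
  by (auto simp: cadj_def sym_def)

lemma cadj_Suc: "i < k \<Longrightarrow> (i, Suc i mod k) \<in> cadj k"
  by (auto simp: cadj_def)

lemma cadj_forward: "i < k \<Longrightarrow> (i, (i + a) mod k) \<in> cadj k ^^ a"
proof (induction a)
  case (Suc a)
  have "((i + a) mod k, Suc ((i + a) mod k) mod k) \<in> cadj k" using Suc.prems by (intro cadj_Suc) auto
  then have "((i + a) mod k, (i + Suc a) mod k) \<in> cadj k" by (simp add: mod_Suc_eq)
  then show ?case using Suc by (blast intro: relpow_Suc_I)
qed simp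

text \<open>Walk along one of the two arcs, of length \<open>j - i\<close> or
  \<open>k - (j - i)\<close>, and spend the even surplus on a single edge.\<close>

lemma cadj_relpow_le:
  assumes "i \<le> j" "j < k"
    and "even (l + (j - i)) \<and> j - i \<le> l \<or> even (l + (k - (j - i))) \<and> k - (j - i) \<le> l"
  shows "(i, j) \<in> cadj k ^^ l"
  using assms(3)
proof
  assume *: "even (l + (j - i)) \<and> j - i \<le> l"
  then have "even (l - (j - i))" by simp
  then obtain b where "l - (j - i) = 2 * b" by (blast elim: evenE)
  with * have b: "l = (j - i) + 2 * b" by linarith
  have "(i, (i + (j - i)) mod k) \<in> cadj k ^^ (j - i)" using assms by (intro cadj_forward) auto
  then have "(i, j) \<in> cadj k ^^ (j - i)" using assms by simp
  then show ?thesis unfolding b using sym_cadj cadj_Suc[OF assms(2)] by (intro relpow_pad)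
next
  assume *: "even (l + (k - (j - i))) \<and> k - (j - i) \<le> l"
  then have "even (l - (k - (j - i)))" by simp
  then obtain b where "l - (k - (j - i)) = 2 * b" by (blast elim: evenE)
  with * have b: "l = (k - (j - i)) + 2 * b" by linarith
  have "(j, (j + (k - (j - i))) mod k) \<in> cadj k ^^ (k - (j - i))" using assms by (intro cadj_forward) auto
  moreover have "(j + (k - (j - i))) mod k = i" using assms by (simp add: mod_if)
  ultimately have "(i, j) \<in> cadj k ^^ (k - (j - i))" using sym_relpow[OF sym_cadj] by (auto dest: symD)
  then show ?thesis unfolding b using sym_cadj cadj_Suc[OF assms(2)] by (intro relpow_pad)
qed

text \<open>The even arc between two positions has length at most \<open>k - 3\<close> unless it has
  length \<open>k - 1\<close>, in which case the other arc is an edge. Together with a further edge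
  such a walk gives the forbidden length \<open>k - 2\<close>.\<close>

lemma cadj_relpow_minus_3:
  assumes "odd k" "7 \<le> k" "i < k" "j < k" "(i, j) \<notin> cadj k"
  shows "(i, j) \<in> cadj k ^^ (k - 3)"
proof -
  have *: "(i, j) \<in> cadj k ^^ (k - 3)" if "i \<le> j" "j < k" "(i, j) \<notin> cadj k" for i j
  proof (rule cadj_relpow_le)
    have "j \<noteq> Suc i mod k" "i \<noteq> Suc j mod k" using that by (auto simp: cadj_def)
    then have "j \<noteq> Suc i" "\<not> (j = k - 1 \<and> i = 0)" using that by auto
    then have "j - i \<noteq> 1" "j - i \<noteq> k - 1" using that by auto
    moreover define d where "d = j - i"
    ultimately have d: "d \<noteq> 1" "d \<noteq> k - 1" "d < k" using that by auto
    obtain h where h: "k = 2 * h + 1" using assms(1) by (auto elim: oddE)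
    show "even (k - 3 + (j - i)) \<and> j - i \<le> k - 3 \<or>
      even (k - 3 + (k - (j - i))) \<and> k - (j - i) \<le> k - 3"
    proof (cases "even d")
      case True
      then obtain e where "d = 2 * e" by (auto elim: evenE)
      then show ?thesis unfolding d_def[symmetric] using d h assms(2) by auto
    next
      case False
      then obtain e where "d = 2 * e + 1" by (auto elim: oddE)
      then show ?thesis unfolding d_def[symmetric] using d h assms(2) by auto
    qed
  qed (use that in auto)
  show ?thesis
  proof (cases "i \<le> j")
    case False
    then have "(j, i) \<in> cadj k ^^ (k - 3)" using assms *[of j i] sym_cadj by (auto dest: symD)
    then show ?thesis using sym_relpow[OF sym_cadj] by (auto dest: symD)
  qed (use assms * in auto)
qed

text \<open>An odd arc longer than \<open>k - 4\<close> has length \<open>k - 2\<close> or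
  \<open>k\<close>, which leaves cyclic distance two or zero. This serves for two neighbours of one
  vertex, which add two edges to the walk.\<close>

lemma not_cadj_relpow_minus_4:
  assumes "odd k" "7 \<le> k" "i \<le> j" "j < k" "(i, j) \<notin> cadj k ^^ (k - 4)"
  shows "j = i \<or> j = i + 2 \<or> j + 2 = i + k"
proof -
  have "\<not> (even (k - 4 + (j - i)) \<and> j - i \<le> k - 4 \<or>
      even (k - 4 + (k - (j - i))) \<and> k - (j - i) \<le> k - 4)"
    using cadj_relpow_le[of i j k "k - 4"] assms by blast
  moreover define d where "d = j - i"
  ultimately have d: "\<not> (even (k - 4 + d) \<and> d \<le> k - 4)" "\<not> (even (k - 4 + (k - d)) \<and> k - d \<le> k - 4)"
    by auto
  have dk: "d < k" "j = i + d" using assms by (auto simp: d_def)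
  obtain h where h: "k = 2 * h + 1" using assms(1) by (auto elim: oddE)
  show ?thesis
  proof (cases "even d")
    case True
    then obtain e where "d = 2 * e" by (auto elim: evenE)
    then show ?thesis using d dk h assms(2) by simp arith
  next
    case False
    then obtain e where "d = 2 * e + 1" by (auto elim: oddE)
    then show ?thesis using d dk h assms(2) by simp arith
  qed
qed

text \<open>Now the odd arc may also have length \<open>k - 4\<close>. This serves for two vertices
  each joined to a third one by a walk of length two.\<close>

lemma not_cadj_relpow_minus_6:
  assumes "odd k" "7 \<le> k" "i \<le> j" "j < k" "(i, j) \<notin> cadj k ^^ (k - 6)"
  shows "j = i \<or> j = i + 2 \<or> j + 2 = i + k \<or> j = i + 4 \<or> j + 4 = i + k"
proof -
  have "\<not> (even (k - 6 + (j - i)) \<and> j - i \<le> k - 6 \<or>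
      even (k - 6 + (k - (j - i))) \<and> k - (j - i) \<le> k - 6)"
    using cadj_relpow_le[of i j k "k - 6"] assms by blast
  moreover define d where "d = j - i"
  ultimately have d: "\<not> (even (k - 6 + d) \<and> d \<le> k - 6)" "\<not> (even (k - 6 + (k - d)) \<and> k - d \<le> k - 6)"
    by auto
  have dk: "d < k" "j = i + d" using assms by (auto simp: d_def)
  obtain h where h: "k = 2 * h + 1" using assms(1) by (auto elim: oddE)
  show ?thesis
  proof (cases "even d")
    case True
    then obtain e where "d = 2 * e" by (auto elim: evenE)
    then show ?thesis using d dk h assms(2) by simp arith
  next
    case False
    then obtain e where "d = 2 * e + 1" by (auto elim: oddE)
    then show ?thesis using d dk h assms(2) by simp arith
  qed
qed

text \<open>Winding number argument: write the walk as steps \<open>+1\<close> and \<open>-1\<close>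
  modulo \<open>k\<close>. Their sum is divisible by \<open>k\<close> and odd, hence at least
  \<open>k\<close> in absolute value. If there are only \<open>k\<close> steps, all have the same
  sign; \<open>c = k - 1\<close> stands for \<open>-1\<close> within the natural numbers.\<close>

lemma odd_closed_walk_cadj:
  assumes walk: "\<And>s. s < m \<Longrightarrow> (f s, f (Suc s)) \<in> cadj k" and closed: "f m = f 0" and "odd m"
  shows "k \<le> m" and "m = k \<Longrightarrow> \<exists>c\<in>{1, k - 1}. \<forall>s\<le>k. f s = (f 0 + c * s) mod k"
proof -
  define d :: "nat \<Rightarrow> int" where "d s = (if f (Suc s) = Suc (f s) mod k then 1 else - 1)" for s
  have d1: "\<bar>d s\<bar> = 1" for s by (simp add: d_def)
  have step: "int (f (Suc s)) mod int k = (int (f s) + d s) mod int k" if "s < m" for s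
  proof (cases "f (Suc s) = Suc (f s) mod k")
    case True
    then show ?thesis by (simp add: d_def of_nat_mod add.commute)
  next
    case False
    then have "f s = Suc (f (Suc s)) mod k" using walk[OF that] by (auto simp: cadj_def)
    then have "int (f s) = (int (f (Suc s)) + 1) mod int k" by (simp add: of_nat_mod add.commute)
    then have "(int (f s) + d s) mod int k = (int (f (Suc s)) + 1 - 1) mod int k"
      using False by (simp add: d_def mod_diff_left_eq)
    then show ?thesis by simp
  qed
  have pos: "int (f s) mod int k = (int (f 0) + (\<Sum>t<s. d t)) mod int k" if "s \<le> m" for s
    using that
  proof (induction s)
    case (Suc s)
    have "int (f (Suc s)) mod int k = (int (f s) mod int k + d s) mod int k"
      using step[of s] Suc.prems by (simp add: mod_add_left_eq)
    also have "\<dots> = (int (f 0) + (\<Sum>t<s. d t) + d s) mod int k"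
      using Suc by (simp add: mod_add_left_eq)
    finally show ?case by (simp add: add.assoc)
  qed simp
  define S where "S = (\<Sum>t<m. d t)"
  \<comment> \<open>Each step is odd, so a sum of \<open>s\<close> steps has the parity of
    \<open>s\<close>.\<close>
  have "even ((\<Sum>t<s. d t) + int s)" for s
    by (induction s) (auto simp: d_def)
  then have "odd S" using \<open>odd m\<close> unfolding S_def by (metis even_add even_of_nat)
  have "int k dvd (int (f 0) + S) - int (f 0)"
    using pos[of m] closed unfolding S_def by (metis le_refl mod_eq_dvd_iff)
  then have dvd: "int k dvd S" by simp
  have "\<bar>S\<bar> \<le> (\<Sum>t<m. \<bar>d t\<bar>)" unfolding S_def by (rule sum_abs)
  then have le: "\<bar>S\<bar> \<le> int m" by (simp add: d1)
  have "S \<noteq> 0" using \<open>odd S\<close> by auto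
  then have ge: "int k \<le> \<bar>S\<bar>" using dvd dvd_imp_le_int[of S "int k"] by simp
  show "k \<le> m" using ge le by simp
  assume mk: "m = k"
  have fk: "f s < k" if "s \<le> k" for s
  proof (cases s)
    case 0
    then show ?thesis using walk[of 0] mk \<open>odd m\<close> by (auto simp: cadj_def intro: odd_pos)
  next
    case (Suc t)
    then show ?thesis using walk[of t] mk that by (auto simp: cadj_def)
  qed
  have "S = int k \<or> S = - int k" using ge le mk by auto
  then show "\<exists>c\<in>{1, k - 1}. \<forall>s\<le>k. f s = (f 0 + c * s) mod k"
  proof
    assume "S = int k"
    then have "(\<Sum>t<m. 1 - d t) = 0" using mk by (simp add: S_def sum_subtractf)
    then have "\<forall>t<m. d t = 1" by (subst (asm) sum_nonneg_eq_0_iff) (auto simp: d_def)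
    then have "(\<Sum>t<s. d t) = int s" if "s \<le> k" for s using that mk by simp
    then have "int (f s) mod int k = int ((f 0 + 1 * s) mod k)" if "s \<le> k" for s
      using pos[of s] that mk by (simp add: of_nat_mod)
    then have "f s = (f 0 + 1 * s) mod k" if "s \<le> k" for s
      using that fk[OF that] by (metis mod_less of_nat_eq_iff of_nat_mod)
    then show ?thesis by blast
  next
    assume "S = - int k"
    then have "(\<Sum>t<m. 1 + d t) = 0" using mk by (simp add: S_def sum.distrib)
    then have "\<forall>t\<in>{..<m}. 1 + d t = 0" by (subst (asm) sum_nonneg_eq_0_iff) (auto simp: d_def)
    then have "\<forall>t<m. d t = - 1" by (simp add: add_eq_0_iff)
    then have ds: "(\<Sum>t<s. d t) = - int s" if "s \<le> k" for s using that mk by simp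
    have "int (f s) mod int k = int ((f 0 + (k - 1) * s) mod k)" if "s \<le> k" for s
    proof -
      have "int ((f 0 + (k - 1) * s) mod k) = (int (f 0) - int s + int s * int k) mod int k"
        using mk \<open>odd m\<close> by (cases k) (simp_all add: of_nat_mod algebra_simps)
      then show ?thesis using pos[of s] ds that mk by simp
    qed
    then have "f s = (f 0 + (k - 1) * s) mod k" if "s \<le> k" for s
      using that fk[OF that] by (metis mod_less of_nat_eq_iff of_nat_mod)
    then show ?thesis by blast
  qed
qed

section \<open>Counting cycles in blow-ups\<close>

lemma card_lists_nth:
  "card {xs. length xs = m \<and> (\<forall>i<m. xs ! i \<in> A i)} = (\<Prod>i<m. card (A i))"
proof (induction m)
  case (Suc m)
  let ?L = "\<lambda>m. {xs. length xs = m \<and> (\<forall>i<m. xs ! i \<in> A i)}"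
  have "?L (Suc m) = (\<lambda>(xs, x). xs @ [x]) ` (?L m \<times> A m)"
  proof (intro equalityI subsetI)
    fix xs assume xs: "xs \<in> ?L (Suc m)"
    then have "xs \<noteq> []" by auto
    then have *: "xs = butlast xs @ [last xs]" by simp
    moreover have "butlast xs \<in> ?L m" using xs by (auto simp: nth_butlast)
    moreover have "last xs \<in> A m" using xs \<open>xs \<noteq> []\<close> by (auto simp: last_conv_nth)
    ultimately show "xs \<in> (\<lambda>(xs, x). xs @ [x]) ` (?L m \<times> A m)" by force
  qed (auto simp: nth_append less_Suc_eq)
  moreover have "inj_on (\<lambda>(xs, x). xs @ [x]) (?L m \<times> A m)" by (auto simp: inj_on_def)
  ultimately show ?case using Suc by (simp add: card_image card_cartesian_product)
qed simp

text \<open>The labelled \<open>k\<close>-cycles of the complete blow-up of \<open>C_k\<close> with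
  parts given by \<open>cl\<close>. Distinctness is not demanded because for odd
  \<open>k >= 3\<close> it follows: the classes already run once around \<open>C_k\<close>.\<close>

definition hom_lists :: "nat \<Rightarrow> ('a \<Rightarrow> nat) \<Rightarrow> 'a set \<Rightarrow> 'a list set" where
  "hom_lists k cl V = {xs. length xs = k \<and> set xs \<subseteq> V \<and>
     (\<forall>s<k. (cl (xs ! s), cl (xs ! (Suc s mod k))) \<in> cadj k)}"

lemma affine_mod_bij:
  fixes c k i :: nat
  assumes "coprime c k" "0 < k"
  shows "bij_betw (\<lambda>s. (i + c * s) mod k) {..<k} {..<k}"
proof -
  have "inj_on (\<lambda>s. (i + c * s) mod k) {..<k}"
  proof (rule linorder_inj_onI')
    fix s t assume st: "s \<in> {..<k}" "t \<in> {..<k}" "s < t"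
    show "(i + c * s) mod k \<noteq> (i + c * t) mod k"
    proof
      assume "(i + c * s) mod k = (i + c * t) mod k"
      then have "k dvd (i + c * t) - (i + c * s)" using st by (intro mod_eq_dvd_iff_nat[THEN iffD1]) auto
      then have "k dvd c * (t - s)" by (simp add: right_diff_distrib')
      then have "k dvd t - s" using assms(1) by (simp add: coprime_commute coprime_dvd_mult_right_iff)
      then show False using st by (auto dest: dvd_imp_le)
    qed
  qed
  moreover have "(\<lambda>s. (i + c * s) mod k) ` {..<k} \<subseteq> {..<k}" using assms(2) by auto
  ultimately show ?thesis by (simp add: bij_betw_def endo_inj_surj)
qed

lemma hom_lists_oriented:
  assumes "odd k" "xs \<in> hom_lists k cl V"
  shows "\<exists>c\<in>{1, k - 1}. \<forall>s<k. cl (xs ! s) = (cl (xs ! 0) + c * s) mod k"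
proof -
  have k: "0 < k" using assms(1) by (rule odd_pos)
  define f where "f s = cl (xs ! (s mod k))" for s
  have "(f s, f (Suc s)) \<in> cadj k" if "s < k" for s
    using assms(2) that by (auto simp: f_def hom_lists_def)
  moreover have "f k = f 0" using k by (simp add: f_def)
  ultimately obtain c where "c \<in> {1, k - 1}" "\<forall>s\<le>k. f s = (f 0 + c * s) mod k"
    using odd_closed_walk_cadj(2)[of k f k] assms(1) by metis
  then have "\<forall>s<k. cl (xs ! s) = (cl (xs ! 0) + c * s) mod k"
    unfolding f_def by (metis k less_imp_le mod_less mod_0)
  then show ?thesis using \<open>c \<in> {1, k - 1}\<close> by blast
qed

text \<open>A closed walk of odd length \<open>k\<close> in \<open>C_k\<close> is determined by its
  start \<open>i\<close> and its direction \<open>c\<close>, so the lists split into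
  \<open>2 * k\<close> product sets.\<close>

lemma hom_lists_eq:
  assumes "odd k"
  shows "hom_lists k cl V = (\<Union>(i, c)\<in>{..<k} \<times> {1, k - 1}.
    {xs. length xs = k \<and> (\<forall>s<k. xs ! s \<in> {x \<in> V. cl x = (i + c * s) mod k})})" (is "_ = ?U")
proof (intro equalityI subsetI)
  fix xs assume xs: "xs \<in> hom_lists k cl V"
  obtain c where c: "c \<in> {1, k - 1}" "\<forall>s<k. cl (xs ! s) = (cl (xs ! 0) + c * s) mod k"
    using hom_lists_oriented[OF assms xs] by blast
  have "cl (xs ! 0) < k" using xs assms odd_pos by (force simp: hom_lists_def cadj_def)
  then have "(cl (xs ! 0), c) \<in> {..<k} \<times> {1, k - 1}" using c(1) by auto
  moreover have "length xs = k \<and> (\<forall>s<k. xs ! s \<in> V)"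
    using xs by (auto simp: hom_lists_def)
  then have "length xs = k \<and> (\<forall>s<k. xs ! s \<in> {x \<in> V. cl x = (cl (xs ! 0) + c * s) mod k})"
    using c(2) by blast
  ultimately show "xs \<in> ?U" by blast
next
  fix xs assume "xs \<in> ?U"
  then obtain ic where ic: "ic \<in> {..<k} \<times> {1, k - 1}" "xs \<in> (case ic of (i, c) \<Rightarrow>
    {xs. length xs = k \<and> (\<forall>s<k. xs ! s \<in> {x \<in> V. cl x = (i + c * s) mod k})})" by blast
  obtain i c where "ic = (i, c)" by fastforce
  with ic have c: "i < k" "c = 1 \<or> c = k - 1" "length xs = k"
    "\<forall>s<k. xs ! s \<in> V \<and> cl (xs ! s) = (i + c * s) mod k" by auto
  have k: "0 < k" using assms by (rule odd_pos)
  have "(cl (xs ! s), cl (xs ! (Suc s mod k))) \<in> cadj k" if "s < k" for s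
  proof -
    have e: "cl (xs ! (Suc s mod k)) = (i + c * Suc s) mod k"
    proof -
      have "cl (xs ! (Suc s mod k)) = (i + c * (Suc s mod k)) mod k" using c(4) k by simp
      also have "\<dots> = (i + c * Suc s) mod k" by (metis mod_add_right_eq mod_mult_right_eq)
      finally show ?thesis .
    qed
    have e': "cl (xs ! s) = (i + c * s) mod k" using c(4) that by simp
    show ?thesis using c(2)
    proof
      assume "c = 1"
      then have "cl (xs ! (Suc s mod k)) = Suc (cl (xs ! s)) mod k" using e e' by (simp add: mod_Suc_eq)
      then show ?thesis using e' k cadj_Suc[of "cl (xs ! s)" k] by simp
    next
      assume "c = k - 1"
      then have "Suc (i + c * Suc s) = i + c * s + k" using k by simp
      then have "cl (xs ! s) = Suc (cl (xs ! (Suc s mod k))) mod k"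
        unfolding e e' by (simp only: mod_Suc_eq mod_add_self2)
      then show ?thesis using e k cadj_Suc[of "cl (xs ! (Suc s mod k))" k] sym_cadj[of k] by (auto dest: symD)
    qed
  qed
  moreover have "set xs \<subseteq> V" using c(3,4) by (auto simp: in_set_conv_nth)
  ultimately show "xs \<in> hom_lists k cl V" using c(3) by (simp add: hom_lists_def)
qed

lemma coprime_pm1: "3 \<le> k \<Longrightarrow> c \<in> {1, k - 1} \<Longrightarrow> coprime c (k::nat)"
  using coprime_diff_one_left_nat[of k] by auto

lemma distinct_hom_lists:
  assumes "odd k" "3 \<le> k" "xs \<in> hom_lists k cl V"
  shows "distinct xs"
proof -
  obtain c where c: "c \<in> {1, k - 1}" "\<forall>s<k. cl (xs ! s) = (cl (xs ! 0) + c * s) mod k"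
    using hom_lists_oriented[OF assms(1,3)] by blast
  have inj: "inj_on (\<lambda>s. (cl (xs ! 0) + c * s) mod k) {..<k}"
    using assms(2) c(1) by (intro bij_betw_imp_inj_on[OF affine_mod_bij] coprime_pm1) auto
  have "s = t" if "s < k" "t < k" "xs ! s = xs ! t" for s t
    using inj_onD[OF inj, of s t] that c(2) by (metis lessThan_iff)
  then show ?thesis using assms(3) by (auto simp: distinct_conv_nth hom_lists_def)
qed

lemma card_hom_lists:
  assumes "odd k" "3 \<le> k" "finite V"
  shows "card (hom_lists k cl V) = 2 * k * (\<Prod>i<k. card {x \<in> V. cl x = i})"
proof -
  define Z where "Z = (\<lambda>(i, c). {xs. length xs = k \<and> (\<forall>s<k. xs ! s \<in> {x \<in> V. cl x = (i + c * s) mod k})})"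
  have cardZ: "card (Z (i, c)) = (\<Prod>i<k. card {x \<in> V. cl x = i})" if "c \<in> {1, k - 1}" for i c
  proof -
    have "card (Z (i, c)) = (\<Prod>s<k. card {x \<in> V. cl x = (i + c * s) mod k})"
      unfolding Z_def by (simp only: split card_lists_nth)
    also have "\<dots> = (\<Prod>i<k. card {x \<in> V. cl x = i})"
      using affine_mod_bij[OF coprime_pm1[OF assms(2) that]] assms(2)
      by (intro prod.reindex_bij_betw[of _ _ _ "\<lambda>i. card {x \<in> V. cl x = i}"]) simp
    finally show ?thesis .
  qed
  have fin: "finite (Z a)" for a
  proof -
    have "Z a \<subseteq> {xs. set xs \<subseteq> V \<and> length xs = k}"
      by (auto simp: Z_def in_set_conv_nth split: prod.splits)
    then show ?thesis using finite_lists_length_eq[OF assms(3)] by (rule finite_subset)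
  qed
  \<comment> \<open>Position 0 reveals the start, and position 1 the direction, since
    \<open>1\<close> and \<open>k - 1\<close> are incongruent modulo \<open>k >= 3\<close>.\<close>
  have disj: "a = b" if "a \<in> {..<k} \<times> {1, k - 1}" "b \<in> {..<k} \<times> {1, k - 1}" "xs \<in> Z a" "xs \<in> Z b" for a b xs
  proof -
    obtain i c j d where ab: "a = (i, c)" "b = (j, d)" by fastforce
    have *: "(i + c * s) mod k = (j + d * s) mod k" if "s < k" for s
      using \<open>xs \<in> Z a\<close> \<open>xs \<in> Z b\<close> that by (auto simp: Z_def ab)
    have ij: "i = j" using *[of 0] assms(2) that(1,2) by (simp add: ab)
    have "(j + c) mod k = (j + d) mod k" using *[of 1] assms(2) ij by simp
    moreover have "(j + 1) mod k = (if j + 1 = k then 0 else j + 1)" using that(2) by (auto simp: ab)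
    moreover have "(j + (k - 1)) mod k = (if j = 0 then k - 1 else j - 1)"
    proof (cases j)
      case (Suc l)
      then have "j + (k - 1) = l + k" "l < k" using that(2) by (auto simp: ab)
      then show ?thesis using Suc by simp
    qed (use assms(2) in simp)
    ultimately have "c = d" using that(1,2) assms(2) by (auto simp: ab split: if_splits)
    then show ?thesis by (simp add: ab ij)
  qed
  have "card (hom_lists k cl V) = card (\<Union> (Z ` ({..<k} \<times> {1, k - 1})))"
    unfolding hom_lists_eq[OF assms(1)] Z_def by simp
  also have "\<dots> = (\<Sum>a\<in>{..<k} \<times> {1, k - 1}. card (Z a))"
  proof (rule card_UN_disjoint)
    show "\<forall>a\<in>{..<k} \<times> {1, k - 1}. \<forall>b\<in>{..<k} \<times> {1, k - 1}. a \<noteq> b \<longrightarrow> Z a \<inter> Z b = {}"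
      using disj by blast
  qed (use fin in auto)
  also have "\<dots> = (\<Sum>a\<in>{..<k} \<times> {1, k - 1}. \<Prod>i<k. card {x \<in> V. cl x = i})"
    using cardZ by (intro sum.cong) auto
  also have "\<dots> = 2 * k * (\<Prod>i<k. card {x \<in> V. cl x = i})"
    using assms(2) by (simp add: card_cartesian_product card_insert_if)
  finally show ?thesis .
qed

section \<open>Products of almost equal sizes\<close>

text \<open>The largest product of \<open>k\<close> natural numbers with sum \<open>n\<close>.\<close>

definition pmax :: "nat \<Rightarrow> nat \<Rightarrow> nat" where
  "pmax k n = (n div k) ^ (k - n mod k) * Suc (n div k) ^ (n mod k)"

lemma prod_balanced:
  fixes a :: "nat \<Rightarrow> nat"
  assumes "0 < k" and bal: "\<And>i j. i < k \<Longrightarrow> j < k \<Longrightarrow> a i \<le> a j + 1" and sum: "(\<Sum>i<k. a i) = n"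
  shows "(\<Prod>i<k. a i) = pmax k n"
proof -
  define q where "q = Min (a ` {..<k})"
  have "q \<in> a ` {..<k}" unfolding q_def using assms(1) by (intro Min_in) auto
  then obtain i0 where i0: "i0 < k" "a i0 = q" by auto
  have "q \<le> a i" if "i < k" for i unfolding q_def using that by (intro Min_le) auto
  then have q: "a i = q \<or> a i = Suc q" if "i < k" for i using bal[OF that i0(1)] i0(2) that by force
  define S where "S = {i. i < k \<and> a i = Suc q}"
  have S: "S \<subseteq> {..<k}" "i0 \<notin> S" using i0 by (auto simp: S_def)
  \<comment> \<open>Some entry attains the minimum \<open>q\<close>, so fewer than \<open>k\<close>
    entries equal \<open>Suc q\<close>; this is what makes \<open>card S\<close> the remainder of
    \<open>n\<close> modulo \<open>k\<close>.\<close>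
  then have "S \<subset> {..<k}" using i0 by auto
  then have r: "card S < k" using psubset_card_mono[of "{..<k}" S] by simp
  have "(\<Sum>i<k. a i) = (\<Sum>i<k. q + (if i \<in> S then 1 else 0))"
    using q by (intro sum.cong) (auto simp: S_def)
  also have "\<dots> = k * q + card S" using S by (simp add: sum.distrib sum.If_cases Int_absorb1)
  finally have n: "n = k * q + card S" using sum by simp
  then have dm: "n div k = q" "n mod k = card S" using r by auto
  have "(\<Prod>i<k. a i) = (\<Prod>i<k. if i \<in> S then Suc q else q)"
    using q by (intro prod.cong) (auto simp: S_def)
  also have "\<dots> = Suc q ^ card S * q ^ card ({..<k} - S)"
    using S by (simp add: prod.If_cases Int_absorb1 Diff_eq)
  also have "card ({..<k} - S) = k - card S" using S by (subst card_Diff_subset) (auto intro: finite_subset)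
  finally show ?thesis by (simp add: pmax_def dm)
qed

lemma sum_balanced_sizes:
  assumes "0 < k"
  shows "(\<Sum>i<k. if i < n mod k then Suc (n div k) else n div k) = n"
proof -
  have "(\<Sum>i<k. if i < n mod k then Suc (n div k) else n div k) =
      (\<Sum>i<k. n div k + (if i < n mod k then 1 else 0))"
    by (intro sum.cong) auto
  also have "\<dots> = k * (n div k) + card ({..<k} \<inter> {i. i < n mod k})"
    by (simp add: sum.distrib sum.If_cases)
  also have "{..<k} \<inter> {i. i < n mod k} = {..<n mod k}" using mod_less_divisor[OF assms, of n] by auto
  finally show ?thesis by simp
qed

text \<open>Moving one unit from a larger to a smaller entry increases the product of the two;
  positivity of the other entries keeps the inequality strict.\<close>

lemma prod_shift_less:
  fixes a :: "nat \<Rightarrow> nat"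
  assumes "i < k" "j < k" "a j + 1 < a i" and pos: "\<And>i. i < k \<Longrightarrow> 0 < a i"
  defines "b \<equiv> a(i := a i - 1, j := a j + 1)"
  shows "(\<Sum>i<k. b i) = (\<Sum>i<k. a i)" and "(\<Prod>i<k. a i) < (\<Prod>i<k. b i)"
proof -
  have ij: "i \<noteq> j" using assms(3) by auto
  define I where "I = {..<k} - {i, j}"
  have k: "{..<k} = insert i (insert j I)" "i \<notin> insert j I" "j \<notin> I" "finite I"
    using assms(1,2) ij by (auto simp: I_def)
  have bI: "b l = a l" if "l \<in> I" for l using that by (auto simp: b_def I_def)
  have bij: "b i = a i - 1" "b j = a j + 1" using ij by (auto simp: b_def)
  show "(\<Sum>i<k. b i) = (\<Sum>i<k. a i)" unfolding k(1) using k(2-4) bI bij assms(3) by simp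
  have "a i * a j < b i * b j"
    using assms(3) bij by (cases "a i") auto
  moreover have "0 < (\<Prod>l\<in>I. a l)" using pos by (intro prod_pos) (auto simp: I_def)
  ultimately have "a i * a j * (\<Prod>l\<in>I. a l) < b i * b j * (\<Prod>l\<in>I. a l)" by simp
  moreover have "(\<Prod>l\<in>I. b l) = (\<Prod>l\<in>I. a l)" using bI by (intro prod.cong) auto
  ultimately show "(\<Prod>i<k. a i) < (\<Prod>i<k. b i)" unfolding k(1) using k(2-4) by (simp add: mult.assoc)
qed

text \<open>A maximiser exists because every product is at most \<open>n ^ k\<close>. By shifting
  units, a maximiser with positive product is balanced and so attains \<open>pmax k n\<close>;
  \<open>k <= n\<close> makes this value positive, which also gives the equality case.\<close>

lemma prod_le_pmax:
  fixes a :: "nat \<Rightarrow> nat"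
  assumes "0 < k" "k \<le> n" and sum: "(\<Sum>i<k. a i) = n"
  shows "(\<Prod>i<k. a i) \<le> pmax k n"
    and "(\<Prod>i<k. a i) = pmax k n \<Longrightarrow> i < k \<Longrightarrow> j < k \<Longrightarrow> a i \<le> a j + 1"
proof -
  define P :: "(nat \<Rightarrow> nat) \<Rightarrow> bool" where "P a \<longleftrightarrow> (\<Sum>i<k. a i) = n" for a
  define f :: "(nat \<Rightarrow> nat) \<Rightarrow> nat" where "f a = (\<Prod>i<k. a i)" for a
  have bound: "f b \<le> n ^ k" if "P b" for b
  proof -
    have "b i \<le> n" if "i < k" for i
      using \<open>P b\<close> that member_le_sum[of i "{..<k}" b] by (auto simp: P_def)
    then have "f b \<le> (\<Prod>i<k. n)" unfolding f_def by (intro prod_mono) auto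
    then show ?thesis by simp
  qed
  then have "\<forall>b. P b \<longrightarrow> f b < Suc (n ^ k)" by (simp add: less_Suc_eq_le)
  moreover have "P a" using sum by (simp add: P_def)
  ultimately obtain c where c: "P c" "\<And>b. P b \<Longrightarrow> f b \<le> f c"
    using ex_has_greatest_nat[of P a f "Suc (n ^ k)"] by blast
  have max_bal: "b i \<le> b j + 1" if b: "P b" "f c \<le> f b" "i < k" "j < k" "0 < f b" for b i j
  proof (rule ccontr)
    assume "\<not> ?thesis"
    moreover have "0 < b i" if "i < k" for i using b(5) that by (auto simp: f_def intro: Suc_leI gr0I)
    ultimately show False
      using prod_shift_less[of i k j b] b c(2)[of "b(i := b i - 1, j := b j + 1)"]
      by (auto simp: P_def f_def)
  qed
  have q: "0 < n div k" using assms(1,2) by (simp add: div_greater_zero_iff)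
  then have pos: "0 < pmax k n" by (simp add: pmax_def)
  define b where "b i = (if i < n mod k then Suc (n div k) else n div k)" for i
  have Pb: "P b" unfolding P_def b_def by (rule sum_balanced_sizes[OF assms(1)])
  have "f b = pmax k n" unfolding f_def
    using Pb by (intro prod_balanced assms) (auto simp: b_def P_def)
  then have fc: "0 < f c" using c(2)[OF Pb] pos by simp
  then have "c i \<le> c j + 1" if "i < k" "j < k" for i j using max_bal[OF c(1) order_refl that] by simp
  then have "f c = pmax k n" unfolding f_def
    using c(1) by (intro prod_balanced assms) (auto simp: P_def)
  then show "(\<Prod>i<k. a i) \<le> pmax k n" using c(2)[OF \<open>P a\<close>] by (simp add: f_def)
  assume "(\<Prod>i<k. a i) = pmax k n" "i < k" "j < k"
  then show "a i \<le> a j + 1" using max_bal[OF \<open>P a\<close>] \<open>f c = pmax k n\<close> pos by (simp add: f_def)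
qed

text \<open>Adding a unit raises one smallest factor by one, so the product grows by the product of
  the other \<open>k - 1\<close> factors. In the extremal argument this says how many cycles a
  vertex ought to lie on.\<close>

lemma pmax_Suc_ge:
  assumes "0 < k"
  shows "pmax k m + (Suc m div k) ^ (k - 1) \<le> pmax k (Suc m)"
proof (cases "Suc m mod k = 0")
  case True
  then obtain Q where Q: "Suc m = k * Q" by auto
  then have Q0: "0 < Q" by (cases Q) auto
  have "m = (k - 1) + k * (Q - 1)" using Q Q0 assms by (cases Q) auto
  then have "m div k = Q - 1" "m mod k = k - 1"
    using assms by (simp_all only: div_mult_self2 mod_mult_self2 mod_less diff_less less_one div_less not_gr0)
  then have "pmax k m + (Suc m div k) ^ (k - 1) = (Q - 1) * Q ^ (k - 1) + Q ^ (k - 1)"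
    using Q Q0 assms by (simp add: pmax_def)
  also have "\<dots> = Q * Q ^ (k - 1)" using Q0 by (cases Q) auto
  also have "\<dots> = Q ^ k" using assms by (cases k) auto
  also have "\<dots> = pmax k (Suc m)" using Q assms by (simp add: pmax_def)
  finally show ?thesis by simp
next
  case False
  define q r where "q = m div k" and "r = m mod k"
  have r: "Suc m mod k = Suc r" "Suc m div k = q" "r < k"
    using False assms by (auto simp: r_def q_def mod_Suc div_Suc split: if_splits)
  then have "Suc r < k" using mod_less_divisor[OF assms, of "Suc m"] by simp
  then obtain d where d: "k = Suc (r + d)" by (metis add_Suc less_iff_Suc_add less_SucI r(3))
  have "q ^ (r + d) = q ^ d * q ^ r" by (simp add: power_add)
  also have "\<dots> \<le> q ^ d * Suc q ^ r" by (intro mult_left_mono power_mono) auto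
  finally have "q ^ (r + d) \<le> q ^ d * Suc q ^ r" .
  moreover have kr: "k - r = Suc d" "k - Suc r = d" "k - 1 = r + d" using d by auto
  have "pmax k m = q ^ (k - r) * Suc q ^ r" by (simp add: pmax_def q_def r_def)
  then have "pmax k m = q * (q ^ d * Suc q ^ r)" by (simp add: kr)
  moreover have "pmax k (Suc m) = q ^ (k - Suc r) * Suc q ^ Suc r" unfolding pmax_def r(1,2) ..
  then have "pmax k (Suc m) = Suc q * (q ^ d * Suc q ^ r)" by (simp add: kr algebra_simps)
  ultimately show ?thesis unfolding r(2) kr by simp
qed

text \<open>The inequality of arithmetic and geometric means, where \<open>c\<close> need only bound
  the mean. It follows from \<open>a/c <= exp (a/c - 1)\<close> for every factor.\<close>

lemma prod_le_power_mean:
  fixes a :: "'b \<Rightarrow> real" and c :: real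
  assumes "finite I" "\<And>i. i \<in> I \<Longrightarrow> 0 \<le> a i" "(\<Sum>i\<in>I. a i) \<le> card I * c" "0 < c"
  shows "(\<Prod>i\<in>I. a i) \<le> c ^ card I"
proof -
  have "(\<Prod>i\<in>I. a i / c) \<le> (\<Prod>i\<in>I. exp (a i / c - 1))"
  proof (intro prod_mono conjI)
    fix i assume "i \<in> I"
    then show "0 \<le> a i / c" using assms by auto
    show "a i / c \<le> exp (a i / c - 1)" using exp_ge_add_one_self[of "a i / c - 1"] by simp
  qed
  also have "\<dots> = exp (\<Sum>i\<in>I. a i / c - 1)" using assms(1) by (simp only: exp_sum)
  also have "\<dots> = exp ((\<Sum>i\<in>I. a i) / c - card I)" by (simp add: sum_subtractf sum_divide_distrib)
  also have "\<dots> \<le> exp 0" using assms(3,4) by (subst exp_le_cancel_iff) (simp add: field_simps)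
  finally show ?thesis using assms(4) by (simp add: prod_dividef field_simps)
qed

lemma pmax_le_power:
  assumes "0 < k" "0 < n"
  shows "real (pmax k n) \<le> (real n / real k) ^ k"
proof -
  define b where "b i = (if i < n mod k then Suc (n div k) else n div k)" for i
  have sum: "(\<Sum>i<k. b i) = n" unfolding b_def by (rule sum_balanced_sizes[OF assms(1)])
  have "(\<Prod>i<k. b i) = pmax k n" using sum by (intro prod_balanced assms) (auto simp: b_def)
  then have "real (pmax k n) = (\<Prod>i<k. real (b i))" by (metis of_nat_prod)
  also have "\<dots> \<le> (real n / real k) ^ card {..<k}"
    using assms sum by (intro prod_le_power_mean) (auto simp flip: of_nat_sum)
  finally show ?thesis by simp
qed

text \<open>As \<open>n div k\<close> is at least \<open>n/k - 1 = n/k * (1 - k/n)\<close>,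
  Bernoulli's inequality loses at most \<open>j * k / n\<close>, and the threshold on
  \<open>n\<close> makes this at most \<open>\<delta>\<close>.\<close>

lemma floor_power_ge:
  fixes \<delta> :: real
  assumes "0 < k" "0 < \<delta>"
  shows "\<exists>n0. \<forall>n\<ge>n0. (1 - \<delta>) * (real n / real k) ^ j \<le> real (n div k) ^ j"
proof (intro exI allI impI)
  fix n assume n: "n \<ge> k + nat \<lceil>real j * real k / \<delta>\<rceil>"
  then have "real j * real k / \<delta> \<le> real n" "k \<le> n" by linarith+
  then have nj: "real j * (real k / real n) \<le> \<delta>" and kn: "real k / real n \<le> 1" and n0: "0 < real n"
    using assms by (auto simp: field_simps)
  have "real n \<le> real k * real (n div k) + real k"
  proof -
    have "n \<le> k * (n div k) + k" using mod_less_divisor[OF assms(1), of n] mult_div_mod_eq[of k n] by linarith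
    then show ?thesis by (metis of_nat_add of_nat_le_iff of_nat_mult)
  qed
  then have ge: "real n / real k * (1 - real k / real n) \<le> real (n div k)"
  proof -
    have "real n / real k * (1 - real k / real n) = real n / real k - 1" using assms n0 by (simp add: field_simps)
    then show ?thesis using \<open>real n \<le> _\<close> assms by (simp add: field_simps)
  qed
  have "1 - \<delta> \<le> 1 + real j * (- (real k / real n))" using nj by simp
  also have "\<dots> \<le> (1 + - (real k / real n)) ^ j" using kn by (intro Bernoulli_inequality) simp
  finally have "(1 - \<delta>) * (real n / real k) ^ j \<le> (1 - real k / real n) ^ j * (real n / real k) ^ j"
    by (intro mult_right_mono) auto
  also have "\<dots> = (real n / real k * (1 - real k / real n)) ^ j" by (metis power_mult_distrib mult.commute)
  also have "\<dots> \<le> real (n div k) ^ j" using ge kn by (intro power_mono) auto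
  finally show "(1 - \<delta>) * (real n / real k) ^ j \<le> real (n div k) ^ j" .
qed

lemma pmax_ge_power:
  assumes "0 < k" shows "(n div k) ^ k \<le> pmax k n"
proof -
  have "n mod k \<le> k" using assms by (simp add: less_imp_le)
  then have "(n div k) ^ k = (n div k) ^ (k - n mod k) * (n div k) ^ (n mod k)"
    by (simp flip: power_add)
  also have "\<dots> \<le> pmax k n" unfolding pmax_def by (intro mult_left_mono power_mono) auto
  finally show ?thesis .
qed

section \<open>Copies and labelled cycles\<close>

definition adj :: "'a graph \<Rightarrow> 'a rel" where
  "adj G = {(x, y). {x, y} \<in> edges G}"

lemma sym_adj: "sym (adj G)"
  by (auto simp: adj_def sym_def insert_commute)

lemma adj_subset: "simple_graph G \<Longrightarrow> adj G \<subseteq> verts G \<times> verts G"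
  by (auto simp: adj_def simple_graph_def)

lemma irrefl_adj: "simple_graph G \<Longrightarrow> irrefl (adj G)"
  by (force simp: adj_def simple_graph_def irrefl_def)

lemma edges_eq_adj:
  assumes "simple_graph G" shows "edges G = {{x, y} | x y. (x, y) \<in> adj G}"
  using assms by (auto simp: simple_graph_def adj_def card_2_iff) metis

lemma adj_cycle_graph: "adj (cycle_graph k) = cadj k"
  by (auto simp: adj_def cycle_graph_def cadj_def doubleton_eq_iff)

lemma cycles_mono: "R \<subseteq> S \<Longrightarrow> cycles m R \<subseteq> cycles m S"
  by (auto simp: cycles_def)

lemma set_cycles: "xs \<in> cycles m R \<Longrightarrow> R \<subseteq> V \<times> V \<Longrightarrow> set xs \<subseteq> V"
  by (fastforce simp: cycles_def in_set_conv_nth)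

lemma finite_cycles:
  assumes "finite V" "R \<subseteq> V \<times> V" shows "finite (cycles m R)"
proof -
  have "cycles m R \<subseteq> {xs. set xs \<subseteq> V \<and> length xs = m}"
    using set_cycles[OF _ assms(2)] by (auto simp: cycles_def)
  then show ?thesis using finite_lists_length_eq[OF assms(1)] by (rule finite_subset)
qed

lemma cycles_subset_hom_lists:
  assumes "R \<subseteq> V \<times> V" "\<And>x y. (x, y) \<in> R \<Longrightarrow> (cl x, cl y) \<in> cadj k"
  shows "cycles k R \<subseteq> hom_lists k cl V"
  using assms(2) set_cycles[OF _ assms(1)] by (auto simp: cycles_def hom_lists_def)

lemma cycles_blowup:
  assumes "odd k" "3 \<le> k"
  shows "cycles k {(x, y). x \<in> V \<and> y \<in> V \<and> (cl x, cl y) \<in> cadj k} = hom_lists k cl V"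
proof
  show "cycles k {(x, y). x \<in> V \<and> y \<in> V \<and> (cl x, cl y) \<in> cadj k} \<subseteq> hom_lists k cl V"
    by (rule cycles_subset_hom_lists) auto
  show "hom_lists k cl V \<subseteq> cycles k {(x, y). x \<in> V \<and> y \<in> V \<and> (cl x, cl y) \<in> cadj k}"
  proof
    fix xs assume xs: "xs \<in> hom_lists k cl V"
    then have "xs ! i \<in> V" if "i < k" for i using that by (auto simp: hom_lists_def)
    then show "xs \<in> cycles k {(x, y). x \<in> V \<and> y \<in> V \<and> (cl x, cl y) \<in> cadj k}"
      using xs distinct_hom_lists[OF assms xs] assms(2) by (auto simp: hom_lists_def cycles_def)
  qed
qed

lemma no_short_cycles_blowup:
  assumes "odd m" "m < k" "\<And>x y. (x, y) \<in> R \<Longrightarrow> (cl x, cl y) \<in> cadj k"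
  shows "cycles m R = {}"
proof (rule ccontr)
  assume "cycles m R \<noteq> {}"
  then obtain xs where xs: "xs \<in> cycles m R" by blast
  have m: "0 < m" using assms(1) by (rule odd_pos)
  define f where "f s = cl (xs ! (s mod m))" for s
  have "(f s, f (Suc s)) \<in> cadj k" if "s < m" for s
    using xs that assms(3) by (auto simp: f_def cycles_def)
  moreover have "f m = f 0" using m by (simp add: f_def)
  ultimately have "k \<le> m" using odd_closed_walk_cadj(1)[of m f k] assms(1) by blast
  then show False using assms(2) by simp
qed

definition cyc_graph :: "'a list \<Rightarrow> 'a graph" where
  "cyc_graph xs = (set xs, {{xs ! i, xs ! (Suc i mod length xs)} | i. i < length xs})"

lemma image_edges_cycle_graph:
  "(\<lambda>e. f ` e) ` edges (cycle_graph m) = {{f i, f (Suc i mod m)} | i. i < m}"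
proof -
  have "edges (cycle_graph m) = (\<lambda>i. {i, Suc i mod m}) ` {..<m}" by (auto simp: cycle_graph_def)
  then have "(\<lambda>e. f ` e) ` edges (cycle_graph m) = (\<lambda>i. {f i, f (Suc i mod m)}) ` {..<m}"
    by (simp add: image_image)
  then show ?thesis by auto
qed

lemma cyc_graph_in_copies:
  assumes "simple_graph G" "xs \<in> cycles m (adj G)"
  shows "cyc_graph xs \<in> copies (cycle_graph m) G"
proof -
  have xs: "length xs = m" "distinct xs" using assms by (auto simp: cycles_def)
  have sub: "edges (cyc_graph xs) \<subseteq> edges G"
    using assms(2) by (auto simp: cyc_graph_def cycles_def adj_def)
  have "e \<subseteq> set xs" if e: "e \<in> edges (cyc_graph xs)" for e
  proof -
    obtain i where "i < m" "e = {xs ! i, xs ! (Suc i mod m)}"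
      using e unfolding cyc_graph_def xs(1) snd_conv mem_Collect_eq by blast
    moreover from this have "Suc i mod m < m" by simp
    ultimately show ?thesis using xs by auto
  qed
  then have "simple_graph (cyc_graph xs)"
    using sub assms(1) by (auto simp: simple_graph_def cyc_graph_def)
  moreover have "verts (cyc_graph xs) \<subseteq> verts G"
    using set_cycles[OF assms(2) adj_subset[OF assms(1)]] by (simp add: cyc_graph_def)
  moreover have "graph_iso (cycle_graph m) (cyc_graph xs)"
    unfolding graph_iso_def image_edges_cycle_graph
    using bij_betw_nth[OF xs(2) refl refl] xs(1)
    by (intro exI[of _ "(!) xs"]) (simp add: cyc_graph_def cycle_graph_def)
  ultimately show ?thesis using sub by (simp add: copies_def subgraph_def)
qed

lemma copiesE:
  assumes "S \<in> copies (cycle_graph m) G"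
  obtains f where "bij_betw f {..<m} (verts S)" "edges S = {{f i, f (Suc i mod m)} | i. i < m}"
proof -
  obtain f where "bij_betw f (verts (cycle_graph m)) (verts S)" "edges S = (\<lambda>e. f ` e) ` edges (cycle_graph m)"
    using assms by (auto simp: copies_def graph_iso_def)
  then show thesis using that unfolding image_edges_cycle_graph by (simp add: cycle_graph_def)
qed

lemma graph_free_cycle_iff:
  assumes "simple_graph G"
  shows "graph_free (cycle_graph m) G \<longleftrightarrow> cycles m (adj G) = {}"
proof
  assume "graph_free (cycle_graph m) G"
  then show "cycles m (adj G) = {}" using cyc_graph_in_copies[OF assms] by (auto simp: graph_free_def)
next
  assume empty: "cycles m (adj G) = {}"
  show "graph_free (cycle_graph m) G" unfolding graph_free_def
  proof (rule ccontr)
    assume "copies (cycle_graph m) G \<noteq> {}"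
    then obtain S where S: "S \<in> copies (cycle_graph m) G" by blast
    then obtain f where f: "bij_betw f {..<m} (verts S)" "edges S = {{f i, f (Suc i mod m)} | i. i < m}"
      by (rule copiesE)
    have "edges S \<subseteq> edges G" using S by (auto simp: copies_def subgraph_def)
    moreover have "(f i, f (Suc i mod m)) \<in> adj S" if "i < m" for i
      using that f(2) by (auto simp: adj_def)
    ultimately have "(f i, f (Suc i mod m)) \<in> adj G" if "i < m" for i
      using that by (auto simp: adj_def)
    moreover have "distinct (map f [0..<m])"
      using f(1) by (simp add: distinct_map bij_betw_def lessThan_atLeast0)
    ultimately have "map f [0..<m] \<in> cycles m (adj G)" by (auto simp: cycles_def)
    then show False using empty by blast
  qed
qed

text \<open>A copy of \<open>C_k\<close> is itself a blow-up of \<open>C_k\<close> with singleton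
  parts, so the count of labelled cycles in blow-ups applies.\<close>

lemma card_cycles_copy:
  assumes "odd k" "3 \<le> k" "S \<in> copies (cycle_graph k) G"
  shows "card (cycles k (adj S)) = 2 * k"
proof -
  obtain f where f: "bij_betw f {..<k} (verts S)" "edges S = {{f i, f (Suc i mod k)} | i. i < k}"
    using assms(3) by (rule copiesE)
  define g where "g = the_inv_into {..<k} f"
  have g: "g (f i) = i" if "i < k" for i
    using f(1) that by (simp add: g_def bij_betw_def the_inv_into_f_f)
  have fg: "f (g x) = x \<and> g x < k" if "x \<in> verts S" for x
    using f(1) that g unfolding bij_betw_def by (metis imageE lessThan_iff)
  have fin: "finite (verts S)" using f(1) by (auto dest: bij_betw_finite)
  have "adj S = {(x, y). x \<in> verts S \<and> y \<in> verts S \<and> (g x, g y) \<in> cadj k}"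
  proof (intro equalityI subsetI; clarify)
    fix x y assume "(x, y) \<in> adj S"
    then obtain i where i: "i < k" "{x, y} = {f i, f (Suc i mod k)}" by (auto simp: adj_def f(2))
    then have i': "Suc i mod k < k" by simp
    then have "f i \<in> verts S" "f (Suc i mod k) \<in> verts S" using i f(1) by (auto simp: bij_betw_def)
    then show "x \<in> verts S \<and> y \<in> verts S \<and> (g x, g y) \<in> cadj k"
      using i i' g cadj_Suc[OF i(1)] sym_cadj[of k] by (auto simp: doubleton_eq_iff dest: symD)
  next
    fix x y assume *: "x \<in> verts S" "y \<in> verts S" "(g x, g y) \<in> cadj k"
    then have xy: "{x, y} = {f (g x), f (g y)}" "{x, y} = {f (g y), f (g x)}" using fg by auto
    have "g x < k" "g y < k" "g y = Suc (g x) mod k \<or> g x = Suc (g y) mod k"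
      using *(3) by (auto simp: cadj_def)
    then have "{x, y} \<in> edges S" unfolding f(2) mem_Collect_eq using xy by metis
    then show "(x, y) \<in> adj S" by (simp add: adj_def)
  qed
  then have "card (cycles k (adj S)) = card (hom_lists k g (verts S))"
    by (simp only: cycles_blowup[OF assms(1,2)])
  also have "\<dots> = 2 * k * (\<Prod>i<k. card {x \<in> verts S. g x = i})"
    by (rule card_hom_lists[OF assms(1,2) fin])
  also have "(\<Prod>i<k. card {x \<in> verts S. g x = i}) = (\<Prod>i<k. 1)"
  proof (intro prod.cong refl)
    fix i assume "i \<in> {..<k}"
    then have "{x \<in> verts S. g x = i} = {f i}" using fg g f(1) by (auto simp: bij_betw_def)
    then show "card {x \<in> verts S. g x = i} = 1" by simp
  qed
  finally show ?thesis by simp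
qed

text \<open>Both edge sets are injective images of the edge set of \<open>cycle_graph k\<close>;
  being of equal size, the inclusion between them is an equality. Hence labelled cycles of different
  copies are different.\<close>

lemma copy_eq_cyc_graph:
  assumes "S \<in> copies (cycle_graph k) G" "xs \<in> cycles k (adj S)"
  shows "S = cyc_graph xs"
proof -
  obtain f where f: "bij_betw f {..<k} (verts S)" "edges S = {{f i, f (Suc i mod k)} | i. i < k}"
    using assms(1) by (rule copiesE)
  have xs: "length xs = k" "distinct xs" using assms(2) by (auto simp: cycles_def)
  have S: "simple_graph S" using assms(1) by (auto simp: copies_def subgraph_def)
  have "set xs \<subseteq> verts S" using set_cycles[OF assms(2) adj_subset[OF S]] .
  moreover have "card (verts S) = card (set xs)"
    using bij_betw_same_card[OF f(1)] xs by (simp add: distinct_card)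
  ultimately have v: "set xs = verts S" using S by (intro card_subset_eq) (auto simp: simple_graph_def)
  have sub: "edges (cyc_graph xs) \<subseteq> edges S" using assms(2) by (auto simp: cyc_graph_def cycles_def adj_def)
  have pow: "edges (cycle_graph k) \<subseteq> Pow {..<k}" by (auto simp: cycle_graph_def)
  have "card (edges S) = card ((\<lambda>e. f ` e) ` edges (cycle_graph k))"
    by (simp add: f(2) image_edges_cycle_graph)
  also have "\<dots> = card (edges (cycle_graph k))"
    using f(1) by (intro card_image inj_on_subset[OF inj_on_image_Pow pow]) (auto simp: bij_betw_def)
  also have "\<dots> = card ((\<lambda>e. (!) xs ` e) ` edges (cycle_graph k))"
    using bij_betw_nth[OF xs(2) refl refl] xs(1)
    by (intro card_image[symmetric] inj_on_subset[OF inj_on_image_Pow pow]) (auto simp: bij_betw_def)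
  also have "\<dots> = card (edges (cyc_graph xs))"
    unfolding image_edges_cycle_graph by (simp add: cyc_graph_def xs(1))
  finally have "card (edges S) = card (edges (cyc_graph xs))" .
  moreover have "finite (edges S)" by (simp add: f(2))
  ultimately have "edges (cyc_graph xs) = edges S" using sub by (intro card_subset_eq) auto
  then show ?thesis using v by (auto simp: cyc_graph_def prod_eq_iff)
qed

lemma card_cycles_eq_num_copies:
  assumes "odd k" "3 \<le> k" "simple_graph G"
  shows "card (cycles k (adj G)) = 2 * k * num_copies (cycle_graph k) G"
proof -
  have "copies (cycle_graph k) G \<subseteq> Pow (verts G) \<times> Pow (Pow (verts G))"
    using assms(3) by (fastforce simp: copies_def subgraph_def simple_graph_def)
  then have fin: "finite (copies (cycle_graph k) G)"
    by (rule finite_subset) (use assms(3) in \<open>auto simp: simple_graph_def\<close>)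
  have "cycles k (adj G) = (\<Union>S\<in>copies (cycle_graph k) G. cycles k (adj S))"
  proof (intro equalityI subsetI)
    fix xs assume xs: "xs \<in> cycles k (adj G)"
    then have "xs \<in> cycles k (adj (cyc_graph xs))" by (auto simp: cycles_def adj_def cyc_graph_def)
    then show "xs \<in> (\<Union>S\<in>copies (cycle_graph k) G. cycles k (adj S))"
      using cyc_graph_in_copies[OF assms(3) xs] by blast
  next
    fix xs assume "xs \<in> (\<Union>S\<in>copies (cycle_graph k) G. cycles k (adj S))"
    then obtain S where "S \<in> copies (cycle_graph k) G" "xs \<in> cycles k (adj S)" by blast
    moreover from this have "adj S \<subseteq> adj G" by (auto simp: copies_def subgraph_def adj_def)
    ultimately show "xs \<in> cycles k (adj G)" using cycles_mono by blast
  qed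
  then have "card (cycles k (adj G)) = (\<Sum>S\<in>copies (cycle_graph k) G. card (cycles k (adj S)))"
  proof (simp only:, intro card_UN_disjoint ballI impI)
    fix S assume "S \<in> copies (cycle_graph k) G"
    then have "simple_graph S" by (auto simp: copies_def subgraph_def)
    moreover from this have "finite (verts S)" by (simp add: simple_graph_def)
    ultimately show "finite (cycles k (adj S))" using finite_cycles adj_subset by blast
  next
    fix S T assume "S \<in> copies (cycle_graph k) G" "T \<in> copies (cycle_graph k) G" "S \<noteq> T"
    then show "cycles k (adj S) \<inter> cycles k (adj T) = {}" using copy_eq_cyc_graph by blast
  qed (rule fin)
  also have "\<dots> = (\<Sum>S\<in>copies (cycle_graph k) G. 2 * k)"
    by (intro sum.cong refl card_cycles_copy[OF assms(1,2)])
  finally show ?thesis by (simp add: num_copies_def)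
qed

section \<open>Removing short odd cycles\<close>

lemma ex_constant_fibre:
  assumes "finite Y" "finite Z" "T ` Y \<subseteq> Z" "card Z * t < card Y"
  shows "\<exists>z\<in>Z. t < card {y \<in> Y. T y = z}"
proof (rule ccontr)
  assume "\<not> ?thesis"
  then have le: "card {y \<in> Y. T y = z} \<le> t" if "z \<in> Z" for z using that by force
  have "Y = (\<Union>z\<in>Z. {y \<in> Y. T y = z})" using assms(3) by auto
  then have "card Y \<le> (\<Sum>z\<in>Z. card {y \<in> Y. T y = z})" using card_UN_le[OF assms(2)] by metis
  also have "\<dots> \<le> card Z * t" using le sum_bounded_above[of Z "\<lambda>z. card {y \<in> Y. T y = z}" t] by simp
  finally show False using assms(4) by simp
qed

text \<open>Used backwards: a large sum forces many indices whose set has size at least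
  \<open>c\<close>.\<close>

lemma sum_card_threshold:
  fixes c b :: real
  assumes "finite V" "\<And>x. x \<in> V \<Longrightarrow> card (D x) \<le> b" "0 \<le> c"
  shows "(\<Sum>x\<in>V. real (card (D x))) \<le> card {x \<in> V. c \<le> card (D x)} * b + card V * c"
proof -
  let ?H = "{x \<in> V. c \<le> card (D x)}"
  have "(\<Sum>x\<in>V. real (card (D x))) = (\<Sum>x\<in>?H. real (card (D x))) + (\<Sum>x\<in>V - ?H. real (card (D x)))"
    using assms(1) by (subst sum.subset_diff[of ?H]) auto
  also have "(\<Sum>x\<in>?H. real (card (D x))) \<le> card ?H * b"
    using assms(2) by (intro sum_bounded_above) auto
  also have "(\<Sum>x\<in>V - ?H. real (card (D x))) \<le> card (V - ?H) * c"
    by (intro sum_bounded_above) auto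
  also have "card (V - ?H) * c \<le> card V * c"
    using assms(1,3) by (intro mult_right_mono) (auto intro: card_mono)
  finally show ?thesis by simp
qed

lemma card_Collect_snd_sum:
  assumes "finite V" "R \<subseteq> V \<times> V"
  shows "card R = (\<Sum>x\<in>V. card {y. (x, y) \<in> R})"
proof -
  have "R = Sigma V (\<lambda>x. {y. (x, y) \<in> R})" using assms(2) by auto
  moreover have "finite {y. (x, y) \<in> R}" for x
    by (rule finite_subset[OF _ assms(1)]) (use assms(2) in auto)
  ultimately show ?thesis using assms(1) card_SigmaI[of V "\<lambda>x. {y. (x, y) \<in> R}"] by simp
qed

text \<open>A constant number \<open>M\<close> of vertices of linear degree already share, by pigeonhole over the
  subsets of these \<open>M\<close> vertices, a linear common neighbourhood for some \<open>t\<close> of them.\<close>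

lemma dense_contains_biclique:
  fixes \<delta> :: real
  assumes "0 < \<delta>" "0 < t"
  shows "\<exists>n0. \<forall>(V :: 'a set) R. finite V \<and> n0 \<le> card V \<and> R \<subseteq> V \<times> V \<and> \<delta> * real (card V) ^ 2 \<le> card R
    \<longrightarrow> (\<exists>A B. finite A \<and> finite B \<and> card A = t \<and> card B = t \<and> A \<times> B \<subseteq> R)"
proof -
  \<comment> \<open>With \<open>M >= 4t/\<delta>\<close>, the vertices having fewer than
    \<open>t\<close> neighbours in \<open>X\<close> absorb at most half of the
    \<open>M * \<delta> * n / 2\<close> edges leaving \<open>X\<close>.\<close>
  define M where "M = nat \<lceil>4 * real t / \<delta>\<rceil>"
  have M: "4 * real t / \<delta> \<le> real M" unfolding M_def by linarith
  then have M0: "0 < M" using assms by (smt (verit) divide_pos_pos of_nat_0_less_iff)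
  \<comment> \<open>The first term provides \<open>M\<close> vertices of large degree; the second
    makes \<open>Y\<close>, of size at least \<open>\<delta> * n / 4\<close>, larger than
    \<open>2 ^ M * t\<close>, as the pigeonhole principle needs.\<close>
  define n0 where "n0 = nat \<lceil>2 * real M / \<delta>\<rceil> + nat \<lceil>4 * (2 ^ M * real t + 1) / \<delta>\<rceil> + 1"
  show ?thesis
  proof (intro exI[of _ n0] allI impI)
    fix V :: "'a set" and R
    assume asm: "finite V \<and> n0 \<le> card V \<and> R \<subseteq> V \<times> V \<and> \<delta> * real (card V) ^ 2 \<le> card R"
    define n where "n = real (card V)"
    have "2 * real M / \<delta> \<le> n" "4 * (2 ^ M * real t + 1) / \<delta> \<le> n" "0 < n"
      using asm unfolding n0_def n_def by linarith+
    then have n: "2 * real M \<le> \<delta> * n" "4 * (2 ^ M * real t + 1) \<le> \<delta> * n" "0 < n"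
      using assms(1) by (simp_all add: field_simps)
    have fin: "finite V" and R: "R \<subseteq> V \<times> V" and dense: "\<delta> * n ^ 2 \<le> card R"
      using asm by (auto simp: n_def)
    define N where "N x = {y. (x, y) \<in> R}" for x
    have N: "N x \<subseteq> V" for x using R by (auto simp: N_def)
    have cN: "card (N x) \<le> n" for x unfolding n_def using card_mono[OF fin N] by simp
    define H where "H = {x \<in> V. \<delta> * n / 2 \<le> card (N x)}"
    have "real (card R) = (\<Sum>x\<in>V. real (card (N x)))"
      using card_Collect_snd_sum[OF fin R] by (simp add: N_def)
    also have "\<dots> \<le> card H * n + n * (\<delta> * n / 2)"
      unfolding H_def n_def using cN assms(1) fin by (intro sum_card_threshold) (auto simp: n_def)
    finally have "\<delta> * n / 2 * n \<le> card H * n" using dense by (simp add: power2_eq_square algebra_simps)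
    then have "\<delta> * n / 2 \<le> card H" using n(3) by simp
    then have "M \<le> card H" using n(1) by linarith
    then obtain X where X: "X \<subseteq> H" "card X = M" "finite X"
      by (metis obtain_subset_with_card_n)
    define D where "D y = {x \<in> X. (x, y) \<in> R}" for y
    define Y where "Y = {y \<in> V. real t \<le> card (D y)}"
    have finY: "finite Y" using fin by (simp add: Y_def)
    have XV: "X \<subseteq> V" using X by (auto simp: H_def)
    have cD: "card (D y) \<le> M" for y
      unfolding D_def X(2)[symmetric] using X(3) by (intro card_mono) auto
    have "M * (\<delta> * n / 2) \<le> (\<Sum>x\<in>X. real (card (N x)))"
      using X sum_bounded_below[of X "\<delta> * n / 2" "\<lambda>x. real (card (N x))"] by (auto simp: H_def)
    also have "\<dots> = real (\<Sum>x\<in>X. card (N x))" by simp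
    also have "(\<Sum>x\<in>X. card (N x)) = card (Sigma X N)"
      using X(3) finite_subset[OF N fin] by (intro card_SigmaI[symmetric]) auto
    also have "\<dots> = card (Sigma V D)"
    proof -
      have "Sigma V D = prod.swap ` Sigma X N" using N by (auto simp: D_def N_def image_iff) blast
      then show ?thesis by (simp add: card_image)
    qed
    also have "\<dots> = (\<Sum>y\<in>V. card (D y))"
      using fin X(3) by (intro card_SigmaI) (auto simp: D_def)
    also have "real \<dots> = (\<Sum>y\<in>V. real (card (D y)))" by simp
    also have "\<dots> \<le> real (card Y) * real M + n * real t"
      unfolding Y_def n_def using cD fin by (intro sum_card_threshold) auto
    also have "n * real t \<le> M * (\<delta> * n / 4)"
    proof -
      have "4 * real t \<le> M * \<delta>" using M assms(1) by (simp add: field_simps)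
      then have "4 * real t * n \<le> M * \<delta> * n" using n(3) by (intro mult_right_mono) auto
      then show ?thesis by (simp add: algebra_simps)
    qed
    finally have "real M * (\<delta> * n / 4) \<le> real M * real (card Y)" by (simp add: algebra_simps)
    then have "\<delta> * n / 4 \<le> card Y" using M0 by simp
    then have "2 ^ M * real t < card Y" using n(2) by argo
    then have cY: "2 ^ M * t < card Y" by (metis of_nat_less_iff of_nat_mult of_nat_numeral of_nat_power)
    have "\<exists>T. T \<subseteq> D y \<and> card T = t" if "y \<in> Y" for y
    proof -
      have "t \<le> card (D y)" using that by (simp add: Y_def)
      then show ?thesis by (metis obtain_subset_with_card_n)
    qed
    then obtain T where T: "\<And>y. y \<in> Y \<Longrightarrow> T y \<subseteq> D y \<and> card (T y) = t" by metis
    have "T ` Y \<subseteq> Pow X" using T by (auto simp: D_def)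
    then obtain A where A: "A \<in> Pow X" "t < card {y \<in> Y. T y = A}"
      using ex_constant_fibre[of Y "Pow X" T t] finY X(2,3) cY by (auto simp: card_Pow)
    then obtain B where B: "B \<subseteq> {y \<in> Y. T y = A}" "card B = t" "finite B"
      using obtain_subset_with_card_n[OF less_imp_le[OF A(2)]] by blast
    have "B \<noteq> {}" using B(2) assms(2) by auto
    then obtain y where "y \<in> Y" "T y = A" using B(1) by blast
    then have "card A = t" using T by blast
    moreover have "A \<times> B \<subseteq> R"
    proof clarify
      fix a b assume "a \<in> A" "b \<in> B"
      then have "b \<in> Y" "a \<in> T b" using B(1) by auto
      then show "(a, b) \<in> R" using T by (auto simp: D_def)
    qed
    moreover have "finite A" using A(1) X(3) by (auto intro: finite_subset)
    ultimately show "\<exists>A B. finite A \<and> finite B \<and> card A = t \<and> card B = t \<and> A \<times> B \<subseteq> R"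
      using B by blast
  qed
qed

section \<open>Lengthening a cycle by a path inside a biclique\<close>

lemma card_less_imp_ex_notin:
  assumes "finite F" "card F < card A" shows "\<exists>a. a \<in> A \<and> a \<notin> F"
  using assms card_mono[of F A] by (metis leD subsetI)

abbreviation walk :: "'a rel \<Rightarrow> 'a list \<Rightarrow> bool" where
  "walk R \<equiv> successively (\<lambda>x y. (x, y) \<in> R)"

text \<open>Greedy: every induction step puts a fresh edge \<open>ab\<close> in front, and
  \<open>b\<close> is adjacent to the head of the rest, which lies in \<open>A\<close>. As
  \<open>A\<close> and \<open>B\<close> might meet, irreflexivity is what separates \<open>a\<close>
  from \<open>b\<close>.\<close>

lemma ex_alternating_path:
  assumes "sym R" "irrefl R" "A \<times> B \<subseteq> R" "finite F" "card F + 2 * Suc m \<le> card A" "card F + 2 * Suc m \<le> card B"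
  shows "\<exists>zs. length zs = 2 * Suc m \<and> distinct zs \<and> set zs \<inter> F = {} \<and> hd zs \<in> A \<and> last zs \<in> B \<and>
    walk R zs"
  using assms(4-)
proof (induction m arbitrary: F)
  case 0
  then obtain a where a: "a \<in> A" "a \<notin> F" using card_less_imp_ex_notin[of F A] by auto
  obtain b where b: "b \<in> B" "b \<notin> F" using 0 card_less_imp_ex_notin[of F B] by auto
  have "(a, b) \<in> R" "a \<noteq> b" using a b assms(2,3) by (auto simp: irrefl_def)
  then show ?case using a b by (intro exI[of _ "[a, b]"]) auto
next
  case (Suc m)
  then obtain a where a: "a \<in> A" "a \<notin> F" using card_less_imp_ex_notin[of F A] by auto
  obtain b where b: "b \<in> B" "b \<notin> F" using Suc.prems card_less_imp_ex_notin[of F B] by auto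
  have ab: "(a, b) \<in> R" "a \<noteq> b" using a b assms(2,3) by (auto simp: irrefl_def)
  have "card (insert a (insert b F)) \<le> card F + 2" using Suc.prems(1) by (simp add: card_insert_if)
  then obtain zs where zs: "length zs = 2 * Suc m" "distinct zs" "set zs \<inter> insert a (insert b F) = {}"
    "hd zs \<in> A" "last zs \<in> B" "walk R zs"
    using Suc.IH[of "insert a (insert b F)"] Suc.prems by auto
  have "zs \<noteq> []" using zs(1) by auto
  moreover have "(b, hd zs) \<in> R" using assms(1,3) b zs(4) by (auto dest: symD)
  ultimately show ?case using zs a b ab
    by (intro exI[of _ "a # b # zs"]) (auto simp: successively_Cons)
qed

lemma path_in_cycles:
  assumes "xs \<noteq> []" "distinct xs" "walk R xs" "(last xs, hd xs) \<in> R"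
  shows "xs \<in> cycles (length xs) R"
  unfolding cycles_def
proof (intro CollectI conjI refl assms(2) allI impI)
  fix i assume i: "i < length xs"
  show "(xs ! i, xs ! (Suc i mod length xs)) \<in> R"
  proof (cases "Suc i < length xs")
    case True
    then show ?thesis using assms(3) by (simp add: successively_conv_nth)
  next
    case False
    then have "i = length xs - 1" using i by linarith
    then show ?thesis using assms(1,4) i by (simp add: last_conv_nth hd_conv_nth)
  qed
qed

lemma rotate_in_cycles:
  assumes "xs \<in> cycles m R" shows "rotate s xs \<in> cycles m R"
proof -
  have xs: "length xs = m" "distinct xs" "\<And>i. i < m \<Longrightarrow> (xs ! i, xs ! (Suc i mod m)) \<in> R"
    using assms by (auto simp: cycles_def)
  have "(rotate s xs ! i, rotate s xs ! (Suc i mod m)) \<in> R" if i: "i < m" for i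
  proof -
    have "(Suc i mod m + s) mod m = Suc ((i + s) mod m) mod m"
      by (metis add_Suc mod_Suc_eq mod_add_left_eq)
    then show ?thesis using i xs(3)[of "(i + s) mod m"] by (simp add: nth_rotate xs(1) add.commute)
  qed
  then show ?thesis using xs(1,2) by (simp add: cycles_def)
qed

lemma cycles_successively:
  assumes "xs \<in> cycles m R" shows "walk R xs"
  using assms by (auto simp: cycles_def successively_conv_nth) (metis Suc_lessD mod_less)

text \<open>Rotating the cycle places the edge between the last and the first position; reversal
  supplies the other direction.\<close>

lemma cycle_edge_path:
  assumes "sym R" "xs \<in> cycles m R" "i < m" "(a, b) \<in> {(xs ! i, xs ! (Suc i mod m)), (xs ! (Suc i mod m), xs ! i)}"
  shows "\<exists>ps. length ps = m \<and> distinct ps \<and> walk R ps \<and> hd ps = a \<and> last ps = b"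
proof -
  define ys where "ys = rotate (Suc i) xs"
  have ys: "ys \<in> cycles m R" unfolding ys_def using assms(2) by (rule rotate_in_cycles)
  have len: "length xs = m" "length ys = m" using assms(2) ys by (auto simp: cycles_def)
  have ne: "ys \<noteq> []" using len assms(3) by auto
  have h: "hd ys = xs ! (Suc i mod m)" using ne len assms(3) by (simp add: ys_def hd_rotate_conv_nth del: rotate_Suc)
  have "m - 1 + Suc i = i + m" using assms(3) by simp
  then have l: "last ys = xs ! i" using ne len assms(3) 
    by (simp add: last_conv_nth) (simp add: ys_def nth_rotate add.commute del: rotate_Suc)
  have s: "walk R ys" "distinct ys" using ys cycles_successively by (auto simp: cycles_def)
  have r: "walk R (rev ys)"
    using s(1) assms(1) by (simp add: sym_def) (metis (mono_tags, lifting) successively_mono)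
  show ?thesis
  proof (cases "(a, b) = (xs ! i, xs ! (Suc i mod m))")
    case True
    then show ?thesis using s r h l len ne by (intro exI[of _ "rev ys"]) (auto simp: hd_rev last_rev)
  next
    case False
    then show ?thesis using s h l len assms(4) by (intro exI[of _ ys]) auto
  qed
qed

text \<open>Take \<open>R'\<close> maximal without short odd cycles. Every removed edge then closes an odd cycle of
  length at most \<open>k - 4\<close> in \<open>R\<close>; were the removed edges dense, they would contain a large biclique,
  and inserting an alternating path of the biclique lengthens such a cycle to \<open>k - 2\<close>.\<close>

lemma remove_short_odd_cycles:
  fixes \<delta> :: real
  assumes "odd k" "7 \<le> k" "0 < \<delta>"
  shows "\<exists>n0. \<forall>(V :: 'a set) R. finite V \<and> n0 \<le> card V \<and> R \<subseteq> V \<times> V \<and> sym R \<and> irrefl R \<and> cycles (k - 2) R = {}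
    \<longrightarrow> (\<exists>R'\<subseteq>R. sym R' \<and> (\<forall>m. odd m \<and> 3 \<le> m \<and> m < k \<longrightarrow> cycles m R' = {}) \<and>
          card (R - R') \<le> \<delta> * real (card V) ^ 2)"
proof -
  \<comment> \<open>Size \<open>2 * k\<close> leaves room for an alternating path of fewer than
    \<open>k\<close> vertices that avoids a cycle of fewer than \<open>k\<close> vertices.\<close>
  obtain n0 where n0: "\<And>(V :: 'a set) R. finite V \<and> n0 \<le> card V \<and> R \<subseteq> V \<times> V \<and> \<delta> * real (card V) ^ 2 \<le> card R
    \<Longrightarrow> \<exists>A B. finite A \<and> finite B \<and> card A = 2 * k \<and> card B = 2 * k \<and> A \<times> B \<subseteq> R"
    using dense_contains_biclique[of \<delta> "2 * k", where 'a = 'a] assms by auto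
  show ?thesis
  proof (intro exI[of _ n0] allI impI)
    fix V :: "'a set" and R
    assume asm: "finite V \<and> n0 \<le> card V \<and> R \<subseteq> V \<times> V \<and> sym R \<and> irrefl R \<and> cycles (k - 2) R = {}"
    have finR: "finite R" using asm by (auto intro: finite_subset)
    define P where "P S \<longleftrightarrow> S \<subseteq> R \<and> sym S \<and> (\<forall>m. odd m \<and> 3 \<le> m \<and> m < k \<longrightarrow> cycles m S = {})" for S
    have "cycles m {} = {}" if "3 \<le> m" for m using that by (fastforce simp: cycles_def)
    then have "P {}" by (auto simp: P_def sym_def)
    moreover have "\<forall>S. P S \<longrightarrow> card S < Suc (card R)"
      using finR by (auto simp: P_def less_Suc_eq_le intro: card_mono)
    ultimately obtain R' where R': "P R'" "\<And>S. P S \<Longrightarrow> card S \<le> card R'"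
      using ex_has_greatest_nat[of P "{}" card "Suc (card R)"] by blast
    have "card (R - R') \<le> \<delta> * real (card V) ^ 2"
    proof (rule ccontr)
      assume "\<not> ?thesis"
      then obtain A B where AB: "finite A" "finite B" "card A = 2 * k" "card B = 2 * k" "A \<times> B \<subseteq> R - R'"
        using n0[of V "R - R'"] asm by force
      then have "A \<noteq> {}" "B \<noteq> {}" using assms(2) by auto
      then obtain a b where ab: "a \<in> A" "b \<in> B" by blast
      define S where "S = insert (a, b) (insert (b, a) R')"
      have abR: "(a, b) \<in> R" "(b, a) \<in> R" "(a, b) \<notin> R'" using ab AB(5) asm by (auto dest: symD)
      have SR: "S \<subseteq> R" "sym S" using abR R'(1) by (auto simp: S_def P_def sym_def)
      have "R' \<subset> S" using abR by (auto simp: S_def)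
      moreover have "finite S" using SR(1) finR by (rule finite_subset)
      ultimately have "card R' < card S" by (simp add: psubset_card_mono)
      then have "\<not> P S" using R'(2)[of S] by auto
      then obtain m xs where m: "odd m" "3 \<le> m" "m < k" "xs \<in> cycles m S" using SR by (auto simp: P_def)
      have xsR: "xs \<in> cycles m R" using m(4) cycles_mono[OF SR(1)] by blast
      then have "m \<noteq> k - 2" using asm by auto
      \<comment> \<open>Both numbers are odd, so \<open>k - 2 - m\<close> is even and positive:
        exactly the number of vertices an alternating path can supply.\<close>
      then have "m < k - 2" using m(1,3) assms(1,2) by presburger
      have "xs \<notin> cycles m R'" using R'(1) m by (auto simp: P_def)
      then obtain i where i: "i < m" "(xs ! i, xs ! (Suc i mod m)) \<notin> R'" using m(4) by (auto simp: cycles_def)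
      moreover have "(xs ! i, xs ! (Suc i mod m)) \<in> S" using m(4) i(1) by (auto simp: cycles_def)
      ultimately have "(a, b) \<in> {(xs ! i, xs ! (Suc i mod m)), (xs ! (Suc i mod m), xs ! i)}"
        by (auto simp: S_def)
      then obtain ps where ps: "length ps = m" "distinct ps" "walk R ps"
          "hd ps = a" "last ps = b"
        using cycle_edge_path[OF _ xsR i(1)] asm by blast
      have "even (k - 2 - m)" using assms(1,2) m(1) \<open>m < k - 2\<close> by simp
      then obtain j where "k - 2 - m = 2 * j" by (blast elim: evenE)
      with \<open>m < k - 2\<close> obtain j where j: "k - 2 - m = 2 * Suc j" by (cases j) auto
      have "card (set ps) \<le> k" using ps(1,2) m(3) by (simp add: distinct_card)
      then have "card (set ps) + 2 * Suc j \<le> 2 * k" using j by linarith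
      then obtain zs where zs: "length zs = 2 * Suc j" "distinct zs" "set zs \<inter> set ps = {}" "hd zs \<in> A"
          "last zs \<in> B" "walk R zs"
        using ex_alternating_path[of R A B "set ps" j] asm AB by auto
      have ne: "zs \<noteq> []" "ps \<noteq> []" using zs(1) ps(1) m(2) by auto
      have "(b, hd zs) \<in> R" "(last zs, a) \<in> R" using ab AB(5) zs(4,5) asm by (auto dest: symD)
      then have "ps @ zs \<in> cycles (length (ps @ zs)) R"
        using ne ps zs by (intro path_in_cycles) (auto simp: successively_append_iff)
      moreover have "length (ps @ zs) = k - 2" using ps(1) zs(1) j \<open>m < k - 2\<close> by simp
      ultimately show False using asm by auto
    qed
    then show "\<exists>R'\<subseteq>R. sym R' \<and> (\<forall>m. odd m \<and> 3 \<le> m \<and> m < k \<longrightarrow> cycles m R' = {}) \<and>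
          card (R - R') \<le> \<delta> * real (card V) ^ 2"
      using R'(1) by (auto simp: P_def)
  qed
qed

text \<open>Induction on the length: a repeated vertex splits an odd closed walk into two closed
  walks, one of which is odd and shorter; without repetition the walk is a cycle. Length one is
  excluded by irreflexivity.\<close>

lemma odd_closed_walk_ge:
  assumes "irrefl R" and no_cycle: "\<And>m. odd m \<Longrightarrow> 3 \<le> m \<Longrightarrow> m < k \<Longrightarrow> cycles m R = {}"
    and "odd m" "(x, x) \<in> R ^^ m"
  shows "k \<le> m"
proof -
  have "k \<le> m" if "odd m" "\<And>i. i < m \<Longrightarrow> (f i, f (Suc i)) \<in> R" "f m = f 0" for f m
    using that
  proof (induction m arbitrary: f rule: less_induct)
    case (less m)
    show ?case
    proof (cases "inj_on f {..<m}")
      case True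
      have "m \<noteq> 1" using less.prems assms(1) by (auto simp: irrefl_def)
      then have "3 \<le> m" using less.prems(1) by presburger
      have "(f i, f (Suc i mod m)) \<in> R" if "i < m" for i
        using less.prems(2)[OF that] less.prems(3) that by (cases "Suc i = m") auto
      then have "map f [0..<m] \<in> cycles m R"
        using True by (auto simp: cycles_def distinct_map lessThan_atLeast0)
      then show ?thesis using no_cycle[OF less.prems(1) \<open>3 \<le> m\<close>] by fastforce
    next
      case False
      then obtain i j where ij: "i < j" "j < m" "f i = f j"
        by (auto simp: inj_on_def) (metis linorder_neqE_nat)
      show ?thesis
      proof (cases "odd (j - i)")
        case True
        have "k \<le> j - i"
          using less.prems ij True by (intro less.IH[of "j - i" "\<lambda>s. f (i + s)"]) auto
        then show ?thesis using ij by linarith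
      next
        case False
        \<comment> \<open>The even segment between the two visits at times \<open>i\<close> and
          \<open>j\<close> is cut out.\<close>
        define h where "h s = (if s \<le> i then f s else f (s + (j - i)))" for s
        have "(h s, h (Suc s)) \<in> R" if "s < m - (j - i)" for s
        proof -
          consider "s < i" | "s = i" | "i < s" by linarith
          then show ?thesis
          proof cases
            case 2
            then have "h s = f j" "h (Suc s) = f (Suc j)" using ij by (auto simp: h_def)
            then show ?thesis using less.prems(2) ij by simp
          qed (use less.prems(2) ij that in \<open>auto simp: h_def\<close>)
        qed
        moreover have "h (m - (j - i)) = h 0" using less.prems(3) ij by (auto simp: h_def)
        moreover have "odd (m - (j - i))" using less.prems(1) False ij by simp
        ultimately have "k \<le> m - (j - i)" using ij by (intro less.IH[of "m - (j - i)" h]) auto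
        then show ?thesis by linarith
      qed
    qed
  qed
  then show ?thesis using assms(3,4) by (auto simp: relpow_fun_conv)
qed

section \<open>Weighting the cycles of a graph without short odd cycles\<close>

text \<open>The summand is the probability that the list arises when every entry is picked uniformly
  from a set depending on the previous entries. The total may fall below one because the process
  stops at an empty set.\<close>

lemma sum_inverse_card_choices_le_1:
  fixes B :: "'a list \<Rightarrow> 'a set"
  assumes "\<And>zs. finite (B zs)"
  defines "S \<equiv> \<lambda>m. {zs. length zs = m \<and> (\<forall>i<m. zs ! i \<in> B (take i zs))}"
  shows "finite (S m) \<and> (\<Sum>zs\<in>S m. \<Prod>i<m. 1 / real (card (B (take i zs)))) \<le> 1"
proof (induction m)
  case 0
  have "S 0 = {[]}" by (auto simp: S_def)
  then show ?case by simp
next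
  case (Suc m)
  let ?a = "\<lambda>(zs, z). zs @ [z]"
  have S: "S (Suc m) = ?a ` Sigma (S m) B"
  proof (intro equalityI subsetI)
    fix zs assume zs: "zs \<in> S (Suc m)"
    then have ne: "zs \<noteq> []" by (auto simp: S_def)
    have len: "length (butlast zs) = m" using zs by (auto simp: S_def)
    have tk: "take i (butlast zs) = take i zs" if "i \<le> m" for i
      using zs that by (simp add: S_def take_butlast butlast_conv_take)
    have "butlast zs \<in> S m"
      using zs len tk by (auto simp: S_def nth_butlast)
    moreover have "last zs \<in> B (butlast zs)"
    proof -
      have "zs ! m \<in> B (take m zs)" using zs by (auto simp: S_def)
      then show ?thesis using zs ne by (simp add: S_def last_conv_nth butlast_conv_take)
    qed
    moreover have "zs = ?a (butlast zs, last zs)" using ne by simp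
    ultimately show "zs \<in> ?a ` Sigma (S m) B" by blast
  next
    fix zs assume "zs \<in> ?a ` Sigma (S m) B"
    then obtain ys y where "zs = ys @ [y]" "ys \<in> S m" "y \<in> B ys" by auto
    then show "zs \<in> S (Suc m)" by (auto simp: S_def nth_append less_Suc_eq)
  qed
  have inj: "inj_on ?a (Sigma (S m) B)" by (auto simp: inj_on_def)
  let ?w = "\<lambda>m zs. \<Prod>i<m. 1 / real (card (B (take i zs)))"
  have w: "?w (Suc m) (ys @ [y]) = ?w m ys * (1 / real (card (B ys)))" if "ys \<in> S m" for ys y
    using that by (auto simp: S_def intro!: prod.cong)
  have "(\<Sum>zs\<in>S (Suc m). ?w (Suc m) zs) = (\<Sum>p\<in>Sigma (S m) B. ?w (Suc m) (?a p))"
    unfolding S using inj by (rule sum.reindex_cong) auto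
  also have "\<dots> = (\<Sum>(ys, y)\<in>Sigma (S m) B. ?w m ys * (1 / real (card (B ys))))"
  proof (rule sum.cong[OF refl])
    fix p assume "p \<in> Sigma (S m) B"
    then obtain ys y where p: "p = (ys, y)" "ys \<in> S m" by blast
    show "?w (Suc m) (?a p) = (case p of (ys, y) \<Rightarrow> ?w m ys * (1 / real (card (B ys))))"
      unfolding p(1) split by (rule w[OF p(2)])
  qed
  also have "\<dots> = (\<Sum>ys\<in>S m. \<Sum>y\<in>B ys. ?w m ys * (1 / real (card (B ys))))"
    using Suc assms(1) by (intro sum.Sigma[symmetric]) auto
  also have "\<dots> = (\<Sum>ys\<in>S m. ?w m ys * (real (card (B ys)) * (1 / real (card (B ys)))))"
    by (intro sum.cong refl) (simp add: mult.left_commute)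
  \<comment> \<open>The factor is \<open>1\<close>, or \<open>0\<close> for an empty
    \<open>B ys\<close>, where \<open>1 / 0 = 0\<close>.\<close>
  also have "\<dots> \<le> (\<Sum>ys\<in>S m. ?w m ys * 1)"
    by (intro sum_mono mult_left_mono prod_nonneg) auto
  also have "\<dots> \<le> 1" using Suc by simp
  finally show ?case using S Suc assms(1) by simp
qed

lemma sum_card_swap:
  fixes k :: nat
  assumes "finite V"
  shows "(\<Sum>s<k. real (card {x \<in> V. P s x})) = (\<Sum>x\<in>V. real (card {s. s < k \<and> P s x}))"
proof -
  have "(\<Sum>s<k. real (card {x \<in> V. P s x})) = (\<Sum>s<k. \<Sum>x\<in>V. if P s x then 1 else 0)"
    using assms by (intro sum.cong refl) (simp add: sum.If_cases Int_def)
  also have "\<dots> = (\<Sum>x\<in>V. \<Sum>s<k. if P s x then 1 else 0)" by (rule sum.swap)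
  also have "\<dots> = (\<Sum>x\<in>V. real (card {s. s < k \<and> P s x}))"
    by (intro sum.cong refl) (simp add: sum.If_cases Int_def)
  finally show ?thesis .
qed

lemma sum_mod_shift:
  fixes g :: "nat \<Rightarrow> 'b::comm_monoid_add"
  assumes "0 < k"
  shows "(\<Sum>s<k. g ((s + a) mod k)) = (\<Sum>s<k. g s)"
  using sum.reindex_bij_betw[OF affine_mod_bij[of 1 k a], of g] assms by (simp add: add.commute)

lemma card_mod_shift:
  fixes k :: nat
  assumes "0 < k"
  shows "card {s. s < k \<and> P ((s + a) mod k)} = card {s. s < k \<and> P s}"
  using sum_mod_shift[OF assms, of "\<lambda>s. if P s then 1 else 0 :: nat" a]
  by (simp add: sum.If_cases Int_def)

lemma ex_increasing_enumeration:
  fixes T :: "nat set"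
  assumes "finite T" "m \<le> card T"
  shows "\<exists>f. (\<forall>i<m. f i \<in> T) \<and> (\<forall>i j. i < j \<longrightarrow> j < m \<longrightarrow> f i < f j)"
proof (intro exI conjI allI impI)
  let ?f = "(!) (sorted_list_of_set T)"
  show "?f i \<in> T" if "i < m" for i
    using assms that by (metis nth_mem set_sorted_list_of_set sorted_list_of_set.length_sorted_key_list_of_set less_le_trans)
  show "?f i < ?f j" if "i < j" "j < m" for i j
    using assms that sorted_wrt_nth_less[OF sorted_list_of_set.strict_sorted_key_list_of_set, of i j T]
    by simp
qed

text \<open>The assumption speaks of walks rather than cycles, so that contradictions can be derived
  from homomorphic images without checking that vertices are distinct. Its case \<open>m = 1\<close>
  excludes loops.\<close>

locale short_odd_free =
  fixes V :: "'a set" and R :: "'a rel" and k :: nat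
  assumes odd_k: "odd k" and k7: "7 \<le> k" and finV: "finite V" and RV: "R \<subseteq> V \<times> V" and symR: "sym R"
    and odd_walk: "\<And>m x. odd m \<Longrightarrow> (x, x) \<in> R ^^ m \<Longrightarrow> k \<le> m"
begin

abbreviation "N x \<equiv> {y. (x, y) \<in> R}"

lemma N_sub: "N x \<subseteq> V" using RV by auto

lemma finite_N: "finite (N x)" using N_sub finV by (rule finite_subset)

lemma k_pos: "0 < k" using k7 by simp

lemma no_closed_walk: "(x, x) \<notin> R ^^ (k - 2)"
  using odd_walk[of "k - 2" x] odd_k k7 by auto

lemma cycle_hom:
  assumes "xs \<in> cycles k R" "(i, j) \<in> cadj k ^^ m"
  shows "(xs ! i, xs ! j) \<in> R ^^ m"
  using assms(2)
proof (rule relpow_hom[where f = "(!) xs"])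
  fix i j assume "(i, j) \<in> cadj k"
  then show "(xs ! i, xs ! j) \<in> R" using assms(1) symR by (auto simp: cadj_def cycles_def dest: symD)
qed

section \<open>Positions of the neighbours of a vertex on a cycle\<close>

definition nbr_idx :: "'a list \<Rightarrow> 'a \<Rightarrow> nat set" where
  "nbr_idx xs x = {i. i < k \<and> (xs ! i, x) \<in> R}"

definition nbr2_idx :: "'a list \<Rightarrow> 'a \<Rightarrow> nat set" where
  "nbr2_idx xs x = {i. i < k \<and> (xs ! i, x) \<in> R O R}"

lemma finite_idx [simp]: "finite (nbr_idx xs x)" "finite (nbr2_idx xs x)"
  by (auto simp: nbr_idx_def nbr2_idx_def)

text \<open>A walk of length \<open>k - 4\<close> between two neighbours of \<open>x\<close> would
  close through \<open>x\<close> to one of length \<open>k - 2\<close>.\<close>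

lemma nbr_idx_diff:
  assumes "xs \<in> cycles k R" "i \<in> nbr_idx xs x" "j \<in> nbr_idx xs x" "i \<le> j"
  shows "j = i \<or> j = i + 2 \<or> j + 2 = i + k"
proof (rule not_cadj_relpow_minus_4[OF odd_k k7 assms(4)])
  show "j < k" using assms(3) by (simp add: nbr_idx_def)
  show "(i, j) \<notin> cadj k ^^ (k - 4)"
  proof
    assume "(i, j) \<in> cadj k ^^ (k - 4)"
    then have "(xs ! i, xs ! j) \<in> R ^^ (k - 4)" by (rule cycle_hom[OF assms(1)])
    moreover have "(x, xs ! i) \<in> R" "(xs ! j, x) \<in> R" using assms symR by (auto simp: nbr_idx_def dest: symD)
    ultimately have "(x, x) \<in> R ^^ Suc (Suc (k - 4))" by (blast intro: relpow_Suc_I relpow_Suc_I2)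
    moreover have "Suc (Suc (k - 4)) = k - 2" using k7 by simp
    ultimately show False using no_closed_walk by metis
  qed
qed

lemma nbr2_idx_diff:
  assumes "xs \<in> cycles k R" "i \<in> nbr2_idx xs x" "j \<in> nbr2_idx xs x" "i \<le> j"
  shows "j = i \<or> j = i + 2 \<or> j + 2 = i + k \<or> j = i + 4 \<or> j + 4 = i + k"
proof (rule not_cadj_relpow_minus_6[OF odd_k k7 assms(4)])
  show "j < k" using assms(3) by (simp add: nbr2_idx_def)
  show "(i, j) \<notin> cadj k ^^ (k - 6)"
  proof
    assume "(i, j) \<in> cadj k ^^ (k - 6)"
    then have "(xs ! i, xs ! j) \<in> R ^^ (k - 6)" by (rule cycle_hom[OF assms(1)])
    moreover obtain w where "(x, w) \<in> R" "(w, xs ! i) \<in> R" using assms symR by (auto simp: nbr2_idx_def dest: symD)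
    moreover obtain u where "(xs ! j, u) \<in> R" "(u, x) \<in> R" using assms by (auto simp: nbr2_idx_def)
    ultimately have "(x, x) \<in> R ^^ Suc (Suc (Suc (Suc (k - 6))))" by (blast intro: relpow_Suc_I relpow_Suc_I2)
    moreover have "Suc (Suc (Suc (Suc (k - 6)))) = k - 2" using k7 by simp
    ultimately show False using no_closed_walk by metis
  qed
qed

text \<open>Among three positions pairwise at cyclic distance two, the gaps would have to add up to
  \<open>2 + 2 = k - 2\<close>, impossible for \<open>k >= 7\<close>.\<close>

lemma card_nbr_idx:
  assumes "xs \<in> cycles k R"
  shows "card (nbr_idx xs x) \<le> 2"
proof (rule ccontr)
  assume "\<not> ?thesis"
  then have "3 \<le> card (nbr_idx xs x)" by simp
  then obtain f :: "nat \<Rightarrow> nat" where f: "\<And>i. i < 3 \<Longrightarrow> f i \<in> nbr_idx xs x" "\<And>i j. i < j \<Longrightarrow> j < 3 \<Longrightarrow> f i < f j"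
    using ex_increasing_enumeration[OF finite_idx(1)] by metis
  have lt: "f 0 < f 1" "f 1 < f 2" "f 2 < k" using f(1)[of 2] f(2) by (auto simp: nbr_idx_def)
  have "f 1 = f 0 + 2 \<or> f 1 + 2 = f 0 + k" "f 2 = f 1 + 2 \<or> f 2 + 2 = f 1 + k"
    "f 2 = f 0 + 2 \<or> f 2 + 2 = f 0 + k"
    using nbr_idx_diff[OF assms f(1) f(1), of 0 1] nbr_idx_diff[OF assms f(1) f(1), of 1 2]
      nbr_idx_diff[OF assms f(1) f(1), of 0 2] lt by auto
  then show False using lt k7 odd_k by auto
qed

text \<open>Among four positions the consecutive gaps are 2 or 4, so the outer two differ by an even
  number of at least 6. But their difference could then only be \<open>k - 2\<close> or
  \<open>k - 4\<close>, which are odd.\<close>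

lemma card_nbr2_idx:
  assumes "xs \<in> cycles k R"
  shows "card (nbr2_idx xs x) \<le> 3"
proof (rule ccontr)
  assume "\<not> ?thesis"
  then have "4 \<le> card (nbr2_idx xs x)" by simp
  then obtain f :: "nat \<Rightarrow> nat" where f: "\<And>i. i < 4 \<Longrightarrow> f i \<in> nbr2_idx xs x" "\<And>i j. i < j \<Longrightarrow> j < 4 \<Longrightarrow> f i < f j"
    using ex_increasing_enumeration[OF finite_idx(2)] by metis
  have lt: "f 0 < f 1" "f 1 < f 2" "f 2 < f 3" "f 3 < k" using f(1)[of 3] f(2) by (auto simp: nbr2_idx_def)
  have d: "f j = f i + 2 \<or> f j = f i + 4 \<or> f j + 2 = f i + k \<or> f j + 4 = f i + k" if "i < j" "j < 4" for i j
    using nbr2_idx_diff[OF assms f(1) f(1), of i j] f(2)[OF that] that by auto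
  have ge: "f i + 2 \<le> f j" if "i < j" "j < 4" for i j using d[OF that] k7 by auto
  have s: "f j = f i + 2 \<or> f j = f i + 4" if "(i, j) \<in> {(0, 1), (1, 2), (2, 3)}" for i j
  proof -
    \<comment> \<open>The other two gaps take up at least 4, so this gap is less than
      \<open>k - 4\<close>.\<close>
    have "f i + k > f j + 4" using that ge[of 0 1] ge[of 1 2] ge[of 2 3] lt by auto
    then show ?thesis using d[of i j] that by auto
  qed
  have "even (f 3 - f 0)" "6 \<le> f 3 - f 0" using s[of 0 1] s[of 1 2] s[of 2 3] by auto
  moreover have "f 3 + 2 = f 0 + k \<or> f 3 + 4 = f 0 + k" using d[of 0 3] \<open>6 \<le> f 3 - f 0\<close> by auto
  ultimately show False using odd_k lt by (auto simp: even_diff_nat) presburger+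
qed

lemma two_nbrs:
  assumes "xs \<in> cycles k R" "card (nbr_idx xs x) = 2"
  obtains i where "i < k" "nbr_idx xs x = {i, (i + 2) mod k}"
proof -
  obtain f :: "nat \<Rightarrow> nat" where f: "\<And>i. i < 2 \<Longrightarrow> f i \<in> nbr_idx xs x" "\<And>i j. i < j \<Longrightarrow> j < 2 \<Longrightarrow> f i < f j"
    using ex_increasing_enumeration[OF finite_idx(1), of 2 xs x] assms(2) by (metis order_refl)
  have lt: "f 0 < f 1" "f 1 < k" using f(1)[of 1] f(2)[of 0 1] by (auto simp: nbr_idx_def)
  have "{f 0, f 1} \<subseteq> nbr_idx xs x" "card {f 0, f 1} = 2" using f(1)[of 0] f(1)[of 1] lt by auto
  then have eq: "nbr_idx xs x = {f 0, f 1}" using assms(2) by (metis card_subset_eq finite_idx(1))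
  have "f 1 = f 0 + 2 \<or> f 1 + 2 = f 0 + k"
    using nbr_idx_diff[OF assms(1) f(1) f(1), of 0 1] lt by auto
  then show thesis
  proof
    assume "f 1 = f 0 + 2"
    then show thesis using that[of "f 0"] eq lt by simp
  next
    assume "f 1 + 2 = f 0 + k"
    then have "(f 1 + 2) mod k = f 0" using lt by simp
    then show thesis using that[of "f 1"] eq lt by (auto simp: insert_commute)
  qed
qed


text \<open>In a blow-up of \<open>C\<^sub>k\<close> the set \<open>cand v 1\<close> consists of two parts, and each later one of a single
  part. The map \<open>swp\<close> accounts for \<open>v\<^sub>3\<close> being chosen before \<open>v\<^sub>2\<close>.\<close>

definition cand :: "(nat \<Rightarrow> 'a) \<Rightarrow> nat \<Rightarrow> 'a set" where
  "cand v j = (if j = 0 then V else if j = 1 then N (v 0)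
     else if j = 2 then {x \<in> V. (v 1, x) \<in> R O R \<and> (v 0, x) \<notin> R}
     else if j = 3 then N (v 1) \<inter> N (v 3)
     else if j = k - 1 then N (v (k - 2)) \<inter> N (v 0)
     else N (v (j - 1)) - N (v (j - 3)))"

definition swp :: "nat \<Rightarrow> nat" where
  "swp i = (if i = 2 then 3 else if i = 3 then 2 else i)"

lemma swp_swp [simp]: "swp (swp i) = i" by (simp add: swp_def)

lemma swp_less: "i < k \<Longrightarrow> swp i < k" using k7 by (auto simp: swp_def)

lemma finite_cand: "finite (cand v j)"
  using finV finite_N by (auto simp: cand_def)

text \<open>The vertex \<open>v i\<close> is chosen in step \<open>swp i\<close>. So the candidate
  set of step \<open>j\<close> depends only on earlier choices, which is what makes the random
  process well defined.\<close>

lemma cand_cong: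
  assumes "\<And>i. swp i < j \<Longrightarrow> v i = w i" "j < k"
  shows "cand v j = cand w j"
proof -
  have *: "v i = w i" if "swp i < j" for i using assms(1) that .
  consider "j = 0" | "j = 1" | "j = 2" | "j = 3" | "4 \<le> j" "j = k - 1" | "4 \<le> j" "j \<noteq> k - 1" by linarith
  then show ?thesis
  proof cases
    case 2 then show ?thesis using *[of 0] by (simp add: cand_def swp_def)
  next
    case 3 then show ?thesis using *[of 0] *[of 1] by (simp add: cand_def swp_def)
  next
    case 4 then show ?thesis using *[of 1] *[of 3] by (simp add: cand_def swp_def)
  next
    case 5
    then have "swp (k - 2) < j" "swp 0 < j" using k7 by (auto simp: swp_def)
    then show ?thesis using *[of 0] *[of "k - 2"] 5 k7 by (simp add: cand_def)
  next
    case 6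
    have "swp (j - 1) < j" "swp (j - 3) < j" using 6 by (auto simp: swp_def)
    then show ?thesis using *[of "j - 1"] *[of "j - 3"] 6 by (simp add: cand_def)
  qed (simp add: cand_def)
qed

text \<open>Positions at distance three are joined by the even arc of length \<open>k - 3\<close>,
  which a chord would close to length \<open>k - 2\<close>.\<close>

lemma no_chord:
  assumes "xs \<in> cycles k R" "i + 3 < k"
  shows "(xs ! i, xs ! (i + 3)) \<notin> R"
proof
  assume "(xs ! i, xs ! (i + 3)) \<in> R"
  then have *: "(xs ! (i + 3), xs ! i) \<in> R" using symR by (auto dest: symD)
  have "(i, i + 3) \<in> cadj k ^^ (k - 3)" using assms(2) k7 by (intro cadj_relpow_le) auto
  then have "(xs ! i, xs ! i) \<in> R ^^ Suc (k - 3)"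
    using cycle_hom[OF assms(1)] * by (blast intro: relpow_Suc_I)
  moreover have "Suc (k - 3) = k - 2" using k7 by simp
  ultimately show False using no_closed_walk by metis
qed

text \<open>Every cycle can arise in the random process. The sets removed from the candidates
  contain no vertex of the cycle that is due, because there are no chords between positions at
  distance three.\<close>

lemma cand_mem:
  assumes "xs \<in> cycles k R" "j < k"
  shows "xs ! swp j \<in> cand ((!) xs) j"
proof -
  have e: "(xs ! i, xs ! Suc i) \<in> R" if "Suc i < k" for i
    using assms(1) that by (auto simp: cycles_def) (metis Suc_lessD mod_less)
  have e': "(xs ! Suc i, xs ! i) \<in> R" if "Suc i < k" for i using e[OF that] symR by (auto dest: symD)
  have V: "xs ! i \<in> V" if "i < k" for i
    using set_cycles[OF assms(1) RV] assms(1) that by (auto simp: cycles_def)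
  consider "j = 0" | "j = 1" | "j = 2" | "j = 3" | "4 \<le> j" "j = k - 1" | "4 \<le> j" "j \<noteq> k - 1" by linarith
  then show ?thesis
  proof cases
    case 1 then show ?thesis using V[of 0] k7 by (simp add: cand_def swp_def)
  next
    case 2 then show ?thesis using e[of 0] k7 by (simp add: cand_def swp_def)
  next
    case 3
    then show ?thesis using e[of 1] e[of 2] V[of 3] no_chord[OF assms(1), of 0] k7
      by (auto simp: cand_def swp_def numeral_3_eq_3 numeral_2_eq_2)
  next
    case 4
    then show ?thesis using e[of 1] e'[of 2] k7 by (simp add: cand_def swp_def numeral_3_eq_3 numeral_2_eq_2)
  next
    case 5
    have "Suc (k - 1) mod k = 0" "k - 1 < k" using k7 by simp_all
    moreover have "\<forall>i<k. (xs ! i, xs ! (Suc i mod k)) \<in> R" using assms(1) by (simp add: cycles_def)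
    ultimately have "(xs ! (k - 1), xs ! 0) \<in> R" by metis
    then have "(xs ! 0, xs ! (k - 1)) \<in> R" using symR by (auto dest: symD)
    moreover have "Suc (k - 2) = k - 1" using k7 by simp
    ultimately show ?thesis using 5 e[of "k - 2"] k7 by (simp add: cand_def swp_def)
  next
    case 6
    then have "Suc (j - 1) = j" "j - 3 + 3 = j" by auto
    then show ?thesis using 6 e[of "j - 1"] no_chord[OF assms(1), of "j - 3"] assms(2)
      by (simp add: cand_def swp_def)
  qed
qed

definition weight :: "'a list \<Rightarrow> real" where
  "weight xs = (\<Prod>j<k. 1 / real (card (cand ((!) xs) j)))"

text \<open>The weight of a cycle is the probability that it arises by choosing its vertices at random in
  the order \<open>v\<^sub>0, v\<^sub>1, v\<^sub>3, v\<^sub>2, v\<^sub>4, \<dots>\<close>, each uniformly from its candidate set.\<close>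

lemma sum_weight_le_1: "(\<Sum>xs\<in>cycles k R. weight xs) \<le> 1"
proof -
  \<comment> \<open>The prefix \<open>zs\<close> lists the vertices in the order of choice; entries
    beyond its length are unspecified, but the candidate set does not look at them.\<close>
  define B where "B zs = cand (\<lambda>i. zs ! swp i) (length zs)" for zs
  define S where "S = {zs. length zs = k \<and> (\<forall>i<k. zs ! i \<in> B (take i zs))}"
  define pick where "pick xs = map (\<lambda>i. xs ! swp i) [0..<k]" for xs :: "'a list"
  have S: "finite S" "(\<Sum>zs\<in>S. \<Prod>i<k. 1 / real (card (B (take i zs)))) \<le> 1"
    using sum_inverse_card_choices_le_1[of B k] finite_cand by (auto simp: S_def B_def)
  have B: "B (take j (pick xs)) = cand ((!) xs) j" if "j < k" for xs j
  proof -
    have "length (take j (pick xs)) = j" using that by (simp add: pick_def)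
    moreover have "take j (pick xs) ! swp i = xs ! i" if "swp i < j" for i
      using that \<open>j < k\<close> by (simp add: pick_def)
    ultimately have "cand (\<lambda>i. take j (pick xs) ! swp i) j = cand ((!) xs) j"
      using that by (intro cand_cong) simp_all
    then show ?thesis unfolding B_def \<open>length (take j (pick xs)) = j\<close> .
  qed
  have sub: "pick ` cycles k R \<subseteq> S"
  proof
    fix zs assume "zs \<in> pick ` cycles k R"
    then obtain xs where xs: "xs \<in> cycles k R" "zs = pick xs" by blast
    have "pick xs ! i \<in> B (take i (pick xs))" if "i < k" for i
      using cand_mem[OF xs(1) that] B[OF that] that by (simp add: pick_def)
    then show "zs \<in> S" by (simp add: S_def xs(2) pick_def)
  qed
  have inj: "inj_on pick (cycles k R)"
  proof (rule inj_onI)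
    fix xs ys assume *: "xs \<in> cycles k R" "ys \<in> cycles k R" "pick xs = pick ys"
    have "xs ! i = ys ! i" if "i < k" for i
    proof -
      have "pick xs ! swp i = pick ys ! swp i" using *(3) by simp
      then show ?thesis using swp_less[OF that] by (simp add: pick_def)
    qed
    then show "xs = ys" using * by (auto simp: cycles_def intro: nth_equalityI)
  qed
  have "(\<Sum>xs\<in>cycles k R. weight xs) = (\<Sum>xs\<in>cycles k R. \<Prod>i<k. 1 / real (card (B (take i (pick xs)))))"
    using B by (simp add: weight_def)
  also have "\<dots> = (\<Sum>zs\<in>pick ` cycles k R. \<Prod>i<k. 1 / real (card (B (take i zs))))"
    using inj by (simp add: sum.reindex)
  also have "\<dots> \<le> (\<Sum>zs\<in>S. \<Prod>i<k. 1 / real (card (B (take i zs))))"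
    using S(1) sub by (intro sum_mono2 prod_nonneg) auto
  finally show ?thesis using S(2) by simp
qed

text \<open>The first set is halved because in a blow-up it consists of two parts. All
  \<open>k - 1\<close> terms then amount to one part each.\<close>

definition total_cand :: "'a list \<Rightarrow> real" where
  "total_cand xs = real (card (cand ((!) xs) 1)) / 2 + (\<Sum>j=2..<k. real (card (cand ((!) xs) j)))"

text \<open>With \<open>y j\<close> the normalised sizes, \<open>\<Prod> 1 / y j >= exp (\<Sum> (1 -
  y j)) >= 1 + \<Sum> (1 - y j)\<close>. This linear form of the inequality of means is chosen
  because only the average of \<open>total_cand\<close> over rotations can be controlled.\<close>

lemma weight_ge:
  assumes "xs \<in> cycles k R"
  defines "n \<equiv> real (card V)"
  shows "(k / n) ^ (k - 1) / (2 * n) * (k - k / n * total_cand xs) \<le> weight xs"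
proof -
  have c0: "0 < card (cand ((!) xs) j)" if "j < k" for j
    using cand_mem[OF assms(1) that] finite_cand by (auto simp: card_gt_0_iff)
  then have n: "0 < n" using c0[of 0] k7 by (simp add: n_def cand_def)
  define c where "c j = (if j = 1 then card (cand ((!) xs) 1) / 2 else real (card (cand ((!) xs) j)))" for j
  have cpos: "0 < c j" if "j < k" for j using c0[OF that] c0[of 1] k7 by (auto simp: c_def)
  define y where "y j = c j * (k / n)" for j
  have ypos: "0 < y j" if "j < k" for j using cpos[OF that] n k7 by (simp add: y_def)
  have I: "{..<k} = insert 0 {1..<k}" "{1..<k} = insert 1 {2..<k}" using k7 by auto
  have "weight xs = 1 / n * (\<Prod>j\<in>{1..<k}. 1 / real (card (cand ((!) xs) j)))"
    unfolding weight_def I(1) by (simp add: cand_def n_def)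
  also have "(\<Prod>j\<in>{1..<k}. 1 / real (card (cand ((!) xs) j))) = (\<Prod>j\<in>{1..<k}. 1 / c j) / 2"
    unfolding I(2) by (simp add: c_def)
  also have "(\<Prod>j\<in>{1..<k}. 1 / c j) = (\<Prod>j\<in>{1..<k}. k / n * (1 / y j))"
    using n k7 by (intro prod.cong) (auto simp: y_def)
  also have "\<dots> = (k / n) ^ (k - 1) * (\<Prod>j\<in>{1..<k}. 1 / y j)"
    by (simp only: prod.distrib prod_constant card_atLeastLessThan)
  finally have w: "weight xs = (k / n) ^ (k - 1) / (2 * n) * (\<Prod>j\<in>{1..<k}. 1 / y j)" by simp
  have "k - k / n * total_cand xs = 1 + (\<Sum>j\<in>{1..<k}. 1 - y j)"
  proof -
    have "(\<Sum>j\<in>{1..<k}. y j) = k / n * (\<Sum>j\<in>{1..<k}. c j)"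
      by (simp add: y_def sum_distrib_left mult.commute)
    also have "(\<Sum>j\<in>{1..<k}. c j) = total_cand xs"
      unfolding I(2) total_cand_def by (simp add: c_def)
    finally show ?thesis using k7 by (simp add: sum_subtractf of_nat_diff)
  qed
  also have "\<dots> \<le> exp (\<Sum>j\<in>{1..<k}. 1 - y j)" by (rule exp_ge_add_one_self)
  also have "\<dots> = (\<Prod>j\<in>{1..<k}. exp (1 - y j))" by (rule exp_sum) simp
  also have "\<dots> \<le> (\<Prod>j\<in>{1..<k}. 1 / y j)"
  proof (intro prod_mono conjI)
    fix j assume "j \<in> {1..<k}"
    then have yj: "0 < y j" using ypos by simp
    have "y j \<le> exp (y j - 1)" using exp_ge_add_one_self[of "y j - 1"] by simp
    then have "y j * exp (1 - y j) \<le> exp (y j - 1) * exp (1 - y j)" by (intro mult_right_mono) auto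
    also have "\<dots> = 1" by (simp flip: exp_add)
    finally show "exp (1 - y j) \<le> 1 / y j" using yj by (simp add: field_simps)
  qed simp
  finally have "k - k / n * total_cand xs \<le> (\<Prod>j\<in>{1..<k}. 1 / y j)" .
  then show ?thesis unfolding w using n by (intro mult_left_mono) auto
qed

section \<open>Averaging the candidate sets over all rotations\<close>

definition exceptional :: "'a list \<Rightarrow> 'a set" where
  "exceptional xs = {x \<in> V. card (nbr_idx xs x) \<noteq> 2}"

lemma nbr_idx_shift:
  assumes "xs \<in> cycles k R" "s \<in> nbr_idx xs x"
  shows "(s + 1) mod k \<in> nbr2_idx xs x"
proof -
  have s: "s < k" "(xs ! s, x) \<in> R" using assms(2) by (auto simp: nbr_idx_def)
  then have "(xs ! (Suc s mod k), xs ! s) \<in> R" using assms(1) symR by (auto simp: cycles_def dest: symD)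
  then show ?thesis using s k_pos by (auto simp: nbr2_idx_def)
qed

text \<open>How often \<open>x\<close> is a candidate over all rotations: in steps 1 (halved), 2,
  then 3 and \<open>k - 1\<close>, then the \<open>k - 5\<close> others. With two neighbours on the
  cycle the extreme case is \<open>1 + 1 + 2 + (k - 5) = k - 1\<close>. The deficit
  \<open>3 / 2\<close> is attained with a single neighbour: \<open>1 / 2 + 2 + (k - 5)\<close>. The
  remaining cases are where \<open>k >= 7\<close> enters.\<close>

lemma vertex_count:
  fixes xs x
  defines "T \<equiv> nbr2_idx xs x" and "M \<equiv> nbr_idx xs x"
  assumes "xs \<in> cycles k R"
  shows "real (card M) / 2 + real (card {s. s < k \<and> (s + 1) mod k \<in> T \<and> s \<notin> M})
      + 2 * real (card {s. s < k \<and> s \<in> M \<and> (s + 2) mod k \<in> M})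
      + (real k - 5) * real (card {s. s < k \<and> (s + 2) mod k \<in> M \<and> s \<notin> M})
    \<le> real k - 1 - (if card M = 2 then 0 else 3 / 2)"
proof -
  define b c d where "b = card {s. s < k \<and> (s + 1) mod k \<in> T \<and> s \<notin> M}"
    and "c = card {s. s < k \<and> s \<in> M \<and> (s + 2) mod k \<in> M}"
    and "d = card {s. s < k \<and> (s + 2) mod k \<in> M \<and> s \<notin> M}"
  have fin: "finite {s. s < k \<and> P s}" for P by simp
  have Mk: "M = {s. s < k \<and> s \<in> M}" and Tk: "T = {s. s < k \<and> s \<in> T}"
    by (auto simp: M_def T_def nbr_idx_def nbr2_idx_def)
  \<comment> \<open>The positions next to those in \<open>T\<close> include all of \<open>M\<close>;
    hence at most \<open>3 - card M\<close> of them lie outside \<open>M\<close>.\<close>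
  have "{s. s < k \<and> (s + 1) mod k \<in> T} = {s. s < k \<and> (s + 1) mod k \<in> T \<and> s \<notin> M} \<union> M"
    using nbr_idx_shift[OF assms(3)] by (auto simp: M_def T_def nbr_idx_def)
  then have "card {s. s < k \<and> (s + 1) mod k \<in> T} = b + card M"
    unfolding b_def by (simp add: M_def) (subst card_Un_disjoint, auto)
  moreover have "card {s. s < k \<and> (s + 1) mod k \<in> T} = card T"
    using card_mod_shift[OF k_pos, of "\<lambda>s. s \<in> T" 1] Tk by simp
  moreover have "card T \<le> 3" unfolding T_def using assms(3) by (rule card_nbr2_idx)
  ultimately have b: "b + card M \<le> 3" by simp
  have "{s. s < k \<and> (s + 2) mod k \<in> M} =
      {s. s < k \<and> s \<in> M \<and> (s + 2) mod k \<in> M} \<union> {s. s < k \<and> (s + 2) mod k \<in> M \<and> s \<notin> M}" by auto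
  then have "card {s. s < k \<and> (s + 2) mod k \<in> M} = c + d"
    unfolding c_def d_def by (simp only:) (subst card_Un_disjoint, auto)
  moreover have "card {s. s < k \<and> (s + 2) mod k \<in> M} = card M"
    using card_mod_shift[OF k_pos, of "\<lambda>s. s \<in> M" 2] Mk by simp
  ultimately have cd: "c + d = card M" by simp
  have M2: "card M \<le> 2" unfolding M_def using assms(3) by (rule card_nbr_idx)
  \<comment> \<open>Two neighbours sit at positions \<open>i\<close> and \<open>i + 2\<close> modulo
    \<open>k\<close>, so \<open>i\<close> is counted by \<open>c\<close>.\<close>
  have c1: "1 \<le> c" if M2: "card M = 2"
  proof -
    obtain i where "i < k" "M = {i, (i + 2) mod k}"
      using two_nbrs[OF assms(3), of x] M2 unfolding M_def by metis
    then have "i \<in> {s. s < k \<and> s \<in> M \<and> (s + 2) mod k \<in> M}" by auto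
    then show ?thesis unfolding c_def by (metis card_0_eq empty_iff fin less_one not_le)
  qed
  have k: "7 \<le> real k" using k7 by simp
  have "d = 0 \<or> d = 1" using cd M2 c1 by linarith
  then have "real (card M) / 2 + real b + 2 * real c + (real k - 5) * real d
      \<le> real k - 1 - (if card M = 2 then 0 else 3 / 2)"
    using b cd M2 c1 k by auto
  then show ?thesis by (simp only: b_def c_def d_def)
qed

text \<open>Double counting: after rotation by \<open>s\<close> every candidate set is described by
  a condition at one shifted position. Summing over all \<open>s\<close> removes the shift, and
  exchanging sums leaves one bound for each vertex.\<close>

lemma sum_total_cand_rotate:
  assumes xs: "xs \<in> cycles k R"
  shows "(\<Sum>s<k. total_cand (rotate s xs)) \<le> (real k - 1) * card V - 3 / 2 * card (exceptional xs)"
proof -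
  define M T where "M x = nbr_idx xs x" and "T x = nbr2_idx xs x" for x
  \<comment> \<open>Candidacy in step 1, step 2, steps 3 and \<open>k - 1\<close>, and the steps
    from 4 to \<open>k - 2\<close>, each stated at a base position \<open>s\<close>.\<close>
  define A B C D where "A s x \<longleftrightarrow> s \<in> M x"
    and "B s x \<longleftrightarrow> (s + 1) mod k \<in> T x \<and> s \<notin> M x"
    and "C s x \<longleftrightarrow> s \<in> M x \<and> (s + 2) mod k \<in> M x"
    and "D s x \<longleftrightarrow> (s + 2) mod k \<in> M x \<and> s \<notin> M x" for s x
  define c where "c P s = real (card {x \<in> V. P s x})" for P :: "nat \<Rightarrow> 'a \<Rightarrow> bool" and s
  note defs = c_def A_def B_def C_def D_def M_def T_def nbr_idx_def nbr2_idx_def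
  have len: "length xs = k" using xs by (simp add: cycles_def)
  have rot: "rotate s xs ! i = xs ! ((s + i) mod k)" if "i < k" for s i
    using that by (simp add: nth_rotate len add.commute)
  have mm: "((s + i) mod k + j) mod k = (s + (i + j)) mod k" for s i j
    by (simp add: mod_add_left_eq add.assoc)
  have sets: "N (xs ! i) = {x \<in> V. A i x}" "N (xs ! i) \<inter> N (xs ! ((i + 2) mod k)) = {x \<in> V. C i x}"
    "N (xs ! ((i + 2) mod k)) - N (xs ! i) = {x \<in> V. D i x}" if "i < k" for i
    using that RV k_pos by (auto simp: defs)
  have t1: "real (card (cand ((!) (rotate s xs)) 1)) = c A s" if "s < k" for s
    using rot[of 0 s] k7 that by (simp add: cand_def c_def sets)
  have t2: "real (card (cand ((!) (rotate s xs)) 2)) = c B s" if "s < k" for s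
    using rot[of 0 s] rot[of 1 s] k7 that by (simp add: cand_def defs)
  have t3: "real (card (cand ((!) (rotate s xs)) 3)) = c C ((s + 1) mod k)" if "s < k" for s
  proof -
    have "((s + 1) mod k + 2) mod k = (s + 3) mod k" unfolding mm by (simp add: numeral_3_eq_3)
    then have "cand ((!) (rotate s xs)) 3 = {x \<in> V. C ((s + 1) mod k) x}"
      using rot[of 1 s] rot[of 3 s] k7 sets(2)[of "(s + 1) mod k"] by (simp add: cand_def)
    then show ?thesis by (simp add: c_def)
  qed
  have tl: "real (card (cand ((!) (rotate s xs)) (k - 1))) = c C ((s + (k - 2)) mod k)" if "s < k" for s
  proof -
    have "k - 2 + 2 = k" using k7 by simp
    then have "((s + (k - 2)) mod k + 2) mod k = s" unfolding mm using that by simp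
    moreover have "k - 1 \<noteq> 0" "k - 1 \<noteq> 1" "k - 1 \<noteq> 2" "k - 1 \<noteq> 3" using k7 by auto
    then have "cand v (k - 1) = N (v (k - 2)) \<inter> N (v 0)" for v by (simp add: cand_def)
    ultimately have "cand ((!) (rotate s xs)) (k - 1) = {x \<in> V. C ((s + (k - 2)) mod k) x}"
      using rot[of 0 s] rot[of "k - 2" s] k7 that sets(2)[of "(s + (k - 2)) mod k"] by simp
    then show ?thesis by (simp add: c_def)
  qed
  have tj: "real (card (cand ((!) (rotate s xs)) j)) = c D ((s + (j - 3)) mod k)" if "4 \<le> j" "j < k - 1" for s j
  proof -
    have "j - 3 + 2 = j - 1" using that by simp
    then have "((s + (j - 3)) mod k + 2) mod k = (s + (j - 1)) mod k" unfolding mm by simp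
    then have "cand ((!) (rotate s xs)) j = {x \<in> V. D ((s + (j - 3)) mod k) x}"
      using rot[of "j - 3" s] rot[of "j - 1" s] that sets(3)[of "(s + (j - 3)) mod k"] by (simp add: cand_def)
    then show ?thesis by (simp add: c_def)
  qed
  have J: "{2..<k} = insert 2 (insert 3 (insert (k - 1) {4..<k - 1}))" using k7 by auto
  have "total_cand (rotate s xs) = c A s / 2 + (c B s + (c C ((s + 1) mod k) + (c C ((s + (k - 2)) mod k)
      + (\<Sum>j=4..<k - 1. c D ((s + (j - 3)) mod k)))))" if "s < k" for s
  proof -
    have "(\<Sum>j=4..<k - 1. real (card (cand ((!) (rotate s xs)) j))) = (\<Sum>j=4..<k - 1. c D ((s + (j - 3)) mod k))"
      using tj by (intro sum.cong) auto
    moreover have "k - 1 \<noteq> 2" "k - 1 \<noteq> 3" using k7 by auto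
    ultimately show ?thesis using that t1 t2 t3 tl unfolding total_cand_def J by simp
  qed
  then have "(\<Sum>s<k. total_cand (rotate s xs)) = (\<Sum>s<k. c A s) / 2 + ((\<Sum>s<k. c B s) + ((\<Sum>s<k. c C ((s + 1) mod k))
      + ((\<Sum>s<k. c C ((s + (k - 2)) mod k)) + (\<Sum>s<k. \<Sum>j=4..<k - 1. c D ((s + (j - 3)) mod k)))))"
    by (simp add: sum.distrib sum_divide_distrib)
  also have "(\<Sum>s<k. \<Sum>j=4..<k - 1. c D ((s + (j - 3)) mod k))
      = (\<Sum>j=4..<k - 1. \<Sum>s<k. c D ((s + (j - 3)) mod k))" by (rule sum.swap)
  also have "\<dots> = (real k - 5) * (\<Sum>s<k. c D s)" 
    unfolding sum_mod_shift[OF k_pos] using k7 by (simp add: of_nat_diff)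
  finally have "(\<Sum>s<k. total_cand (rotate s xs)) =
      (\<Sum>s<k. c A s) / 2 + (\<Sum>s<k. c B s) + 2 * (\<Sum>s<k. c C s) + (real k - 5) * (\<Sum>s<k. c D s)"
    unfolding sum_mod_shift[OF k_pos] by simp
  also have "\<dots> = (\<Sum>x\<in>V. real (card {s. s < k \<and> A s x}) / 2 + real (card {s. s < k \<and> B s x})
      + 2 * real (card {s. s < k \<and> C s x}) + (real k - 5) * real (card {s. s < k \<and> D s x}))"
    unfolding c_def sum_card_swap[OF finV]
    by (simp add: sum.distrib sum_divide_distrib flip: sum_distrib_left)
  also have "\<dots> \<le> (\<Sum>x\<in>V. real k - 1 - (if card (nbr_idx xs x) = 2 then 0 else 3 / 2))"
  proof (intro sum_mono)
    fix x
    have "{s. s < k \<and> A s x} = M x" by (auto simp: A_def M_def nbr_idx_def)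
    then show "real (card {s. s < k \<and> A s x}) / 2 + real (card {s. s < k \<and> B s x})
        + 2 * real (card {s. s < k \<and> C s x}) + (real k - 5) * real (card {s. s < k \<and> D s x})
        \<le> real k - 1 - (if card (nbr_idx xs x) = 2 then 0 else 3 / 2)"
      using vertex_count[OF xs, of x] by (simp add: B_def C_def D_def M_def T_def)
  qed
  also have "\<dots> = (real k - 1) * card V - (\<Sum>x\<in>V. if card (nbr_idx xs x) = 2 then 0 else 3 / 2)"
    by (simp add: sum_subtractf)
  also have "(\<Sum>x\<in>V. if card (nbr_idx xs x) = 2 then 0 else 3 / 2 :: real) = 3 / 2 * card (exceptional xs)"
    using finV by (simp add: sum.If_cases exceptional_def Int_def)
  finally show ?thesis .
qed

lemma sum_cycles_rotate:
  fixes F :: "'a list \<Rightarrow> real"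
  shows "(\<Sum>xs\<in>cycles k R. F (rotate s xs)) = (\<Sum>xs\<in>cycles k R. F xs)"
\<comment> \<open>\<open>k * s - s\<close> completes \<open>s\<close> to a multiple of the length
  and also works for \<open>s >= k\<close>.\<close>
proof (rule sum.reindex_bij_witness[where j = "rotate s" and i = "rotate (k * s - s)"])
  fix xs assume xs: "xs \<in> cycles k R"
  have len: "length xs = k" using xs by (simp add: cycles_def)
  have ks: "s + (k * s - s) = k * s" using k_pos by (cases k) auto
  show "rotate (k * s - s) (rotate s xs) = xs" "rotate s (rotate (k * s - s) xs) = xs"
    using ks len by (simp_all add: rotate_rotate add.commute)
  show "rotate s xs \<in> cycles k R" "rotate (k * s - s) xs \<in> cycles k R"
    using rotate_in_cycles[OF xs] by auto
qed simp

text \<open>Vertices without exactly two neighbours on the cycle are penalised; this yields stability.\<close>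

lemma sum_exceptional_le:
  defines "n \<equiv> real (card V)"
  assumes "0 < n"
  shows "(\<Sum>xs\<in>cycles k R. 1 + 3 / 2 * card (exceptional xs) / n) \<le> 2 * real k * (n / k) ^ k"
proof -
  let ?C = "cycles k R"
  \<comment> \<open>Rotation permutes the labelled cycles, so the sum may be replaced by its average
    over rotations.\<close>
  have "k * (\<Sum>xs\<in>?C. total_cand xs) = (\<Sum>s<k. \<Sum>xs\<in>?C. total_cand (rotate s xs))"
    by (simp add: sum_cycles_rotate)
  also have "\<dots> = (\<Sum>xs\<in>?C. \<Sum>s<k. total_cand (rotate s xs))" by (rule sum.swap)
  also have "\<dots> \<le> (\<Sum>xs\<in>?C. (real k - 1) * n - 3 / 2 * card (exceptional xs))"
    unfolding n_def by (intro sum_mono sum_total_cand_rotate)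
  finally have tot: "k / n * (\<Sum>xs\<in>?C. total_cand xs) \<le> (\<Sum>xs\<in>?C. (real k - 1) * n - 3 / 2 * card (exceptional xs)) / n"
    using assms(2) by (simp add: field_simps)
  have "(\<Sum>xs\<in>?C. 1 + 3 / 2 * card (exceptional xs) / n)
      = (\<Sum>xs\<in>?C. real k) - (\<Sum>xs\<in>?C. (real k - 1) * n - 3 / 2 * card (exceptional xs)) / n"
    unfolding sum_divide_distrib sum_subtractf[symmetric]
    using assms(2) by (intro sum.cong refl) (simp add: field_simps)
  also have "\<dots> \<le> (\<Sum>xs\<in>?C. real k) - k / n * (\<Sum>xs\<in>?C. total_cand xs)" using tot by linarith
  also have "\<dots> = (\<Sum>xs\<in>?C. k - k / n * total_cand xs)"
    by (simp add: sum_subtractf sum_distrib_left)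
  finally have *: "(\<Sum>xs\<in>?C. 1 + 3 / 2 * card (exceptional xs) / n) \<le> (\<Sum>xs\<in>?C. k - k / n * total_cand xs)" .
  have "(k / n) ^ (k - 1) / (2 * n) * (\<Sum>xs\<in>?C. k - k / n * total_cand xs) \<le> (\<Sum>xs\<in>?C. weight xs)"
    unfolding sum_distrib_left n_def by (intro sum_mono weight_ge)
  also have "\<dots> \<le> 1" by (rule sum_weight_le_1)
  finally have "(k / n) ^ (k - 1) / (2 * n) * (\<Sum>xs\<in>?C. k - k / n * total_cand xs) \<le> 1" .
  moreover have "0 < (k / n) ^ (k - 1) / (2 * n)" using assms(2) k7 by simp
  ultimately have "(\<Sum>xs\<in>?C. k - k / n * total_cand xs) \<le> 1 / ((k / n) ^ (k - 1) / (2 * n))"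
    by (metis mult.commute pos_le_divide_eq)
  also have "\<dots> = 2 * real k * (n / k) ^ k"
  proof -
    have "(n / k) ^ k = (n / k) * (n / k) ^ (k - 1)" using k_pos by (cases k) auto
    then show ?thesis using k7 assms(2) by (simp add: power_divide)
  qed
  finally show ?thesis using * by linarith
qed

lemma card_cycles_le:
  assumes "0 < card V"
  shows "real (card (cycles k R)) \<le> 2 * real k * (real (card V) / k) ^ k"
proof -
  have "real (card (cycles k R)) = (\<Sum>xs\<in>cycles k R. 1)" by simp
  also have "\<dots> \<le> (\<Sum>xs\<in>cycles k R. 1 + 3 / 2 * card (exceptional xs) / real (card V))"
    by (intro sum_mono) simp
  also have "\<dots> \<le> 2 * real k * (real (card V) / k) ^ k" using assms by (intro sum_exceptional_le) simp
  finally show ?thesis .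
qed

end

section \<open>Cycles lost by deleting edges or vertices\<close>

lemma card_lists_pair_le:
  assumes "finite V" "finite D" "2 \<le> k" "i < k"
  shows "card {xs. length xs = k \<and> set xs \<subseteq> V \<and> (xs ! i, xs ! (Suc i mod k)) \<in> D} \<le> card D * card V ^ (k - 2)"
proof -
  let ?Z = "{zs. set zs \<subseteq> V \<and> length zs = k - 2}"
  let ?g = "\<lambda>((x, y), zs). rotate (k - i) (x # y # zs)"
  have "{xs. length xs = k \<and> set xs \<subseteq> V \<and> (xs ! i, xs ! (Suc i mod k)) \<in> D} \<subseteq> ?g ` (D \<times> ?Z)"
  proof
    fix xs assume "xs \<in> {xs. length xs = k \<and> set xs \<subseteq> V \<and> (xs ! i, xs ! (Suc i mod k)) \<in> D}"
    then have xs: "length xs = k" "set xs \<subseteq> V" "(xs ! i, xs ! (Suc i mod k)) \<in> D" by auto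
    define ys where "ys = rotate i xs"
    have ys: "length ys = k" "set ys \<subseteq> V" "ys ! 0 = xs ! i" "ys ! 1 = xs ! (Suc i mod k)"
      using xs assms(3,4) by (auto simp: ys_def nth_rotate)
    then obtain x y zs where y: "ys = x # y # zs" using assms(3) by (cases ys; cases "tl ys") auto
    have "rotate (k - i) ys = xs" using assms(4) xs(1) by (simp add: ys_def rotate_rotate)
    moreover have "((x, y), zs) \<in> D \<times> ?Z" using ys y xs(3) by auto
    ultimately show "xs \<in> ?g ` (D \<times> ?Z)" using y by force
  qed
  then have "card {xs. length xs = k \<and> set xs \<subseteq> V \<and> (xs ! i, xs ! (Suc i mod k)) \<in> D} \<le> card (?g ` (D \<times> ?Z))"
    using assms(1,2) by (intro card_mono) (auto intro: finite_lists_length_eq)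
  also have "\<dots> \<le> card (D \<times> ?Z)" using assms(1,2) by (intro card_image_le) (auto intro: finite_lists_length_eq)
  also have "\<dots> = card D * card V ^ (k - 2)" using card_lists_length_eq[OF assms(1)] by (simp add: card_cartesian_product)
  finally show ?thesis .
qed

lemma card_cycles_le_remove_edges:
  assumes "finite V" "R \<subseteq> V \<times> V" "R' \<subseteq> R" "2 \<le> k"
  shows "card (cycles k R) \<le> card (cycles k R') + k * (card (R - R') * card V ^ (k - 2))"
proof -
  define Z where "Z i = {xs. length xs = k \<and> set xs \<subseteq> V \<and> (xs ! i, xs ! (Suc i mod k)) \<in> R - R'}" for i
  have finL: "finite {xs. set xs \<subseteq> V \<and> length xs = k}" using assms(1) by (rule finite_lists_length_eq)
  have finZ: "finite (Z i)" for i by (rule finite_subset[OF _ finL]) (auto simp: Z_def)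
  have finR: "finite (R - R')" using assms(1,2) by (auto intro: finite_subset)
  have "cycles k R \<subseteq> (cycles k R') \<union> (\<Union>i<k. Z i)"
    using set_cycles[OF _ assms(2)] by (auto simp: cycles_def Z_def)
  then have "card (cycles k R) \<le> card ((cycles k R') \<union> (\<Union>i<k. Z i))"
    using finZ finite_cycles[OF assms(1), of R'] assms(2,3) by (intro card_mono) auto
  also have "\<dots> \<le> card (cycles k R') + card (\<Union>i<k. Z i)" by (rule card_Un_le)
  also have "card (\<Union>i<k. Z i) \<le> (\<Sum>i<k. card (Z i))" by (rule card_UN_le) simp
  also have "\<dots> \<le> (\<Sum>i<k. card (R - R') * card V ^ (k - 2))"
    unfolding Z_def using assms finR by (intro sum_mono card_lists_pair_le) auto
  also have "\<dots> = k * (card (R - R') * card V ^ (k - 2))" by simp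
  finally show ?thesis by simp
qed

lemma card_lists_meeting_le:
  assumes "finite V" "B \<subseteq> V"
  shows "card {xs. length xs = m \<and> set xs \<subseteq> V \<and> (\<exists>i<m. xs ! i \<in> B)} \<le> m * (card B * card V ^ (m - 1))"
proof -
  define Z where "Z i = {xs. length xs = m \<and> (\<forall>j<m. xs ! j \<in> (if j = i then B else V))}" for i
  have finL: "finite {xs. set xs \<subseteq> V \<and> length xs = m}" using assms(1) by (rule finite_lists_length_eq)
  have ZV: "Z i \<subseteq> {xs. set xs \<subseteq> V \<and> length xs = m}" for i
    using assms(2) by (fastforce simp: Z_def in_set_conv_nth split: if_splits)
  have cZ: "card (Z i) = card B * card V ^ (m - 1)" if "i < m" for i
  proof -
    have "card (Z i) = (\<Prod>j<m. card (if j = i then B else V))" unfolding Z_def by (rule card_lists_nth)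
    also have "\<dots> = card B * (\<Prod>j\<in>{..<m} - {i}. card V)"
      using that by (subst prod.remove[of _ i]) (auto intro: prod.cong)
    finally show ?thesis using that by simp
  qed
  have "{xs. length xs = m \<and> set xs \<subseteq> V \<and> (\<exists>i<m. xs ! i \<in> B)} \<subseteq> (\<Union>i<m. Z i)"
    by (fastforce simp: Z_def)
  then have "card {xs. length xs = m \<and> set xs \<subseteq> V \<and> (\<exists>i<m. xs ! i \<in> B)} \<le> card (\<Union>i<m. Z i)"
    using finite_subset[OF ZV finL] by (intro card_mono) auto
  also have "\<dots> \<le> (\<Sum>i<m. card (Z i))" by (rule card_UN_le) simp
  also have "\<dots> = m * (card B * card V ^ (m - 1))" using cZ by simp
  finally show ?thesis .
qed

definition cycle_free_on :: "nat \<Rightarrow> 'a set \<Rightarrow> 'a rel \<Rightarrow> bool" where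
  "cycle_free_on m V R \<longleftrightarrow> finite V \<and> R \<subseteq> V \<times> V \<and> sym R \<and> irrefl R \<and> cycles m R = {}"

lemma ex_short_odd_free:
  fixes \<delta> :: real
  assumes "odd k" "7 \<le> k" "0 < \<delta>"
  shows "\<exists>n0. \<forall>(V :: 'a set) R. cycle_free_on (k - 2) V R \<and> n0 \<le> card V \<longrightarrow>
    (\<exists>R'\<subseteq>R. short_odd_free V R' k \<and>
      real (card (cycles k R)) \<le> card (cycles k R') + 2 * real k * \<delta> * (real (card V) / k) ^ k)"
proof -
  \<comment> \<open>At most \<open>k * \<gamma> * n^k\<close> labelled cycles use a deleted edge,
    which for this \<open>\<gamma>\<close> is \<open>2k * \<delta> * (n/k)^k\<close>.\<close>
  define \<gamma> where "\<gamma> = 2 * \<delta> / real k ^ k"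
  have "0 < \<gamma>" using assms by (simp add: \<gamma>_def)
  then obtain n0 where n0: "\<And>(V :: 'a set) R. finite V \<and> n0 \<le> card V \<and> R \<subseteq> V \<times> V \<and> sym R \<and> irrefl R \<and> cycles (k - 2) R = {}
    \<Longrightarrow> \<exists>R'\<subseteq>R. sym R' \<and> (\<forall>m. odd m \<and> 3 \<le> m \<and> m < k \<longrightarrow> cycles m R' = {}) \<and>
          card (R - R') \<le> \<gamma> * real (card V) ^ 2"
    using remove_short_odd_cycles[OF assms(1,2), where 'a = 'a] by metis
  show ?thesis
  proof (intro exI[of _ n0] allI impI)
    fix V :: "'a set" and R assume asm: "cycle_free_on (k - 2) V R \<and> n0 \<le> card V"
    then obtain R' where R': "R' \<subseteq> R" "sym R'" "\<And>m. odd m \<Longrightarrow> 3 \<le> m \<Longrightarrow> m < k \<Longrightarrow> cycles m R' = {}"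
        "card (R - R') \<le> \<gamma> * real (card V) ^ 2"
      using n0[of V R] by (auto simp: cycle_free_on_def)
    have irr: "irrefl R'" using asm R'(1) by (auto simp: cycle_free_on_def irrefl_def)
    have RV: "finite V" "R \<subseteq> V \<times> V" using asm by (auto simp: cycle_free_on_def)
    have "short_odd_free V R' k"
    proof
      show "k \<le> m" if "odd m" "(x, x) \<in> R' ^^ m" for m x
        using odd_closed_walk_ge[OF irr R'(3) that] .
    qed (use assms RV R' in auto)
    moreover have "real (card (cycles k R)) \<le> card (cycles k R') + 2 * real k * \<delta> * (real (card V) / k) ^ k"
    proof -
      have "real (card (R - R')) * real (card V) ^ (k - 2) \<le> \<gamma> * real (card V) ^ 2 * real (card V) ^ (k - 2)"
        using R'(4) by (intro mult_right_mono) auto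
      also have "\<dots> = \<gamma> * real (card V) ^ k"
      proof -
        have "2 + (k - 2) = k" using assms(2) by simp
        then have "real (card V) ^ k = real (card V) ^ 2 * real (card V) ^ (k - 2)"
          by (metis power_add)
        then show ?thesis by (simp only: mult.assoc)
      qed
      also have "\<dots> = 2 * \<delta> * (real (card V) / k) ^ k" by (simp add: \<gamma>_def power_divide)
      finally have "real k * (real (card (R - R')) * real (card V) ^ (k - 2)) \<le> real k * (2 * \<delta> * (real (card V) / k) ^ k)"
        by (rule mult_left_mono) simp
      moreover have "real (card (cycles k R)) \<le> real (card (cycles k R') + k * (card (R - R') * card V ^ (k - 2)))"
        using card_cycles_le_remove_edges[OF RV R'(1), of k] assms(2) by (intro of_nat_mono) simp
      then have "real (card (cycles k R)) \<le> card (cycles k R') + k * (real (card (R - R')) * real (card V) ^ (k - 2))" by simp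
      ultimately show ?thesis by (simp add: mult.assoc mult.left_commute)
    qed
    ultimately show "\<exists>R'\<subseteq>R. short_odd_free V R' k \<and>
      real (card (cycles k R)) \<le> card (cycles k R') + 2 * real k * \<delta> * (real (card V) / k) ^ k"
      using R'(1) by blast
  qed
qed

lemma card_cycles_asymp_le:
  fixes \<eta> :: real
  assumes "odd k" "7 \<le> k" "0 < \<eta>"
  shows "\<exists>n0. \<forall>(V :: 'a set) R. cycle_free_on (k - 2) V R \<and> n0 \<le> card V \<longrightarrow>
    real (card (cycles k R)) \<le> 2 * real k * (1 + \<eta>) * (real (card V) / k) ^ k"
proof -
  obtain n0 where n0: "\<And>(V :: 'a set) R. cycle_free_on (k - 2) V R \<and> n0 \<le> card V \<Longrightarrow>
    (\<exists>R'\<subseteq>R. short_odd_free V R' k \<and>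
      real (card (cycles k R)) \<le> card (cycles k R') + 2 * real k * \<eta> * (real (card V) / k) ^ k)"
    using ex_short_odd_free[OF assms, where 'a = 'a] by metis
  show ?thesis
  proof (intro exI[of _ "n0 + 1"] allI impI)
    fix V :: "'a set" and R assume asm: "cycle_free_on (k - 2) V R \<and> n0 + 1 \<le> card V"
    then obtain R' where R': "short_odd_free V R' k"
      "real (card (cycles k R)) \<le> card (cycles k R') + 2 * real k * \<eta> * (real (card V) / k) ^ k"
      using n0[of V R] by auto
    have "real (card (cycles k R')) \<le> 2 * real k * (real (card V) / k) ^ k"
      using short_odd_free.card_cycles_le[OF R'(1)] asm by simp
    then show "real (card (cycles k R)) \<le> 2 * real k * (1 + \<eta>) * (real (card V) / k) ^ k"
      using R'(2) by (simp add: algebra_simps)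
  qed
qed

section \<open>Stability\<close>

lemma cadj_iff:
  assumes "i < k"
  shows "(i, j) \<in> cadj k \<longleftrightarrow> j = (i + 1) mod k \<or> j = (i + (k - 1)) mod k"
proof -
  have "(j < k \<and> i = Suc j mod k) \<longleftrightarrow> j = (i + (k - 1)) mod k"
  proof
    assume *: "j < k \<and> i = Suc j mod k"
    then have "(i + (k - 1)) mod k = (Suc j + (k - 1)) mod k" by (simp only: mod_add_left_eq)
    also have "Suc j + (k - 1) = j + k" using assms by simp
    finally show "j = (i + (k - 1)) mod k" using * by simp
  next
    assume *: "j = (i + (k - 1)) mod k"
    then have "Suc j mod k = Suc (i + (k - 1)) mod k" by (simp add: mod_Suc_eq)
    also have "Suc (i + (k - 1)) = i + k" using assms by simp
    finally show "j < k \<and> i = Suc j mod k" using * assms by simp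
  qed
  then show ?thesis using assms by (auto simp: cadj_def)
qed

lemma cadj_from_Suc:
  assumes "a < k" "((a + 1) mod k, j) \<in> cadj k"
  shows "j = a \<or> j = (a + 2) mod k"
proof -
  have "(a + 1) mod k < k" using assms(1) by simp
  then have "j = ((a + 1) mod k + 1) mod k \<or> j = ((a + 1) mod k + (k - 1)) mod k"
    using assms(2) cadj_iff by blast
  moreover have "((a + 1) mod k + 1) mod k = (a + 2) mod k" by (simp add: mod_Suc_eq)
  moreover have "((a + 1) mod k + (k - 1)) mod k = a"
  proof -
    have "((a + 1) mod k + (k - 1)) mod k = (a + 1 + (k - 1)) mod k" by (rule mod_add_left_eq)
    also have "a + 1 + (k - 1) = a + k" using assms(1) by simp
    finally show ?thesis using assms(1) by simp
  qed
  ultimately show ?thesis by metis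
qed

context short_odd_free
begin

text \<open>The class of \<open>x\<close> is the position between its two neighbours on
  \<open>xs\<close>, where \<open>x\<close> could take the place of the cycle vertex. For an edge
  \<open>xy\<close> between non-adjacent classes, the walk of length \<open>k - 3\<close> between
  the classes can have its two ends replaced by \<open>x\<close> and \<open>y\<close>, and the edge
  closes it to length \<open>k - 2\<close>.\<close>

lemma ex_class_map:
  assumes xs: "xs \<in> cycles k R"
  shows "\<exists>cl. (\<forall>x\<in>V - exceptional xs. cl x < k) \<and>
    (\<forall>x\<in>V - exceptional xs. \<forall>y\<in>V - exceptional xs. (x, y) \<in> R \<longrightarrow> (cl x, cl y) \<in> cadj k)"
proof -
  \<comment> \<open>\<open>x\<close> is adjacent to both cycle neighbours of position
    \<open>i\<close>.\<close>
  define P where "P x i \<longleftrightarrow> i < k \<and> (\<forall>j. (i, j) \<in> cadj k \<longrightarrow> (xs ! j, x) \<in> R)" for x i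
  have "\<exists>i. P x i" if "x \<in> V - exceptional xs" for x
  proof -
    have "card (nbr_idx xs x) = 2" using that by (auto simp: exceptional_def)
    then obtain a where a: "a < k" "nbr_idx xs x = {a, (a + 2) mod k}" using two_nbrs[OF xs] by metis
    have "P x ((a + 1) mod k)" unfolding P_def
    proof (intro conjI allI impI)
      fix j assume "((a + 1) mod k, j) \<in> cadj k"
      then have "j \<in> nbr_idx xs x" using cadj_from_Suc[OF a(1)] a(2) by blast
      then show "(xs ! j, x) \<in> R" by (simp add: nbr_idx_def)
    qed (use k_pos in simp)
    then show ?thesis by blast
  qed
  then obtain cl where cl: "\<And>x. x \<in> V - exceptional xs \<Longrightarrow> P x (cl x)" by metis
  have "(cl x, cl y) \<in> cadj k" if x: "x \<in> V - exceptional xs" and y: "y \<in> V - exceptional xs" and xy: "(x, y) \<in> R" for x y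
  proof (rule ccontr)
    assume "(cl x, cl y) \<notin> cadj k"
    then have "(cl x, cl y) \<in> cadj k ^^ (k - 3)"
      using cl[OF x] cl[OF y] by (intro cadj_relpow_minus_3 odd_k k7) (auto simp: P_def)
    moreover have "k - 3 = Suc (Suc (k - 5))" using k7 by simp
    ultimately have "(cl x, cl y) \<in> cadj k ^^ Suc (Suc (k - 5))" by simp
    then obtain i where i: "(cl x, i) \<in> cadj k" "(i, cl y) \<in> cadj k ^^ Suc (k - 5)" by (metis relpow_Suc_D2)
    then obtain j where j: "(i, j) \<in> cadj k ^^ (k - 5)" "(j, cl y) \<in> cadj k" by auto
    have "(cl y, j) \<in> cadj k" using j(2) sym_cadj by (auto dest: symD)
    then have "(xs ! j, y) \<in> R" "(xs ! i, x) \<in> R" using cl[OF x] cl[OF y] i(1) by (auto simp: P_def)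
    moreover have "(xs ! i, xs ! j) \<in> R ^^ (k - 5)" using j(1) by (rule cycle_hom[OF xs])
    moreover have "(x, xs ! i) \<in> R" "(y, x) \<in> R" using \<open>(xs ! i, x) \<in> R\<close> xy symR by (auto dest: symD)
    ultimately have "(x, x) \<in> R ^^ Suc (Suc (Suc (k - 5)))" by (blast intro: relpow_Suc_I relpow_Suc_I2)
    moreover have "Suc (Suc (Suc (k - 5))) = k - 2" using k7 by simp
    ultimately show False using no_closed_walk by metis
  qed
  then show ?thesis using cl by (auto simp: P_def)
qed

text \<open>Averaging: otherwise every cycle contributes more than \<open>1 + 6 * \<delta>\<close>
  to the penalised sum, but \<open>(1 + 6 * \<delta>) * (1 - 2 * \<delta>) > 1\<close> for
  \<open>0 < \<delta> < 1/3\<close>.\<close>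

lemma ex_cycle_few_exceptional:
  fixes \<delta> :: real
  defines "n \<equiv> real (card V)"
  assumes "0 < \<delta>" "\<delta> < 1 / 3" "0 < n" "2 * real k * (1 - 2 * \<delta>) * (n / k) ^ k \<le> card (cycles k R)"
  shows "\<exists>xs\<in>cycles k R. card (exceptional xs) \<le> 4 * \<delta> * n"
proof (rule ccontr)
  assume "\<not> ?thesis"
  then have e: "4 * \<delta> * n \<le> card (exceptional xs)" if "xs \<in> cycles k R" for xs using that by force
  define X where "X = 2 * real k * (n / k) ^ k"
  have X: "0 < X" using assms(4) k7 by (simp add: X_def)
  have eq: "(1 - 2 * \<delta>) * X = 2 * real k * (1 - 2 * \<delta>) * (n / k) ^ k" by (simp add: X_def algebra_simps)
  have "(1 - 2 * \<delta>) * X \<le> card (cycles k R)" unfolding eq by (rule assms(5))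
  then have "(1 + 6 * \<delta>) * ((1 - 2 * \<delta>) * X) \<le> (1 + 6 * \<delta>) * card (cycles k R)"
    using assms(2) by (intro mult_left_mono) simp_all
  then have "(1 + 6 * \<delta>) * (1 - 2 * \<delta>) * X \<le> (1 + 6 * \<delta>) * card (cycles k R)" by (simp only: mult.assoc)
  also have "\<dots> = (\<Sum>xs\<in>cycles k R. 1 + 6 * \<delta>)" by simp
  also have "\<dots> \<le> (\<Sum>xs\<in>cycles k R. 1 + 3 / 2 * card (exceptional xs) / n)"
  proof (intro sum_mono)
    fix xs assume "xs \<in> cycles k R"
    then show "1 + 6 * \<delta> \<le> 1 + 3 / 2 * card (exceptional xs) / n" using e[of xs] assms(4) by (simp add: field_simps)
  qed
  also have "\<dots> \<le> X" unfolding X_def n_def using assms(4) by (intro sum_exceptional_le) (simp add: n_def)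
  finally have "(1 + 6 * \<delta>) * (1 - 2 * \<delta>) \<le> 1" using X by simp
  then have "4 * \<delta> \<le> 12 * \<delta> * \<delta>" by (simp add: algebra_simps)
  then show False using assms(2,3) by simp
qed

end

section \<open>Almost complete pairs of consecutive classes\<close>

lemma sum_card_classes:
  fixes k :: nat
  assumes "finite V" "\<And>v. v \<in> V \<Longrightarrow> cl v < k"
  shows "(\<Sum>i<k. card {v \<in> V. cl v = i}) = card V"
proof -
  have "(\<Sum>i<k. card {v \<in> V. cl v = i}) = card (\<Union>i<k. {v \<in> V. cl v = i})"
    using assms(1) by (intro card_UN_disjoint[symmetric]) auto
  also have "(\<Union>i<k. {v \<in> V. cl v = i}) = V" using assms(2) by auto
  finally show ?thesis .
qed

text \<open>A missing pair between classes \<open>i\<close> and \<open>j\<close> costs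
  \<open>P2\<close> labelled cycles of the complete blow-up, the product of the other
  \<open>k - 2\<close> class sizes, whereas at most \<open>2k * \<gamma> * (n/k)^k\<close> are
  missing in total. \<open>P2\<close> is not small since the product of all class sizes is at least
  \<open>(n/k)^k / 2\<close>; bounding all but one factor of that product by \<open>n\<close> gives
  the second claim.\<close>

lemma bad_vertices_le:
  fixes n \<beta> \<gamma> :: real
  assumes "odd k" "3 \<le> k" "finite U" "card U \<le> n" "0 < n" "0 < \<beta>" "\<gamma> \<le> 1 / 2" "0 \<le> \<gamma>"
    and QU: "Q \<subseteq> U \<times> U" and clU: "\<And>x. x \<in> U \<Longrightarrow> cl x < k"
    and hom: "\<And>x y. (x, y) \<in> Q \<Longrightarrow> (cl x, cl y) \<in> cadj k"
    and many: "2 * real k * (1 - \<gamma>) * (n / k) ^ k \<le> card (cycles k Q)"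
    and ij: "(i, j) \<in> cadj k"
  shows "card {x \<in> U. cl x = i \<and> \<beta> * n < card {y \<in> U. cl y = j \<and> (x, y) \<notin> Q}} \<le> 4 * real k * \<gamma> * n / \<beta>" (is "real (card ?X) \<le> _")
    and "n / (2 * real k ^ k) \<le> card {x \<in> U. cl x = i}"
proof -
  have ik: "i < k" using ij by (auto simp: cadj_def)
  obtain c where c: "c \<in> {1, k - 1}" "j = (i + c) mod k" using ij cadj_iff[OF ik] by blast
  \<comment> \<open>The classes are listed in the direction leading from \<open>i\<close> to
    \<open>j\<close>, so that \<open>A 0\<close> and \<open>A 1\<close> are the two classes in
    question.\<close>
  define A where "A s = {x \<in> U. cl x = (i + c * s) mod k}" for s
  have A01: "A 0 = {x \<in> U. cl x = i}" "A 1 = {y \<in> U. cl y = j}" using ik c(2) by (auto simp: A_def)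
  have finA: "finite (A s)" for s using assms(3) by (simp add: A_def)
  have cA: "card (A s) \<le> n" for s
  proof -
    have "card (A s) \<le> card U" using assms(3) by (intro card_mono) (auto simp: A_def)
    then show ?thesis using assms(4) by linarith
  qed
  define P2 where "P2 = (\<Prod>s<k - 2. card (A (s + 2)))"
  have prodA: "(\<Prod>i<k. card {x \<in> U. cl x = i}) = (\<Prod>s<k. card (A s))"
    unfolding A_def using affine_mod_bij[OF coprime_pm1[OF assms(2) c(1)]] assms(2)
    by (intro prod.reindex_bij_betw[of _ _ _ "\<lambda>i. card {x \<in> U. cl x = i}", symmetric]) simp
  also have "\<dots> = card (A 0) * card (A 1) * P2"
  proof -
    have "k = Suc (Suc (k - 2))" using assms(2) by simp
    then have "(\<Prod>s<k. card (A s)) = (\<Prod>s<Suc (Suc (k - 2)). card (A s))" by simp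
    also have "\<dots> = card (A 0) * (card (A 1) * P2)"
      unfolding prod.lessThan_Suc_shift by (simp add: P2_def)
    finally show ?thesis by simp
  qed
  finally have homcard: "card (hom_lists k cl U) = 2 * k * (card (A 0) * card (A 1) * P2)"
    using card_hom_lists[OF assms(1-3)] by simp
  have cyc_sub: "cycles k Q \<subseteq> hom_lists k cl U" using QU hom by (rule cycles_subset_hom_lists)
  have finH: "finite (hom_lists k cl U)"
    by (rule finite_subset[OF _ finite_lists_length_eq[OF assms(3), of k]]) (auto simp: hom_lists_def)
  have upper: "real (card (A 0) * card (A 1) * P2) \<le> (n / k) ^ k"
  proof -
    have "(\<Sum>i<k. card {x \<in> U. cl x = i}) = card U" using assms(3) clU by (rule sum_card_classes)
    then have "(\<Sum>i<k. real (card {x \<in> U. cl x = i})) \<le> n" using assms(4) by (simp flip: of_nat_sum)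
    then have "(\<Prod>i<k. real (card {x \<in> U. cl x = i})) \<le> (n / k) ^ card {..<k}"
      using assms(2,5) by (intro prod_le_power_mean) auto
    then show ?thesis using prodA \<open>(\<Prod>s<k. card (A s)) = card (A 0) * card (A 1) * P2\<close>
      by (simp flip: of_nat_prod)
  qed
  define X where "X = (n / k) ^ k"
  have X0: "0 < X" using assms(2,5) by (simp add: X_def)
  have "card (cycles k Q) \<le> 2 * k * (card (A 0) * card (A 1) * P2)"
    using card_mono[OF finH cyc_sub] homcard by simp
  then have "real (card (cycles k Q)) \<le> 2 * real k * real (card (A 0) * card (A 1) * P2)"
    by (metis of_nat_le_iff of_nat_mult of_nat_numeral)
  with many have "2 * real k * (1 - \<gamma>) * X \<le> 2 * real k * real (card (A 0) * card (A 1) * P2)"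
    unfolding X_def by (rule order_trans)
  then have "(1 - \<gamma>) * X \<le> real (card (A 0) * card (A 1) * P2)" using assms(2) by (simp add: mult.assoc)
  moreover have "1 / 2 * X \<le> (1 - \<gamma>) * X" using X0 assms(7) by (intro mult_right_mono) auto
  ultimately have lower: "X / 2 \<le> real (card (A 0)) * real (card (A 1)) * real P2" by simp
  have "real (card (A 0)) * real (card (A 1)) * real P2 \<le> n * n * real P2"
    using cA assms(5) by (intro mult_right_mono mult_mono) auto
  then have P2: "X / 2 \<le> n * n * real P2" using lower by linarith
  then have P2pos: "0 < real P2" using X0 by (cases "P2 = 0") auto
  show "n / (2 * real k ^ k) \<le> card {x \<in> U. cl x = i}"
  proof -
    have "real P2 \<le> (\<Prod>s<k - 2. n)"
      unfolding P2_def of_nat_prod using cA by (intro prod_mono) auto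
    then have "real P2 \<le> n ^ (k - 2)" by simp
    then have "real (card (A 0)) * real (card (A 1)) * real P2 \<le> real (card (A 0)) * n * n ^ (k - 2)"
      using cA assms(5) by (intro mult_mono) auto
    moreover have "n ^ k = n * n * n ^ (k - 2)"
    proof -
      have "k = Suc (Suc (k - 2))" using assms(2) by simp
      then show ?thesis by (metis power_Suc mult.assoc)
    qed
    ultimately have "n * (n * n ^ (k - 2)) / (2 * real k ^ k) \<le> real (card (A 0)) * (n * n ^ (k - 2))"
      using lower by (simp add: X_def power_divide mult.assoc)
    then have "n / (2 * real k ^ k) * (n * n ^ (k - 2)) \<le> real (card (A 0)) * (n * n ^ (k - 2))" by simp
    moreover have "0 < n * n ^ (k - 2)" using assms(5) by simp
    ultimately show ?thesis unfolding A01 by (metis mult_le_cancel_right_pos)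
  qed
  define D where "D = Sigma ?X (\<lambda>x. {y \<in> U. cl y = j \<and> (x, y) \<notin> Q})"
  define Z where "Z = {zs. length zs = k - 2 \<and> (\<forall>s<k - 2. zs ! s \<in> A (s + 2))}"
  have cardZ: "card Z = P2" unfolding Z_def P2_def by (rule card_lists_nth)
  have "card ?X * (\<beta> * n) \<le> card D"
  proof -
    have "card ?X * (\<beta> * n) \<le> (\<Sum>x\<in>?X. real (card {y \<in> U. cl y = j \<and> (x, y) \<notin> Q}))"
      by (intro sum_bounded_below) auto
    also have "\<dots> = card D" unfolding D_def using assms(3) by (subst card_SigmaI) auto
    finally show ?thesis .
  qed
  then have "card ?X * (\<beta> * n) * P2 \<le> real (card D) * P2" by (intro mult_right_mono) auto
  also have "\<dots> = card (D \<times> Z)" by (simp add: card_cartesian_product cardZ)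
  also have "card (D \<times> Z) \<le> card (hom_lists k cl U - cycles k Q)"
  proof (rule card_inj_on_le)
    show "inj_on (\<lambda>((x, y), zs). x # y # zs) (D \<times> Z)" by (auto simp: inj_on_def)
    show "finite (hom_lists k cl U - cycles k Q)" using finH by simp
    show "(\<lambda>((x, y), zs). x # y # zs) ` (D \<times> Z) \<subseteq> hom_lists k cl U - cycles k Q"
    proof clarify
      fix x y zs assume xy: "(x, y) \<in> D" and zs: "zs \<in> Z"
      have len: "length (x # y # zs) = k" using zs assms(2) by (simp add: Z_def)
      have "(x # y # zs) ! s \<in> A s" if "s < k" for s
      proof -
        consider "s = 0" | "s = 1" | t where "s = Suc (Suc t)" by (metis One_nat_def not0_implies_Suc)
        then show ?thesis
        proof cases
          case 1
          then show ?thesis using xy by (auto simp: D_def A01)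
        next
          case 2
          then show ?thesis using xy A01(2) by (auto simp: D_def)
        next
          case (3 t)
          then show ?thesis using zs that by (auto simp: Z_def)
        qed
      qed
      then have "length (x # y # zs) = k \<and> (\<forall>s<k. (x # y # zs) ! s \<in> {x \<in> U. cl x = (i + c * s) mod k})"
        using len unfolding A_def by blast
      then have "x # y # zs \<in> hom_lists k cl U"
        unfolding hom_lists_eq[OF assms(1)] using ik c(1) by blast
      moreover have "x # y # zs \<notin> cycles k Q"
      proof
        assume "x # y # zs \<in> cycles k Q"
        then have "((x # y # zs) ! 0, (x # y # zs) ! (Suc 0 mod k)) \<in> Q" using assms(2) unfolding cycles_def by fastforce
        then show False using xy assms(2) by (auto simp: D_def)
      qed
      ultimately show "x # y # zs \<in> hom_lists k cl U - cycles k Q" by blast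
    qed
  qed
  also have "real (card (hom_lists k cl U - cycles k Q)) = real (card (hom_lists k cl U)) - card (cycles k Q)"
    using card_mono[OF finH cyc_sub] by (simp add: card_Diff_subset[OF finite_subset[OF cyc_sub finH] cyc_sub] of_nat_diff)
  also have "\<dots> \<le> 2 * real k * X - 2 * real k * (1 - \<gamma>) * X"
  proof -
    have "real (card (hom_lists k cl U)) = 2 * real k * real (card (A 0) * card (A 1) * P2)" unfolding homcard by simp
    also have "\<dots> \<le> 2 * real k * X" unfolding X_def by (intro mult_left_mono upper) simp
    finally show ?thesis using many by (simp add: X_def)
  qed
  also have "\<dots> = 4 * real k * \<gamma> * (X / 2)" by (simp add: algebra_simps)
  finally have *: "card ?X * (\<beta> * n) * P2 \<le> 4 * real k * \<gamma> * (X / 2)" by simp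
  have "4 * real k * \<gamma> * (X / 2) \<le> 4 * real k * \<gamma> * (n * n * P2)" using P2 assms(8) by (intro mult_left_mono) auto
  then have "card ?X * \<beta> * (n * P2) \<le> 4 * real k * \<gamma> * n * (n * P2)" using * by (simp add: algebra_simps)
  then have "card ?X * \<beta> \<le> 4 * real k * \<gamma> * n" using P2pos assms(5) by (simp add: zero_less_mult_iff)
  then show "card ?X \<le> 4 * real k * \<gamma> * n / \<beta>" using assms(6) by (simp add: field_simps)
qed

text \<open>\<open>\<beta>\<close> bounds the share of non-neighbours in an adjacent class,
  \<open>\<rho>\<close> the share of uncovered vertices. The size \<open>1 / (2 * k^k)\<close> is
  what a nearly maximal number of cycles forces on each class, less the removed vertices.\<close>

definition good_classes :: "nat \<Rightarrow> 'a set \<Rightarrow> 'a rel \<Rightarrow> real \<Rightarrow> real \<Rightarrow> (nat \<Rightarrow> 'a set) \<Rightarrow> bool" where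
  "good_classes k V R \<beta> \<rho> W \<longleftrightarrow>
     (\<forall>i<k. W i \<subseteq> V \<and> (1 / (2 * real k ^ k) - \<rho>) * real (card V) \<le> real (card (W i))) \<and>
     (\<forall>i j x. (i, j) \<in> cadj k \<longrightarrow> x \<in> W i \<longrightarrow> real (card {y \<in> W j. (x, y) \<notin> R}) \<le> \<beta> * real (card V)) \<and>
     real (card (V - (\<Union>i<k. W i))) \<le> \<rho> * real (card V)"

lemma card_cadj_le: "finite (cadj k)" "card (cadj k) \<le> 2 * k"
proof -
  have sub: "cadj k \<subseteq> (\<lambda>i. (i, Suc i mod k)) ` {..<k} \<union> (\<lambda>j. (Suc j mod k, j)) ` {..<k}"
    by (auto simp: cadj_def)
  then show "finite (cadj k)" by (rule finite_subset) simp
  have "card (cadj k) \<le> card ((\<lambda>i. (i, Suc i mod k)) ` {..<k} \<union> (\<lambda>j. (Suc j mod k, j)) ` {..<k})"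
    using sub by (intro card_mono) auto
  also have "\<dots> \<le> card ((\<lambda>i. (i, Suc i mod k)) ` {..<k}) + card ((\<lambda>j. (Suc j mod k, j)) ` {..<k})"
    by (rule card_Un_le)
  also have "\<dots> \<le> k + k" by (intro add_mono card_image_le[of "{..<k}", simplified])
  finally show "card (cadj k) \<le> 2 * k" by simp
qed

text \<open>All bad vertices are removed at once. There are at most \<open>2 * k\<close> ordered
  pairs of adjacent classes, so they number at most \<open>8 * k^2 * \<gamma> / \<beta> * n\<close>;
  this takes half of \<open>\<rho>\<close>, and the vertices outside \<open>U\<close> take the other
  half.\<close>

lemma good_classes_of_hom:
  fixes \<beta> \<gamma> \<rho> :: real
  assumes "odd k" "3 \<le> k" "finite V" "0 < card V" "U \<subseteq> V" "0 < \<beta>" "0 \<le> \<gamma>" "\<gamma> \<le> 1 / 2" "Q \<subseteq> R"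
    and "8 * real k ^ 2 * \<gamma> / \<beta> \<le> \<rho> / 2" "card (V - U) \<le> \<rho> / 2 * card V"
    and QU: "Q \<subseteq> U \<times> U" and clU: "\<And>x. x \<in> U \<Longrightarrow> cl x < k"
    and hom: "\<And>x y. (x, y) \<in> Q \<Longrightarrow> (cl x, cl y) \<in> cadj k"
    and many: "2 * real k * (1 - \<gamma>) * (card V / k) ^ k \<le> card (cycles k Q)"
  shows "\<exists>W. good_classes k V R \<beta> \<rho> W"
proof -
  define n where "n = real (card V)"
  have n: "0 < n" using assms(4) by (simp add: n_def)
  have finU: "finite U" using assms(3,5) by (rule finite_subset[rotated])
  have Un: "card U \<le> n" unfolding n_def using assms(3,5) by (simp add: card_mono)
  define X where "X = (\<lambda>(i, j). {x \<in> U. cl x = i \<and> \<beta> * n < card {y \<in> U. cl y = j \<and> (x, y) \<notin> Q}})"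
  have cX: "card (X p) \<le> 4 * real k * \<gamma> * n / \<beta>" if "p \<in> cadj k" for p
    using bad_vertices_le(1)[OF assms(1,2) finU Un n assms(6,8,7) QU clU hom] many that
    unfolding X_def n_def by (cases p) auto
  have cU: "n / (2 * real k ^ k) \<le> card {x \<in> U. cl x = i}" if "i < k" for i
    using bad_vertices_le(2)[OF assms(1,2) finU Un n assms(6,8,7) QU clU hom _ cadj_Suc[OF that]] many
    unfolding n_def by auto
  define Y where "Y = (\<Union>p\<in>cadj k. X p)"
  have YU: "Y \<subseteq> U" by (auto simp: Y_def X_def)
  have "card Y \<le> (\<Sum>p\<in>cadj k. card (X p))" unfolding Y_def by (rule card_UN_le) (rule card_cadj_le)
  then have "real (card Y) \<le> (\<Sum>p\<in>cadj k. real (card (X p)))" by (simp flip: of_nat_sum)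
  also have "\<dots> \<le> card (cadj k) * (4 * real k * \<gamma> * n / \<beta>)" using cX by (intro sum_bounded_above) auto
  also have "\<dots> \<le> real (2 * k) * (4 * real k * \<gamma> * n / \<beta>)"
    using card_cadj_le(2)[of k] n assms(6,7) by (intro mult_right_mono of_nat_mono) auto
  also have "\<dots> = 8 * real k ^ 2 * \<gamma> / \<beta> * n" by (simp add: power2_eq_square)
  also have "\<dots> \<le> \<rho> / 2 * n" using assms(10) n by (intro mult_right_mono) auto
  finally have cY: "card Y \<le> \<rho> / 2 * n" .
  have \<rho>: "0 \<le> \<rho> * n"
  proof -
    have "0 \<le> \<rho> / 2 * n" using cY by (meson of_nat_0_le_iff order_trans)
    then show ?thesis by simp
  qed
  define W where "W i = {x \<in> U. cl x = i} - Y" for i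
  have "good_classes k V R \<beta> \<rho> W" unfolding good_classes_def n_def[symmetric]
  proof (intro conjI allI impI)
    fix i assume i: "i < k"
    show "W i \<subseteq> V" using assms(5) by (auto simp: W_def)
    have "card {x \<in> U. cl x = i} \<le> card (W i \<union> Y)"
      using finU finite_subset[OF YU finU] by (intro card_mono) (auto simp: W_def)
    also have "\<dots> \<le> card (W i) + card Y" by (rule card_Un_le)
    finally have "n / (2 * real k ^ k) \<le> card (W i) + \<rho> / 2 * n" using cU[OF i] cY by simp
    then show "(1 / (2 * real k ^ k) - \<rho>) * n \<le> card (W i)" using \<rho> by (simp add: left_diff_distrib)
  next
    fix i j x assume ij: "(i, j) \<in> cadj k" and x: "x \<in> W i"
    have "x \<notin> X (i, j)" using x ij by (auto simp: W_def Y_def)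
    then have "card {y \<in> U. cl y = j \<and> (x, y) \<notin> Q} \<le> \<beta> * n" using x by (auto simp: X_def W_def)
    moreover have "card {y \<in> W j. (x, y) \<notin> R} \<le> card {y \<in> U. cl y = j \<and> (x, y) \<notin> Q}"
      using finU assms(9) by (intro card_mono) (auto simp: W_def)
    ultimately show "card {y \<in> W j. (x, y) \<notin> R} \<le> \<beta> * n" by linarith
  next
    have "V - (\<Union>i<k. W i) \<subseteq> (V - U) \<union> Y" using clU by (auto simp: W_def)
    then have "card (V - (\<Union>i<k. W i)) \<le> card ((V - U) \<union> Y)"
      using assms(3) finite_subset[OF YU finU] by (intro card_mono) auto
    also have "\<dots> \<le> card (V - U) + card Y" by (rule card_Un_le)
    finally show "card (V - (\<Union>i<k. W i)) \<le> \<rho> * n" using cY assms(11) by (simp add: n_def)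
  qed
  then show ?thesis by blast
qed

lemma ex_good_classes:
  fixes \<beta> \<rho> :: real
  assumes "odd k" "7 \<le> k" "0 < \<beta>" "0 < \<rho>" "\<beta> \<le> 1" "\<rho> \<le> 1"
  shows "\<exists>\<delta>>0. \<exists>n0. \<forall>(V :: 'a set) R. cycle_free_on (k - 2) V R \<and> n0 \<le> card V \<and>
      2 * real k * (1 - \<delta>) * (card V / k) ^ k \<le> card (cycles k R)
    \<longrightarrow> (\<exists>W. good_classes k V R \<beta> \<rho> W)"
proof -
  define K where "K = real k ^ k"
  have K1: "1 \<le> K" using assms(2) by (simp add: K_def)
  \<comment> \<open>The factor 64 makes \<open>8 * k^2 * \<gamma> / \<beta>\<close> equal to
    \<open>\<rho> / 2\<close> for \<open>\<gamma> = 4 * \<delta> * K\<close>.\<close>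
  define \<delta> where "\<delta> = \<beta> * \<rho> / (64 * real k ^ 2 * K)"
  have \<delta>0: "0 < \<delta>" using assms K1 by (simp add: \<delta>_def)
  have k1: "1 \<le> real k ^ 2" using assms(2) by simp
  have bp: "\<beta> * \<rho> \<le> \<rho>" "\<beta> * \<rho> \<le> 1" using assms by (auto simp: mult_le_one)
  have \<delta>K: "\<delta> * K = \<beta> * \<rho> / (64 * real k ^ 2)" using K1 by (simp add: \<delta>_def)
  have le: "\<beta> * \<rho> / (64 * real k ^ 2) \<le> \<beta> * \<rho> / 64"
    using k1 assms by (intro divide_left_mono) auto
  have "\<delta> \<le> \<delta> * K" using \<delta>0 K1 by simp
  then have \<delta>: "\<delta> \<le> \<beta> * \<rho> / 64" using \<delta>K le by linarith
  obtain n0 where n0: "\<And>(V :: 'a set) R. cycle_free_on (k - 2) V R \<and> n0 \<le> card V \<Longrightarrow>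
    (\<exists>R'\<subseteq>R. short_odd_free V R' k \<and>
      real (card (cycles k R)) \<le> card (cycles k R') + 2 * real k * \<delta> * (real (card V) / k) ^ k)"
    using ex_short_odd_free[OF assms(1,2) \<delta>0, where 'a = 'a] by metis
  show ?thesis
  proof (intro exI[of _ \<delta>] conjI \<delta>0 exI[of _ "n0 + 1"] allI impI)
    fix V :: "'a set" and R
    assume asm: "cycle_free_on (k - 2) V R \<and> n0 + 1 \<le> card V \<and>
      2 * real k * (1 - \<delta>) * (card V / k) ^ k \<le> card (cycles k R)"
    obtain R' where R': "R' \<subseteq> R" "short_odd_free V R' k"
      "real (card (cycles k R)) \<le> card (cycles k R') + 2 * real k * \<delta> * (real (card V) / k) ^ k"
      using n0[of V R] asm by auto
    interpret short_odd_free V R' k by (rule R'(2))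
    define n where "n = real (card V)"
    have n: "0 < n" using asm by (simp add: n_def)
    define X where "X = (n / k) ^ k"
    have nk: "n ^ k = K * X" using assms(2) by (simp add: X_def K_def power_divide)
    have "2 * real k * (1 - \<delta>) * X \<le> card (cycles k R') + 2 * real k * \<delta> * X"
      using asm R'(3) by (simp add: X_def n_def)
    then have L': "2 * real k * (1 - 2 * \<delta>) * X \<le> card (cycles k R')" by (simp add: algebra_simps)
    have "\<delta> < 1 / 3" using \<delta> bp(2) by linarith
    then obtain xs where xs: "xs \<in> cycles k R'" "card (exceptional xs) \<le> 4 * \<delta> * n"
      using ex_cycle_few_exceptional[of \<delta>] \<delta>0 n L' unfolding X_def n_def by blast
    define U where "U = V - exceptional xs"
    obtain cl where cl: "\<And>x. x \<in> U \<Longrightarrow> cl x < k"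
        "\<And>x y. x \<in> U \<Longrightarrow> y \<in> U \<Longrightarrow> (x, y) \<in> R' \<Longrightarrow> (cl x, cl y) \<in> cadj k"
      using ex_class_map[OF xs(1)] unfolding U_def by blast
    define Q where "Q = R' \<inter> U \<times> U"
    have exV: "exceptional xs \<subseteq> V" by (auto simp: exceptional_def)
    define Z where "Z = {xs'. length xs' = k \<and> set xs' \<subseteq> V \<and> (\<exists>i<k. xs' ! i \<in> exceptional xs)}"
    have "cycles k R' \<subseteq> cycles k Q \<union> Z"
    proof
      fix ys assume ys: "ys \<in> cycles k R'"
      then have ysV: "set ys \<subseteq> V" "length ys = k" using set_cycles[OF _ RV] by (auto simp: cycles_def)
      show "ys \<in> cycles k Q \<union> Z"
      proof (cases "\<exists>i<k. ys ! i \<in> exceptional xs")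
        case False
        then have "ys ! i \<in> U" if "i < k" for i using ysV that by (auto simp: U_def)
        then show ?thesis using ys k_pos by (auto simp: cycles_def Q_def)
      qed (use ysV in \<open>auto simp: Z_def\<close>)
    qed
    then have "card (cycles k R') \<le> card (cycles k Q \<union> Z)"
    proof (rule card_mono[rotated], intro finite_UnI)
      have "Q \<subseteq> V \<times> V" using RV by (auto simp: Q_def)
      then show "finite (cycles k Q)" by (rule finite_cycles[OF finV])
      show "finite Z"
        by (rule finite_subset[OF _ finite_lists_length_eq[OF finV, of k]]) (auto simp: Z_def)
    qed
    also have "\<dots> \<le> card (cycles k Q) + card Z"
      by (rule card_Un_le)
    also have "card Z \<le> k * (card (exceptional xs) * card V ^ (k - 1))"
      unfolding Z_def by (rule card_lists_meeting_le[OF finV exV])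
    finally have "real (card (cycles k R')) \<le> real (card (cycles k Q) + k * (card (exceptional xs) * card V ^ (k - 1)))"
      by (simp only: of_nat_le_iff add_left_mono)
    also have "\<dots> = card (cycles k Q) + k * (real (card (exceptional xs)) * n ^ (k - 1))" by (simp add: n_def)
    also have "\<dots> \<le> card (cycles k Q) + k * (4 * \<delta> * n * n ^ (k - 1))"
      using xs(2) n by (intro add_left_mono mult_left_mono mult_right_mono) auto
    also have "4 * \<delta> * n * n ^ (k - 1) = 4 * \<delta> * (K * X)"
      using nk k_pos by (cases k) auto
    finally have "real (card (cycles k R')) \<le> card (cycles k Q) + k * (4 * \<delta> * (K * X))" .
    then have LQ: "2 * real k * (1 - 2 * \<delta>) * X - k * (4 * \<delta> * (K * X)) \<le> card (cycles k Q)" using L' by linarith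
    \<comment> \<open>Deleted edges cost a share \<open>2 * \<delta>\<close>, and the at most
      \<open>4 * \<delta> * n\<close> exceptional vertices a share \<open>2 * \<delta> * K\<close>;
      since \<open>K >= 1\<close>, their sum is at most \<open>\<gamma>\<close>.\<close>
    define \<gamma> where "\<gamma> = 4 * (\<delta> * K)"
    have X0: "0 \<le> X" using n by (simp add: X_def)
    have "2 * real k * (1 - \<gamma>) * X \<le> 2 * real k * (1 - 2 * \<delta>) * X - k * (4 * \<delta> * (K * X))"
    proof -
      have "2 * real k * (1 - 2 * \<delta>) * X - k * (4 * \<delta> * (K * X)) - 2 * real k * (1 - \<gamma>) * X
          = 4 * real k * X * \<delta> * (K - 1)" by (simp add: \<gamma>_def algebra_simps)
      moreover have "0 \<le> 4 * real k * X * \<delta> * (K - 1)" using X0 \<delta>0 K1 by simp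
      ultimately show ?thesis by linarith
    qed
    then have many: "2 * real k * (1 - \<gamma>) * (card V / k) ^ k \<le> card (cycles k Q)" using LQ by (simp add: X_def n_def)
    have "0 \<le> \<delta> * K" using \<delta>0 K1 by simp
    then have \<gamma>2: "\<gamma> \<le> 1 / 2" "0 \<le> \<gamma>" unfolding \<gamma>_def using le \<delta>K bp(2) by linarith+
    have g: "8 * real k ^ 2 * \<gamma> / \<beta> \<le> \<rho> / 2" unfolding \<gamma>_def \<delta>K using assms by simp
    have VU: "V - U = exceptional xs" using exV by (auto simp: U_def)
    have "4 * \<delta> * n \<le> \<rho> / 2 * n" using \<delta> bp(1) assms(4) n by (intro mult_right_mono) linarith+
    then have ex: "card (V - U) \<le> \<rho> / 2 * card V" using xs(2) unfolding VU n_def by linarith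
    show "\<exists>W. good_classes k V R \<beta> \<rho> W"
    proof (rule good_classes_of_hom[OF assms(1) _ finV _ _ assms(3) \<gamma>2(2) \<gamma>2(1) _ g ex _ cl(1) _ many])
      show "3 \<le> k" using assms(2) by simp
      show "0 < card V" using asm by simp
      show "U \<subseteq> V" by (auto simp: U_def)
      show "Q \<subseteq> R" "Q \<subseteq> U \<times> U" using R'(1) by (auto simp: Q_def)
      show "(cl x, cl y) \<in> cadj k" if "(x, y) \<in> Q" for x y using cl(2) that by (auto simp: Q_def)
    qed
  qed
qed

section \<open>From good classes to a blow-up\<close>

lemma ex_in_diff:
  assumes "finite B" "finite F" "card {y \<in> B. \<not> P y} + card F < card B"
  shows "\<exists>y\<in>B. P y \<and> y \<notin> F"
proof (rule ccontr)
  assume "\<not> ?thesis"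
  then have "B \<subseteq> {y \<in> B. \<not> P y} \<union> F" by auto
  then have "card B \<le> card ({y \<in> B. \<not> P y} \<union> F)" using assms(1,2) by (intro card_mono) auto
  also have "\<dots> \<le> card {y \<in> B. \<not> P y} + card F" by (rule card_Un_le)
  finally show False using assms(3) by simp
qed

text \<open>The size bounds exceed the number \<open>b\<close> of non-neighbours by the room \<open>k\<close> needed to keep
  a path of fewer than \<open>k\<close> vertices injective.\<close>

locale dense_classes =
  fixes V :: "'a set" and R :: "'a rel" and k b :: nat and W :: "nat \<Rightarrow> 'a set"
  assumes odd_k: "odd k" and k7: "7 \<le> k" and finV: "finite V" and RV: "R \<subseteq> V \<times> V" and symR: "sym R"
    and irreflR: "irrefl R" and cycle_free: "cycles (k - 2) R = {}"
    and WV: "\<And>i. i < k \<Longrightarrow> W i \<subseteq> V" and W_size: "\<And>i. i < k \<Longrightarrow> 2 * b + k < card (W i)"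
    and W_dense: "\<And>i j x. (i, j) \<in> cadj k \<Longrightarrow> x \<in> W i \<Longrightarrow> card {y \<in> W j. (x, y) \<notin> R} \<le> b"
begin

abbreviation "N x \<equiv> {y. (x, y) \<in> R}"

lemma finite_W: "i < k \<Longrightarrow> finite (W i)" using WV finV by (auto intro: finite_subset)

text \<open>A walk of \<open>C_k\<close> lifts greedily to a path: each step has at most
  \<open>b\<close> non-neighbours and at most \<open>k\<close> used vertices to avoid in the next
  class. The target \<open>B\<close> lets the path end in the neighbourhood of a prescribed
  vertex.\<close>

lemma embed_path:
  assumes "B \<subseteq> W j" "b + k < card B"
  shows "x \<in> W i \<Longrightarrow> (i, j) \<in> cadj k ^^ Suc l \<Longrightarrow> finite F \<Longrightarrow> card F + l \<le> k \<Longrightarrow>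
    \<exists>ps. length ps = Suc l \<and> distinct ps \<and> set ps \<inter> F = {} \<and> walk R (x # ps) \<and> last ps \<in> B"
proof (induction l arbitrary: x i F)
  case 0
  have ij: "(i, j) \<in> cadj k" using 0(2) by simp
  then have j: "j < k" by (auto simp: cadj_def)
  have finB: "finite B" using assms(1) finite_W[OF j] by (rule finite_subset)
  have "card {y \<in> B. (x, y) \<notin> R} \<le> card {y \<in> W j. (x, y) \<notin> R}"
    using assms(1) finite_W[OF j] by (intro card_mono) auto
  then have "card {y \<in> B. (x, y) \<notin> R} + card F < card B" using W_dense[OF ij 0(1)] 0(4) assms(2) by linarith
  then obtain y where "y \<in> B" "(x, y) \<in> R" "y \<notin> F" 
    using ex_in_diff[OF finB 0(3), of "\<lambda>y. (x, y) \<in> R"] by blast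
  then show ?case by (intro exI[of _ "[y]"]) auto
next
  case (Suc l)
  obtain i' where i': "(i, i') \<in> cadj k" "(i', j) \<in> cadj k ^^ Suc l" using Suc.prems(2) by (metis relpow_Suc_D2)
  then have ik: "i' < k" by (auto simp: cadj_def)
  have "card {y \<in> W i'. (x, y) \<notin> R} + card F < card (W i')"
    using W_dense[OF i'(1) Suc.prems(1)] Suc.prems(4) W_size[OF ik] by linarith
  then obtain y where y: "y \<in> W i'" "(x, y) \<in> R" "y \<notin> F"
    using ex_in_diff[OF finite_W[OF ik] Suc.prems(3), of "\<lambda>y. (x, y) \<in> R"] by blast
  have "card (insert y F) + l \<le> k" using Suc.prems(3,4) y(3) by simp
  then obtain ps where ps: "length ps = Suc l" "distinct ps" "set ps \<inter> insert y F = {}"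
      "walk R (y # ps)" "last ps \<in> B"
    using Suc.IH[OF y(1) i'(2), of "insert y F"] Suc.prems(3) by auto
  have "ps \<noteq> []" using ps(1) by auto
  then show ?case using ps y by (intro exI[of _ "y # ps"]) (auto simp: successively_Cons)
qed

text \<open>\<open>v\<close> behaves like a vertex of class \<open>i\<close>. The bound
  \<open>b + k\<close> is exactly what a lifted path needs in order to end in
  \<open>N v \<inter> W j\<close>.\<close>

definition attached :: "'a \<Rightarrow> nat \<Rightarrow> bool" where
  "attached v i \<longleftrightarrow> i < k \<and> (\<forall>j. (i, j) \<in> cadj k \<longrightarrow> b + k < card (N v \<inter> W j))"

lemma W_attached:
  assumes "i < k" "x \<in> W i" shows "attached x i"
  unfolding attached_def
proof (intro conjI allI impI assms(1))
  fix j assume ij: "(i, j) \<in> cadj k"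
  then have j: "j < k" by (auto simp: cadj_def)
  have "W j = {y \<in> W j. (x, y) \<notin> R} \<union> (N x \<inter> W j)" by auto
  then have "card (W j) \<le> card {y \<in> W j. (x, y) \<notin> R} + card (N x \<inter> W j)" by (metis card_Un_le)
  then show "b + k < card (N x \<inter> W j)" using W_dense[OF ij assms(2)] W_size[OF j] by linarith
qed

lemma ex_nbr_avoiding:
  assumes "j < k" "b + k < card (N x \<inter> W j)" "finite F" "card F \<le> k"
  shows "\<exists>p\<in>W j. (x, p) \<in> R \<and> p \<notin> F"
  using ex_in_diff[of "N x \<inter> W j" F "\<lambda>_. True"] finite_W[OF assms(1)] assms by auto

text \<open>If the classes are not adjacent, a walk of length \<open>k - 3\<close> joins them. Its
  first and last steps are realised at \<open>x\<close> and \<open>y\<close> through their large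
  neighbourhoods, the middle by a lifted path of fresh vertices, and the edge \<open>xy\<close>
  closes a genuine cycle on \<open>k - 2\<close> vertices.\<close>

lemma attached_adj:
  assumes xy: "(x, y) \<in> R" and x: "attached x i" and y: "attached y j"
  shows "(i, j) \<in> cadj k"
proof (rule ccontr)
  assume "(i, j) \<notin> cadj k"
  then have "(i, j) \<in> cadj k ^^ (k - 3)"
    using x y by (intro cadj_relpow_minus_3 odd_k k7) (auto simp: attached_def)
  moreover have k3: "k - 3 = Suc (Suc (Suc (k - 6)))" using k7 by simp
  ultimately have "(i, j) \<in> cadj k ^^ Suc (Suc (Suc (k - 6)))" by simp
  then obtain i' where i': "(i, i') \<in> cadj k" "(i', j) \<in> cadj k ^^ Suc (Suc (k - 6))" by (metis relpow_Suc_D2)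
  then obtain j' where j': "(i', j') \<in> cadj k ^^ Suc (k - 6)" "(j', j) \<in> cadj k" by (metis relpow_Suc_E)
  have lt: "i' < k" "j' < k" using i'(1) j'(2) by (auto simp: cadj_def)
  have jj: "(j, j') \<in> cadj k" using j'(2) sym_cadj by (auto dest: symD)
  have "card {x, y} \<le> k" using k7 card_insert_le_m1[of 2 "{y}" x] by (auto simp: card_insert_if)
  then obtain p where p: "p \<in> W i'" "(x, p) \<in> R" "p \<notin> {x, y}"
    using ex_nbr_avoiding[OF lt(1), of x "{x, y}"] x i'(1) by (auto simp: attached_def)
  have "card {x, y, p} + (k - 6) \<le> k" using k7 by (auto simp: card_insert_if)
  then obtain ps where ps: "length ps = Suc (k - 6)" "distinct ps" "set ps \<inter> {x, y, p} = {}"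
      "walk R (p # ps)" "last ps \<in> N y \<inter> W j'"
    using embed_path[of "N y \<inter> W j'" j' p i' "k - 6" "{x, y, p}"] p(1) j'(1) y jj by (auto simp: attached_def)
  have ne: "ps \<noteq> []" using ps(1) by auto
  have "(y, x) \<in> R" "(last ps, y) \<in> R" using xy ps(5) symR by (auto dest: symD)
  moreover have "x \<noteq> y" using xy irreflR by (auto simp: irrefl_def)
  ultimately have "x # p # ps @ [y] \<in> cycles (length (x # p # ps @ [y])) R"
    using ps p ne by (intro path_in_cycles) (auto simp: successively_Cons successively_append_iff)
  moreover have "length (x # p # ps @ [y]) = k - 2" using ps(1) k7 by simp
  ultimately show False using cycle_free by simp
qed

text \<open>The counterpart, with classes instead of positions, of the restriction on the neighbours
  of a vertex on a cycle: a lifted path of length \<open>k - 4\<close> between two large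
  neighbourhoods closes through \<open>v\<close>.\<close>

lemma big_classes_diff:
  assumes "i \<le> j" "j < k" "b + k < card (N v \<inter> W i)" "b + k < card (N v \<inter> W j)"
  shows "j = i \<or> j = i + 2 \<or> j + 2 = i + k"
proof (rule not_cadj_relpow_minus_4[OF odd_k k7 assms(1,2)])
  show "(i, j) \<notin> cadj k ^^ (k - 4)"
  proof
    assume "(i, j) \<in> cadj k ^^ (k - 4)"
    moreover have "k - 4 = Suc (k - 5)" using k7 by simp
    ultimately have ij: "(i, j) \<in> cadj k ^^ Suc (k - 5)" by simp
    obtain p where p: "p \<in> W i" "(v, p) \<in> R" "p \<notin> {v}"
      using ex_nbr_avoiding[of i v "{v}"] assms k7 by auto
    have "card {v, p} + (k - 5) \<le> k" using k7 by (auto simp: card_insert_if)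
    then obtain ps where ps: "length ps = Suc (k - 5)" "distinct ps" "set ps \<inter> {v, p} = {}"
        "walk R (p # ps)" "last ps \<in> N v \<inter> W j"
      using embed_path[of "N v \<inter> W j" j p i "k - 5" "{v, p}"] p(1) ij assms(4) by auto
    have ne: "ps \<noteq> []" using ps(1) by auto
    have "(last ps, v) \<in> R" using ps(5) symR by (auto dest: symD)
    then have "v # p # ps \<in> cycles (length (v # p # ps)) R"
      using ps p ne by (intro path_in_cycles) (auto simp: successively_Cons)
    moreover have "length (v # p # ps) = k - 2" using ps(1) k7 by simp
    ultimately show False using cycle_free by simp
  qed
qed

text \<open>Two different classes would be at distance two, and \<open>v\<close> would be attached
  to the class between them.\<close>

lemma big_classes_eq:
  assumes "\<And>l. \<not> attached v l" "i < k" "j < k" "b + k < card (N v \<inter> W i)" "b + k < card (N v \<inter> W j)"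
  shows "i = j"
proof -
  have *: "i = j" if "i \<le> j" "j < k" "b + k < card (N v \<inter> W i)" "b + k < card (N v \<inter> W j)" for i j
  proof (rule ccontr)
    assume "i \<noteq> j"
    then have d: "j = i + 2 \<or> j + 2 = i + k" using big_classes_diff[OF that] by auto
    have att: "attached v ((a + 1) mod k)" if "a < k" "b + k < card (N v \<inter> W a)" "b + k < card (N v \<inter> W ((a + 2) mod k))" for a
      unfolding attached_def using cadj_from_Suc[OF that(1)] that(2,3) k7 by auto
    from d show False
    proof
      assume "j = i + 2"
      then show False using att[of i] that assms(1) by simp
    next
      assume "j + 2 = i + k"
      then have "(j + 2) mod k = i" using that \<open>i \<noteq> j\<close> by simp
      then show False using att[of j] that assms(1) by simp
    qed
  qed
  then show ?thesis using assms by (metis linear)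
qed

text \<open>An unattached \<open>v\<close> has many neighbours in at most one class
  \<open>W i\<close>. A \<open>k\<close>-cycle through \<open>v\<close> that avoids the uncovered
  vertices and the few neighbours of \<open>v\<close> in other classes leaves \<open>v\<close> into
  \<open>W i\<close> and returns from \<open>W i\<close>; its other vertices then give a closed walk
  of odd length \<open>k - 2\<close> in \<open>C_k\<close>. So every cycle through \<open>v\<close>
  meets a small set, which bounds their number.\<close>

lemma ex_attached:
  assumes v: "v \<in> V"
    and many: "k * ((card (V - (\<Union>i<k. W i)) + k * (b + k)) * card V ^ (k - 2)) < card {xs \<in> cycles k R. xs ! 0 = v}"
  shows "\<exists>i. attached v i"
proof (rule ccontr)
  assume "\<not> ?thesis"
  then have not: "\<And>i. \<not> attached v i" by blast
  define R0 where "R0 = V - (\<Union>i<k. W i)"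
  define I where "I = {i. i < k \<and> b + k < card (N v \<inter> W i)}"
  define S where "S = (\<Union>i\<in>{..<k} - I. N v \<inter> W i)"
  have SV: "R0 \<union> S \<subseteq> V" using WV by (auto simp: R0_def S_def)
  have "card S \<le> (\<Sum>i\<in>{..<k} - I. card (N v \<inter> W i))" unfolding S_def by (rule card_UN_le) simp
  also have "\<dots> \<le> (\<Sum>i\<in>{..<k} - I. b + k)" by (intro sum_mono) (auto simp: I_def)
  also have "\<dots> = card ({..<k} - I) * (b + k)" by simp
  also have "\<dots> \<le> k * (b + k)"
  proof (intro mult_right_mono)
    have "card ({..<k} - I) \<le> card {..<k}" by (intro card_mono) auto
    then show "card ({..<k} - I) \<le> k" by simp
  qed simp
  finally have cS: "card S \<le> k * (b + k)" .
  let ?C = "{xs \<in> cycles k R. xs ! 0 = v}"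
  let ?Z = "{us. length us = k - 1 \<and> set us \<subseteq> V \<and> (\<exists>s<k - 1. us ! s \<in> R0 \<union> S)}"
  have "xs \<in> Cons v ` ?Z" if "xs \<in> ?C" for xs
  proof -
    have xs: "xs \<in> cycles k R" "xs ! 0 = v" "length xs = k" using that by (auto simp: cycles_def)
    obtain us where us: "xs = v # us" using xs(2,3) k7 by (cases xs) auto
    have len: "length us = k - 1" using xs(3) us by auto
    have usV: "set us \<subseteq> V" using set_cycles[OF xs(1) RV] us by auto
    have adj: "(xs ! i, xs ! (Suc i mod k)) \<in> R" if "i < k" for i using xs(1) that by (auto simp: cycles_def)
    have "\<exists>s<k - 1. us ! s \<in> R0 \<union> S"
    proof (rule ccontr)
      assume "\<not> ?thesis"
      then have no: "us ! s \<notin> R0" "us ! s \<notin> S" if "s < k - 1" for s using that by auto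
      have inW: "\<exists>i<k. us ! s \<in> W i" if "s < k - 1" for s
      proof -
        have "us ! s \<in> V" using usV len that by (metis nth_mem subsetD)
        then show ?thesis using no(1)[OF that] by (auto simp: R0_def)
      qed
      have "(v, us ! 0) \<in> R" using adj[of 0] us k7 by simp
      then obtain i where i: "i \<in> I" "us ! 0 \<in> W i" using inW[of 0] no(2)[of 0] k7 by (auto simp: S_def)
      have "Suc (k - 1) mod k = 0" "k - 1 < k" using k7 by auto
      then have "(us ! (k - 2), v) \<in> R" using adj[of "k - 1"] us k7 by (simp add: nth_Cons' numeral_2_eq_2)
      then have "(v, us ! (k - 2)) \<in> R" using symR by (auto dest: symD)
      moreover have "k - 2 < k - 1" using k7 by simp
      ultimately obtain j where j: "j \<in> I" "us ! (k - 2) \<in> W j"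
        using inW[of "k - 2"] no(2)[of "k - 2"] by (auto simp: S_def)
      have "i = j" using big_classes_eq[OF not] i j by (auto simp: I_def)
      obtain g where g: "\<And>s. s < k - 1 \<Longrightarrow> g s < k \<and> us ! s \<in> W (g s)" using inW by metis
      \<comment> \<open>Both ends receive the common class \<open>i\<close>, as \<open>g\<close> may
        have picked another class containing the same vertex.\<close>
      define f where "f s = (if s = 0 \<or> s = k - 2 then i else g s)" for s
      have f: "attached (us ! s) (f s)" if "s \<le> k - 2" for s
        using that i j \<open>i = j\<close> g[of s] k7 by (intro W_attached) (auto simp: f_def I_def)
      have "(f s, f (Suc s)) \<in> cadj k" if "s < k - 2" for s
      proof (rule attached_adj[OF _ f f])
        show "(us ! s, us ! Suc s) \<in> R" using adj[of "Suc s"] us that by simp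
      qed (use that in auto)
      moreover have "f (k - 2) = f 0" by (simp add: f_def)
      moreover have "odd (k - 2)" using odd_k k7 by simp
      ultimately have "k \<le> k - 2" using odd_closed_walk_cadj(1)[of "k - 2" f k] by blast
      then show False using k7 by simp
    qed
    then show ?thesis using us len usV by auto
  qed
  then have "?C \<subseteq> Cons v ` ?Z" by blast
  moreover have finZ: "finite ?Z"
    by (rule finite_subset[OF _ finite_lists_length_eq[OF finV, of "k - 1"]]) auto
  ultimately have "card ?C \<le> card (Cons v ` ?Z)" by (intro card_mono) auto
  also have "\<dots> \<le> card ?Z" using finZ by (rule card_image_le)
  also have "\<dots> \<le> (k - 1) * (card (R0 \<union> S) * card V ^ (k - 1 - 1))" by (rule card_lists_meeting_le[OF finV SV])
  also have "\<dots> \<le> k * ((card R0 + k * (b + k)) * card V ^ (k - 2))"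
  proof (intro mult_mono)
    show "card (R0 \<union> S) \<le> card R0 + k * (b + k)" using card_Un_le[of R0 S] cS by linarith
    have "k - 1 - 1 = k - 2" by simp
    then show "card V ^ (k - 1 - 1) \<le> card V ^ (k - 2)" by simp
  qed auto
  finally show False using many by (simp add: R0_def)
qed

end

text \<open>The degree condition asks for half of \<open>2 * (n/k)^(k-1)\<close>, the number of
  labelled cycles starting at a vertex of a blow-up with parts of size \<open>n/k\<close>.\<close>

lemma ex_cycle_partition:
  assumes "odd k" "7 \<le> k"
  shows "\<exists>\<delta>>0. \<exists>n0. \<forall>(V :: 'a set) R. cycle_free_on (k - 2) V R \<and> n0 \<le> card V \<and>
      2 * real k * (1 - \<delta>) * (card V / k) ^ k \<le> card (cycles k R) \<and>
      (\<forall>v\<in>V. (card V / k) ^ (k - 1) \<le> card {xs \<in> cycles k R. xs ! 0 = v})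
    \<longrightarrow> (\<exists>cl. (\<forall>v\<in>V. cl v < k) \<and> (\<forall>(x, y)\<in>R. (cl x, cl y) \<in> cadj k))"
proof -
  define K where "K = real k ^ k"
  have K1: "1 \<le> K" using assms(2) by (simp add: K_def)
  have k7: "7 \<le> real k" using assms(2) by simp
  \<comment> \<open>With \<open>Y = n / K\<close> both \<open>k * \<beta> * n\<close> and
    \<open>\<rho> * n\<close> equal \<open>Y / 4\<close>. Classes then have size at least
    \<open>Y / 4\<close>, while the set met by all cycles of an unattached vertex has at most
    \<open>Y / 2 + k^2 < Y\<close> elements; and \<open>k * Y * n^(k-2)\<close> is the degree bound
    \<open>(n/k)^(k-1)\<close>.\<close>
  define \<beta> \<rho> where "\<beta> = 1 / (4 * real k * K)" and "\<rho> = 1 / (4 * K)"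
  have pos: "0 < \<beta>" "0 < \<rho>" using K1 k7 by (auto simp: \<beta>_def \<rho>_def)
  have "1 \<le> 4 * real k * K" using mult_mono[of 1 "4 * real k" 1 K] K1 k7 by simp
  then have le1: "\<beta> \<le> 1" "\<rho> \<le> 1" using K1 by (auto simp: \<beta>_def \<rho>_def divide_le_eq_1)
  obtain \<delta> n1 where \<delta>: "0 < \<delta>" and n1: "\<And>(V :: 'a set) R. cycle_free_on (k - 2) V R \<and> n1 \<le> card V \<and>
      2 * real k * (1 - \<delta>) * (card V / k) ^ k \<le> card (cycles k R) \<Longrightarrow> \<exists>W. good_classes k V R \<beta> \<rho> W"
    using ex_good_classes[OF assms pos le1, where 'a = 'a] by metis
  define n2 where "n2 = n1 + nat \<lceil>8 * K * real k ^ 2\<rceil> + 1"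
  show ?thesis
  proof (intro exI[of _ \<delta>] conjI \<delta> exI[of _ n2] allI impI)
    fix V :: "'a set" and R
    assume asm: "cycle_free_on (k - 2) V R \<and> n2 \<le> card V \<and>
      2 * real k * (1 - \<delta>) * (card V / k) ^ k \<le> card (cycles k R) \<and>
      (\<forall>v\<in>V. (card V / k) ^ (k - 1) \<le> card {xs \<in> cycles k R. xs ! 0 = v})"
    then have free: "finite V" "R \<subseteq> V \<times> V" "sym R" "irrefl R" "cycles (k - 2) R = {}"
      by (auto simp: cycle_free_on_def)
    define n where "n = real (card V)"
    have n: "8 * K * real k ^ 2 < n" using asm unfolding n2_def n_def by linarith
    have n0: "0 < n" using n K1 by (smt (verit) mult_nonneg_nonneg zero_le_power2)
    define Y where "Y = n / K"
    have nK: "8 * real k ^ 2 < Y" using n K1 by (simp add: Y_def field_simps)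
    obtain W where "good_classes k V R \<beta> \<rho> W" using n1[of V R] asm by (auto simp: n2_def)
    then have W: "\<And>i. i < k \<Longrightarrow> W i \<subseteq> V" "\<And>i. i < k \<Longrightarrow> (1 / (2 * K) - \<rho>) * n \<le> real (card (W i))"
        "\<And>i j x. (i, j) \<in> cadj k \<Longrightarrow> x \<in> W i \<Longrightarrow> real (card {y \<in> W j. (x, y) \<notin> R}) \<le> \<beta> * n"
        "real (card (V - (\<Union>i<k. W i))) \<le> \<rho> * n"
      by (auto simp: good_classes_def K_def n_def)
    define b where "b = nat \<lfloor>\<beta> * n\<rfloor>"
    have b: "real b \<le> \<beta> * n" using pos n0 by (simp add: b_def)
    have \<beta>n: "real k * (\<beta> * n) = Y / 4" "\<rho> * n = Y / 4" using K1 k7 by (auto simp: \<beta>_def \<rho>_def Y_def)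
    have k2: "real k \<le> real k ^ 2" using k7 by (simp add: power2_eq_square)
    have "7 * (\<beta> * n) \<le> real k * (\<beta> * n)" using pos n0 k7 by (intro mult_right_mono) auto
    then have 7: "7 * (\<beta> * n) \<le> Y / 4" using \<beta>n by simp
    interpret dense_classes V R k b W
    proof
      show "2 * b + k < card (W i)" if "i < k" for i
      proof -
        have "(1 / (2 * K) - \<rho>) * n = Y / 4" using K1 by (simp add: \<rho>_def Y_def field_simps)
        then have "Y / 4 \<le> real (card (W i))" using W(2)[OF that] by simp
        moreover have "2 * real b + real k < Y / 4" using b 7 nK k2 by linarith
        ultimately have "real (2 * b + k) < real (card (W i))" by simp
        then show ?thesis by (simp only: of_nat_less_iff)
      qed
      show "card {y \<in> W j. (x, y) \<notin> R} \<le> b" if "(i, j) \<in> cadj k" "x \<in> W i" for i j x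
        using W(3)[OF that] unfolding b_def by (simp add: le_nat_floor)
    qed (use assms free W in auto)
    have "\<exists>i. attached v i" if "v \<in> V" for v
    proof (rule ex_attached[OF that])
      define r where "r = card (V - (\<Union>i<k. W i))"
      have "real (r + k * (b + k)) \<le> Y / 4 + Y / 4 + real k ^ 2"
      proof -
        have "real k * real b \<le> real k * (\<beta> * n)" using b by (intro mult_left_mono) auto
        then show ?thesis using W(4) \<beta>n by (simp add: r_def algebra_simps power2_eq_square)
      qed
      also have "\<dots> < Y" using nK k2 k7 by linarith
      finally have "real (r + k * (b + k)) < Y" .
      then have "real (r + k * (b + k)) * n ^ (k - 2) < Y * n ^ (k - 2)" using n0 by (intro mult_strict_right_mono) auto
      then have "real k * (real (r + k * (b + k)) * n ^ (k - 2)) < real k * (Y * n ^ (k - 2))"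
        using k7 by (intro mult_strict_left_mono) auto
      also have "\<dots> = (n / k) ^ (k - 1)"
      proof -
        have e: "k - 1 = Suc (k - 2)" using assms(2) by simp
        have "n ^ (k - 1) = n * n ^ (k - 2)" unfolding e by simp
        moreover have "K = real k * real k ^ (k - 1)" using assms(2) unfolding K_def by (cases k) auto
        ultimately show ?thesis using k7 by (simp add: power_divide Y_def)
      qed
      also have "\<dots> \<le> card {xs \<in> cycles k R. xs ! 0 = v}" using asm that by (simp add: n_def)
      finally have "real (k * ((r + k * (b + k)) * card V ^ (k - 2))) < real (card {xs \<in> cycles k R. xs ! 0 = v})"
        by (simp add: n_def)
      then show "k * ((card (V - (\<Union>i<k. W i)) + k * (b + k)) * card V ^ (k - 2)) < card {xs \<in> cycles k R. xs ! 0 = v}"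
        unfolding r_def by (simp only: of_nat_less_iff)
    qed
    then obtain cl where cl: "\<And>v. v \<in> V \<Longrightarrow> attached v (cl v)" by metis
    then have "\<forall>(x, y)\<in>R. (cl x, cl y) \<in> cadj k" using attached_adj RV by blast
    moreover have "\<forall>v\<in>V. cl v < k" using cl by (auto simp: attached_def)
    ultimately show "\<exists>cl. (\<forall>v\<in>V. cl v < k) \<and> (\<forall>(x, y)\<in>R. (cl x, cl y) \<in> cadj k)" by blast
  qed
qed

section \<open>Comparison with complete balanced blow-ups\<close>

lemma card_cycles_remove_vertex:
  assumes "finite V" "R \<subseteq> V \<times> V" "0 < k"
  shows "card (cycles k R) \<le> card (cycles k (R \<inter> (V - {v}) \<times> (V - {v}))) + k * card {xs \<in> cycles k R. xs ! 0 = v}"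
proof -
  let ?Q = "R \<inter> (V - {v}) \<times> (V - {v})"
  let ?Z = "\<lambda>i. {xs \<in> cycles k R. xs ! i = v}"
  have fin: "finite (cycles k R)" by (rule finite_cycles[OF assms(1,2)])
  have "cycles k R \<subseteq> cycles k ?Q \<union> (\<Union>i<k. ?Z i)"
  proof
    fix xs assume xs: "xs \<in> cycles k R"
    show "xs \<in> cycles k ?Q \<union> (\<Union>i<k. ?Z i)"
    proof (cases "\<exists>i<k. xs ! i = v")
      case False
      moreover have "xs ! i \<in> V" if "i < k" for i using set_cycles[OF xs assms(2)] xs that by (auto simp: cycles_def)
      ultimately have "xs ! i \<in> V - {v}" if "i < k" for i using that by auto
      then show ?thesis using xs assms(3) by (auto simp: cycles_def)
    qed (use xs in auto)
  qed
  then have "card (cycles k R) \<le> card (cycles k ?Q \<union> (\<Union>i<k. ?Z i))"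
    using fin finite_cycles[OF assms(1), of ?Q] assms(2) by (intro card_mono) auto
  also have "\<dots> \<le> card (cycles k ?Q) + card (\<Union>i<k. ?Z i)" by (rule card_Un_le)
  also have "card (\<Union>i<k. ?Z i) \<le> (\<Sum>i<k. card (?Z i))" by (rule card_UN_le) simp
  also have "\<dots> \<le> (\<Sum>i<k. card (?Z 0))"
  proof (intro sum_mono)
    fix i assume i: "i \<in> {..<k}"
    show "card (?Z i) \<le> card (?Z 0)"
    proof (rule card_inj_on_le)
      show "inj_on (rotate i) (?Z i)"
      proof (rule inj_on_inverseI)
        fix xs assume "xs \<in> ?Z i"
        then show "rotate (k - i) (rotate i xs) = xs" using i by (simp add: rotate_rotate cycles_def)
      qed
      show "rotate i ` ?Z i \<subseteq> ?Z 0"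
      proof
        fix ys assume "ys \<in> rotate i ` ?Z i"
        then obtain xs where xs: "xs \<in> cycles k R" "xs ! i = v" "ys = rotate i xs" by auto
        then have "length xs = k" by (simp add: cycles_def)
        then have "ys ! 0 = v" using xs i assms(3) by (simp add: nth_rotate)
        then show "ys \<in> ?Z 0" using rotate_in_cycles[OF xs(1), of i] xs(3) by simp
      qed
      show "finite (?Z 0)" using fin by simp
    qed
  qed
  also have "\<dots> = k * card (?Z 0)" by simp
  finally show ?thesis by simp
qed

lemma cycle_free_on_restrict:
  assumes "cycle_free_on m V R" "U \<subseteq> V" shows "cycle_free_on m U (Restr R U)"
proof -
  have "cycles m (Restr R U) \<subseteq> cycles m R" by (rule cycles_mono) auto
  then show ?thesis using assms by (auto simp: cycle_free_on_def sym_def irrefl_def intro: finite_subset)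
qed

text \<open>As no class is empty, every pair from adjacent classes starts some labelled cycle of the
  complete blow-up. Equality of the counts puts this list into \<open>cycles k R\<close>, so the
  pair is in \<open>R\<close>.\<close>

lemma complete_blowup_of_card_cycles:
  assumes "odd k" "3 \<le> k" "finite V" "R \<subseteq> V \<times> V" "\<And>v. v \<in> V \<Longrightarrow> cl v < k"
    and hom: "\<And>x y. (x, y) \<in> R \<Longrightarrow> (cl x, cl y) \<in> cadj k"
    and many: "card (hom_lists k cl V) \<le> card (cycles k R)" and ne: "\<And>i. i < k \<Longrightarrow> {v \<in> V. cl v = i} \<noteq> {}"
  shows "R = {(x, y). x \<in> V \<and> y \<in> V \<and> (cl x, cl y) \<in> cadj k}"
proof (intro equalityI subsetI)
  fix p assume "p \<in> R"
  then show "p \<in> {(x, y). x \<in> V \<and> y \<in> V \<and> (cl x, cl y) \<in> cadj k}" using assms(4) hom by auto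
next
  fix p assume "p \<in> {(x, y). x \<in> V \<and> y \<in> V \<and> (cl x, cl y) \<in> cadj k}"
  then obtain x y where p: "p = (x, y)" "x \<in> V" "y \<in> V" "(cl x, cl y) \<in> cadj k" by auto
  have sub: "cycles k R \<subseteq> hom_lists k cl V" using assms(4) hom by (rule cycles_subset_hom_lists)
  have "finite (hom_lists k cl V)"
    by (rule finite_subset[OF _ finite_lists_length_eq[OF assms(3), of k]]) (auto simp: hom_lists_def)
  then have eq: "cycles k R = hom_lists k cl V" using sub many by (intro card_seteq)
  have ik: "cl x < k" using assms(5) p(2) .
  obtain c where c: "c \<in> {1, k - 1}" "cl y = (cl x + c) mod k" using p(4) cadj_iff[OF ik] by blast
  have "\<forall>i. \<exists>v. i < k \<longrightarrow> v \<in> V \<and> cl v = i" using ne by blast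
  then obtain r where r: "\<And>i. i < k \<Longrightarrow> r i \<in> V \<and> cl (r i) = i" by metis
  define xs where "xs = map (\<lambda>s. if s = 0 then x else if s = 1 then y else r ((cl x + c * s) mod k)) [0..<k]"
  have "length xs = k \<and> (\<forall>s<k. xs ! s \<in> {v \<in> V. cl v = (cl x + c * s) mod k})"
    using p ik c(2) r assms(2) by (auto simp: xs_def)
  then have "xs \<in> hom_lists k cl V" unfolding hom_lists_eq[OF assms(1)] using ik c(1) by blast
  then have "xs \<in> cycles k R" using eq by simp
  then have "\<forall>i<k. (xs ! i, xs ! (Suc i mod k)) \<in> R" by (simp add: cycles_def)
  then have "(xs ! 0, xs ! (Suc 0 mod k)) \<in> R" using ik by (metis gr_zeroI less_zeroE)
  then show "p \<in> R" using assms(2) by (simp add: xs_def p(1))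
qed

lemma card_cycles_le_power:
  assumes "finite V" "R \<subseteq> V \<times> V" shows "card (cycles k R) \<le> card V ^ k"
proof -
  have "cycles k R \<subseteq> {xs. set xs \<subseteq> V \<and> length xs = k}" using set_cycles[OF _ assms(2)] by (auto simp: cycles_def)
  then have "card (cycles k R) \<le> card {xs. set xs \<subseteq> V \<and> length xs = k}"
    by (intro card_mono finite_lists_length_eq assms(1))
  then show ?thesis using card_lists_length_eq[OF assms(1)] by simp
qed

text \<open>Vertices lying on few cycles are discarded by maximising the surplus over \<open>pmax\<close> among all
  induced subgraphs, where the linear penalty makes up for the discarded vertices.\<close>

lemma extremal_is_blowup:
  assumes "odd k" "7 \<le> k"
  shows "\<exists>n0. \<forall>(V :: 'a set) R. cycle_free_on (k - 2) V R \<and> n0 \<le> card V \<and> 2 * k * pmax k (card V) \<le> card (cycles k R)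
    \<longrightarrow> card (cycles k R) = 2 * k * pmax k (card V) \<and>
      (\<exists>cl. (\<forall>v\<in>V. cl v < k) \<and> R = {(x, y). x \<in> V \<and> y \<in> V \<and> (cl x, cl y) \<in> cadj k} \<and>
        (\<forall>i<k. \<forall>j<k. card {v \<in> V. cl v = i} \<le> card {v \<in> V. cl v = j} + 1))"
proof -
  have k0: "0 < k" "3 \<le> k" using assms(2) by auto
  obtain \<delta> n1 where \<delta>: "0 < \<delta>" and n1: "\<forall>(V :: 'a set) R. cycle_free_on (k - 2) V R \<and> n1 \<le> card V \<and>
      2 * real k * (1 - \<delta>) * (card V / k) ^ k \<le> card (cycles k R) \<and>
      (\<forall>v\<in>V. (card V / k) ^ (k - 1) \<le> card {xs \<in> cycles k R. xs ! 0 = v})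
    \<longrightarrow> (\<exists>cl. (\<forall>v\<in>V. cl v < k) \<and> (\<forall>(x, y)\<in>R. (cl x, cl y) \<in> cadj k))"
    using ex_cycle_partition[OF assms, where 'a = 'a] by blast
  obtain n2 where n2: "\<And>(V :: 'a set) R. cycle_free_on (k - 2) V R \<and> n2 \<le> card V \<Longrightarrow>
    real (card (cycles k R)) \<le> 2 * real k * (1 + 1 / 16) * (real (card V) / k) ^ k"
    using card_cycles_asymp_le[OF assms, of "1 / 16", where 'a = 'a] by auto
  obtain n3 where n3: "\<And>n. n3 \<le> n \<Longrightarrow> (1 - min \<delta> (1 / 16)) * (real n / k) ^ k \<le> real (n div k) ^ k"
    using floor_power_ge[OF k0(1), of "min \<delta> (1 / 16)" k] \<delta> by auto
  obtain n4 where n4: "\<And>n. n4 \<le> n \<Longrightarrow> (1 - 1 / 4) * (real n / k) ^ (k - 1) \<le> real (n div k) ^ (k - 1)"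
    using floor_power_ge[OF k0(1), of "1 / 4" "k - 1"] by auto
  define m0 where "m0 = n2 + n3"
  \<comment> \<open>The optimal \<open>U\<close> will have at least half of the vertices, hence the
    factor 2; \<open>m0 ^ k\<close> bounds the cycles on a set too small for the asymptotic
    estimates.\<close>
  define n5 where "n5 = 2 * (n1 + n3 + n4 + k) + m0 ^ k + 1"
  show ?thesis
  proof (intro exI[of _ n5] allI impI)
    fix V :: "'a set" and R
    assume asm: "cycle_free_on (k - 2) V R \<and> n5 \<le> card V \<and> 2 * k * pmax k (card V) \<le> card (cycles k R)"
    then have free: "cycle_free_on (k - 2) V R" and finV: "finite V" and RV: "R \<subseteq> V \<times> V"
      by (auto simp: cycle_free_on_def)
    define n where "n = card V"
    define L where "L U = real (card (cycles k (Restr R U)))" for U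
    define p where "p m = 2 * real k * real (pmax k m)" for m
    \<comment> \<open>By \<open>pmax_Suc_ge\<close> one vertex accounts for at least
      \<open>3/2 * k * (m/k)^(k-1)\<close> labelled cycles. For \<open>m >= n/2\<close> the penalty
      \<open>\<mu>\<close> is at most \<open>k/2 * (m/k)^(k-1)\<close>, leaving the required degree
      times \<open>k\<close>.\<close>
    define \<mu> where "\<mu> = real k / 2 * (real n / (2 * k)) ^ (k - 1)"
    define \<Phi> where "\<Phi> U = L U - p (card U) + \<mu> * card U" for U
    have nge: "2 * (n1 + n3 + n4 + k) + m0 ^ k + 1 \<le> n" using asm by (simp add: n5_def n_def)
    have \<mu>0: "0 < \<mu>" using nge k0 by (simp add: \<mu>_def)
    have "Max (\<Phi> ` Pow V) \<in> \<Phi> ` Pow V" using finV by (intro Max_in) auto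
    then obtain U where U: "U \<subseteq> V" "\<Phi> U = Max (\<Phi> ` Pow V)" by auto
    have maxU: "\<Phi> U' \<le> \<Phi> U" if "U' \<subseteq> V" for U' unfolding U(2) using finV that by (intro Max_ge) auto
    define m where "m = card U"
    have finU: "finite U" using U(1) finV by (rule finite_subset)
    have mn: "m \<le> n" unfolding m_def n_def using finV U(1) by (rule card_mono)
    have freeU: "cycle_free_on (k - 2) U (Restr R U)" using free U(1) by (rule cycle_free_on_restrict)
    have RR: "R \<inter> V \<times> V = R" using RV by auto
    have "p n \<le> L V" unfolding L_def p_def RR n_def using asm by (metis of_nat_le_iff of_nat_mult of_nat_numeral)
    then have surplus: "\<mu> * (real n - real m) \<le> L U - p m"
      using maxU[of V] by (simp add: \<Phi>_def m_def n_def algebra_simps)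
    have m2: "real n / 2 \<le> real m"
    proof (rule ccontr)
      assume "\<not> ?thesis"
      then have m: "real m < real n / 2" by simp
      then have "\<mu> * (real n / 2) < \<mu> * (real n - real m)" using \<mu>0 by (intro mult_strict_left_mono) auto
      then have lt: "\<mu> * (real n / 2) < L U - p m" using surplus by linarith
      show False
      \<comment> \<open>A small \<open>U\<close> would need a surplus of at least
        \<open>\<mu> * n / 2\<close>; the asymptotic bound refutes this from \<open>m0\<close> on,
        the trivial bound below.\<close>
      proof (cases "m0 \<le> m")
        case True
        have "L U \<le> 2 * real k * (1 + 1 / 16) * (real m / k) ^ k"
          using n2[of U "Restr R U"] freeU True by (simp add: L_def m_def m0_def)
        moreover have "(1 - 1 / 16) * (real m / k) ^ k \<le> real (pmax k m)"
        proof -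
          have "(1 - 1 / 16) * (real m / k) ^ k \<le> (1 - min \<delta> (1 / 16)) * (real m / k) ^ k"
            by (intro mult_right_mono) auto
          also have "\<dots> \<le> real (m div k) ^ k" using True by (intro n3) (simp add: m0_def)
          also have "\<dots> \<le> real (pmax k m)" using pmax_ge_power[OF k0(1), of m] by (metis of_nat_le_iff of_nat_power)
          finally show ?thesis .
        qed
        then have "2 * real k * ((1 - 1 / 16) * (real m / k) ^ k) \<le> p m"
          unfolding p_def by (intro mult_left_mono) auto
        \<comment> \<open>The upper and lower estimates differ by the factor
          \<open>17/16 - 15/16 = 1/8\<close>, and \<open>2 * k / 8 = k / 4\<close>.\<close>
        ultimately have "L U - p m \<le> real k / 4 * (real m / k) ^ k" by (simp add: algebra_simps)
        also have "\<dots> \<le> real k / 4 * (real n / (2 * k)) ^ k"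
          using m k0 by (intro mult_left_mono power_mono) (auto simp: field_simps)
        also have "(real n / (2 * k)) ^ k = real n / (2 * k) * (real n / (2 * k)) ^ (k - 1)"
          using k0(1) by (cases k) auto
        also have "real k / 4 * (real n / (2 * k) * (real n / (2 * k)) ^ (k - 1)) = real n / 8 * (real n / (2 * k)) ^ (k - 1)"
          using k0(1) by simp
        also have "\<dots> \<le> real k / 4 * real n * (real n / (2 * k)) ^ (k - 1)"
        proof (intro mult_right_mono)
          have "1 / 8 * real n \<le> real k / 4 * real n" using k0(1) by (intro mult_right_mono) auto
          then show "real n / 8 \<le> real k / 4 * real n" by simp
        qed simp
        finally have "L U - p m \<le> \<mu> * (real n / 2)" by (simp add: \<mu>_def mult_ac)
        then show False using lt by linarith
      next
        case False
        have "card (cycles k (Restr R U)) \<le> m ^ k" unfolding m_def by (rule card_cycles_le_power[OF finU]) auto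
        also have "\<dots> \<le> m0 ^ k" using False by (intro power_mono) auto
        finally have "L U \<le> real (m0 ^ k)" unfolding L_def by (rule of_nat_mono)
        moreover have "0 \<le> p m" by (simp add: p_def)
        ultimately have "L U - p m \<le> real n" using nge by linarith
        moreover have "real n \<le> \<mu> * (real n / 2)"
        proof -
          have "2 * k \<le> n" using nge by simp
          then have "1 \<le> real n / (2 * k)" using k0(1) by (simp add: field_simps)
          then have "1 \<le> (real n / (2 * k)) ^ (k - 1)" by (rule one_le_power)
          then have "2 * 1 \<le> \<mu>" unfolding \<mu>_def using assms(2) by (intro mult_mono) auto
          then have "2 * (real n / 2) \<le> \<mu> * (real n / 2)" by (intro mult_right_mono) auto
          then show ?thesis by simp
        qed
        ultimately show False using lt by linarith
      qed
    qed
    then have "real n \<le> real (2 * m)" by simp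
    then have "n \<le> 2 * m" by (simp only: of_nat_le_iff)
    moreover have "2 * (n1 + n3 + n4 + k) \<le> n" using nge by (meson add_leD1)
    ultimately have "2 * (n1 + n3 + n4 + k) \<le> 2 * m" by (rule order_trans[rotated])
    then have mge: "n1 + n3 + n4 + k \<le> m" by (rule mult_left_le_imp_le) simp
    then have m1: "1 \<le> m" using k0 by simp
    have km: "k \<le> m" using mge by simp
    have pm: "p m \<le> L U"
    proof -
      have "0 \<le> \<mu> * (real n - real m)" using \<mu>0 mn by simp
      then show ?thesis using surplus by linarith
    qed
    have LU: "2 * real k * (1 - \<delta>) * (card U / k) ^ k \<le> card (cycles k (Restr R U))"
    proof -
      have "(1 - \<delta>) * (real m / k) ^ k \<le> (1 - min \<delta> (1 / 16)) * (real m / k) ^ k"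
        by (intro mult_right_mono) auto
      also have "\<dots> \<le> real (m div k) ^ k" using mge by (intro n3) simp
      also have "\<dots> \<le> real (pmax k m)" using pmax_ge_power[OF k0(1), of m] by (metis of_nat_le_iff of_nat_power)
      finally have "2 * real k * ((1 - \<delta>) * (real m / k) ^ k) \<le> p m" unfolding p_def by (intro mult_left_mono) auto
      then show ?thesis using pm by (simp add: L_def m_def mult.assoc)
    qed
    have deg: "(card U / k) ^ (k - 1) \<le> card {xs \<in> cycles k (Restr R U). xs ! 0 = v}" if v: "v \<in> U" for v
    proof -
      define d where "d = real (card {xs \<in> cycles k (Restr R U). xs ! 0 = v})"
      have cUv: "card (U - {v}) = m - 1" using v finU by (simp add: m_def)
      have "(Restr R U) \<inter> (U - {v}) \<times> (U - {v}) = R \<inter> (U - {v}) \<times> (U - {v})" by auto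
      then have "card (cycles k (Restr R U)) \<le> card (cycles k (R \<inter> (U - {v}) \<times> (U - {v})))
          + k * card {xs \<in> cycles k (Restr R U). xs ! 0 = v}"
        using card_cycles_remove_vertex[OF finU, of "Restr R U" k v] k0(1) by simp
      then have "L U \<le> real (card (cycles k (R \<inter> (U - {v}) \<times> (U - {v})))
          + k * card {xs \<in> cycles k (Restr R U). xs ! 0 = v})" unfolding L_def by (rule of_nat_mono)
      then have Ld: "L U \<le> L (U - {v}) + real k * d" by (simp add: L_def d_def)
      \<comment> \<open>Maximality of \<open>U\<close> against the removal of \<open>v\<close>
        bounds the number of cycles through \<open>v\<close> from below.\<close>
      have "\<Phi> (U - {v}) \<le> \<Phi> U" using U(1) by (intro maxU) auto
      then have "L (U - {v}) - p (m - 1) + \<mu> * real (m - 1) \<le> L U - p m + \<mu> * real m"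
        unfolding \<Phi>_def cUv m_def[symmetric] by simp
      moreover have "real (m - 1) = real m - 1" using m1 by simp
      ultimately have "L (U - {v}) - p (m - 1) - \<mu> \<le> L U - p m" by (simp add: algebra_simps)
      then have 1: "p m - p (m - 1) - \<mu> \<le> real k * d" using Ld by linarith
      have "pmax k (m - 1) + (m div k) ^ (k - 1) \<le> pmax k m" using pmax_Suc_ge[OF k0(1), of "m - 1"] m1 by simp
      then have "real (pmax k (m - 1)) + real (m div k) ^ (k - 1) \<le> real (pmax k m)"
        by (metis of_nat_add of_nat_le_iff of_nat_power)
      moreover have "(1 - 1 / 4) * (real m / k) ^ (k - 1) \<le> real (m div k) ^ (k - 1)" using mge by (intro n4) simp
      ultimately have "3 / 4 * (real m / k) ^ (k - 1) \<le> real (pmax k m) - real (pmax k (m - 1))" by simp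
      then have "2 * real k * (3 / 4 * (real m / k) ^ (k - 1)) \<le> 2 * real k * (real (pmax k m) - real (pmax k (m - 1)))"
        by (intro mult_left_mono) auto
      then have 2: "3 / 2 * real k * (real m / k) ^ (k - 1) \<le> p m - p (m - 1)"
        by (simp add: p_def algebra_simps)
      have "(real n / (2 * k)) ^ (k - 1) \<le> (real m / k) ^ (k - 1)"
        using m2 k0 by (intro power_mono) (auto simp: field_simps)
      then have "\<mu> \<le> real k / 2 * (real m / k) ^ (k - 1)" unfolding \<mu>_def by (intro mult_left_mono) auto
      then have "real k * (real m / k) ^ (k - 1) \<le> real k * d" using 1 2 by (simp add: algebra_simps)
      then show ?thesis using k0(1) by (simp add: d_def m_def)
    qed
    obtain cl where cl: "\<forall>v\<in>U. cl v < k" "\<forall>(x, y)\<in>R \<inter> U \<times> U. (cl x, cl y) \<in> cadj k"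
      using n1[THEN spec, THEN spec, of U "Restr R U"] freeU LU deg mge unfolding m_def by auto
    define a where "a i = card {v \<in> U. cl v = i}" for i
    have suma: "(\<Sum>i<k. a i) = m" unfolding a_def m_def using finU cl(1) by (intro sum_card_classes) auto
    have homc: "card (hom_lists k cl U) = 2 * k * (\<Prod>i<k. a i)"
      unfolding a_def by (rule card_hom_lists[OF assms(1) k0(2) finU])
    have cyc_hom: "card (cycles k (Restr R U)) \<le> card (hom_lists k cl U)"
    proof (rule card_mono)
      show "finite (hom_lists k cl U)"
        by (rule finite_subset[OF _ finite_lists_length_eq[OF finU, of k]]) (auto simp: hom_lists_def)
      show "cycles k (Restr R U) \<subseteq> hom_lists k cl U" using cl(2) by (intro cycles_subset_hom_lists) auto
    qed
    have prodle: "(\<Prod>i<k. a i) \<le> pmax k m" by (rule prod_le_pmax(1)[OF k0(1) km suma])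
    have pm': "2 * k * pmax k m \<le> card (cycles k (Restr R U))"
    proof -
      have "real (2 * k * pmax k m) \<le> real (card (cycles k (Restr R U)))" using pm by (simp add: p_def L_def)
      then show ?thesis by (simp only: of_nat_le_iff)
    qed
    have "2 * k * (\<Prod>i<k. a i) \<le> 2 * k * pmax k m" using prodle by simp
    then have ceq: "card (cycles k (Restr R U)) = 2 * k * pmax k m" "card (hom_lists k cl U) = 2 * k * pmax k m"
      using cyc_hom homc pm' by linarith+
    then have "L U = p m" by (simp add: L_def p_def)
    \<comment> \<open>Without surplus the penalty for discarded vertices must vanish, so nothing has
      been discarded.\<close>
    then have "\<mu> * (real n - real m) \<le> 0" using surplus by simp
    then have "real n - real m \<le> 0" using \<mu>0 by (simp add: mult_le_0_iff)
    then have "card U = card V" using mn by (simp add: m_def n_def)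
    then have UV: "U = V" using U(1) finV by (intro card_subset_eq) auto
    have peq: "(\<Prod>i<k. a i) = pmax k m" using ceq(2) homc k0(1) by simp
    have bal: "a i \<le> a j + 1" if "i < k" "j < k" for i j
      using prod_le_pmax(2)[OF k0(1) km suma peq that] .
    have "0 < pmax k m" using km k0 by (simp add: pmax_def div_greater_zero_iff)
    then have apos: "a i \<noteq> 0" if "i < k" for i using peq that by (metis finite_lessThan lessThan_iff less_numeral_extra(3) prod_zero)
    have "Restr R U = {(x, y). x \<in> U \<and> y \<in> U \<and> (cl x, cl y) \<in> cadj k}"
    proof (rule complete_blowup_of_card_cycles[OF assms(1) k0(2) finU])
      show "card (hom_lists k cl U) \<le> card (cycles k (Restr R U))" using ceq by simp
      show "{v \<in> U. cl v = i} \<noteq> {}" if "i < k" for i using apos[OF that] unfolding a_def by (metis card.empty)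
    qed (use cl in auto)
    then have "R = {(x, y). x \<in> V \<and> y \<in> V \<and> (cl x, cl y) \<in> cadj k}" unfolding UV RR .
    moreover have "card (cycles k R) = 2 * k * pmax k (card V)" using ceq(1) unfolding UV RR m_def .
    ultimately show "card (cycles k R) = 2 * k * pmax k (card V) \<and>
      (\<exists>cl. (\<forall>v\<in>V. cl v < k) \<and> R = {(x, y). x \<in> V \<and> y \<in> V \<and> (cl x, cl y) \<in> cadj k} \<and>
        (\<forall>i<k. \<forall>j<k. card {v \<in> V. cl v = i} \<le> card {v \<in> V. cl v = j} + 1))"
      using cl(1) bal unfolding UV a_def by blast
  qed
qed

section \<open>Extremal graphs\<close>

lemma card_residue_class:
  assumes "i < k"
  shows "card {t. t < n \<and> t mod k = i} = n div k + (if i < n mod k then 1 else 0)"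
proof (induction n)
  case (Suc n)
  have "{t. t < Suc n \<and> t mod k = i} = (if n mod k = i then insert n {t. t < n \<and> t mod k = i} else {t. t < n \<and> t mod k = i})"
    by (auto simp: less_Suc_eq)
  then have "card {t. t < Suc n \<and> t mod k = i} = card {t. t < n \<and> t mod k = i} + (if n mod k = i then 1 else 0)"
    by simp
  then show ?case using Suc assms mod_less_divisor[of k n] by (auto simp: mod_Suc div_Suc)
qed simp

lemma ex_balanced_classes:
  fixes k :: nat
  assumes "finite V" "0 < k"
  shows "\<exists>cl. (\<forall>v\<in>V. cl v < k) \<and> (\<forall>i<k. \<forall>j<k. card {v \<in> V. cl v = i} \<le> card {v \<in> V. cl v = j} + 1)"
proof -
  obtain h where h: "bij_betw h V {0..<card V}" using ex_bij_betw_finite_nat[OF assms(1)] by blast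
  have c: "card {v \<in> V. h v mod k = i} = card {t. t < card V \<and> t mod k = i}" for i
  proof (rule bij_betw_same_card[of h])
    have "h ` {v \<in> V. h v mod k = i} = {t. t < card V \<and> t mod k = i}"
      using h by (auto simp: bij_betw_def image_iff)
    then show "bij_betw h {v \<in> V. h v mod k = i} {t. t < card V \<and> t mod k = i}"
      using h by (auto simp: bij_betw_def intro: inj_on_subset)
  qed
  show ?thesis
    using assms(2) by (intro exI[of _ "\<lambda>v. h v mod k"]) (auto simp: c card_residue_class)
qed

lemma irrefl_cadj: "3 \<le> k \<Longrightarrow> (i, i) \<notin> cadj k"
proof
  assume "3 \<le> k" "(i, i) \<in> cadj k"
  then have "i < k" "i = Suc i mod k" by (auto simp: cadj_def)
  then show False using \<open>3 \<le> k\<close> by (cases "Suc i = k") auto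
qed

text \<open>The lower bound: a blow-up maps homomorphically to \<open>C_k\<close>, in which odd
  closed walks have length at least \<open>k\<close>, so there is no \<open>C_(k-2)\<close>.\<close>

lemma ex_balanced_blowup_graph:
  assumes "odd k" "7 \<le> k" "finite V"
  shows "\<exists>G. simple_graph G \<and> verts G = V \<and> graph_free (cycle_graph (k - 2)) G \<and>
    num_copies (cycle_graph k) G = pmax k (card V)"
proof -
  have k0: "0 < k" "3 \<le> k" using assms(2) by auto
  obtain cl where cl: "\<forall>v\<in>V. cl v < k" "\<forall>i<k. \<forall>j<k. card {v \<in> V. cl v = i} \<le> card {v \<in> V. cl v = j} + 1"
    using ex_balanced_classes[OF assms(3) k0(1)] by blast
  define B where "B = {(x, y). x \<in> V \<and> y \<in> V \<and> (cl x, cl y) \<in> cadj k}"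
  define G where "G = (V, {{x, y} | x y. (x, y) \<in> B})"
  have symB: "(y, x) \<in> B" if "(x, y) \<in> B" for x y
    using that sym_cadj[of k] by (auto simp: B_def dest: symD)
  have neq: "x \<noteq> y" if "(x, y) \<in> B" for x y using that irrefl_cadj[OF k0(2)] by (auto simp: B_def)
  have simple: "simple_graph G"
    using assms(3) neq by (auto simp: simple_graph_def G_def B_def card_insert_if)
  have adjG: "adj G = B"
  proof (intro equalityI subrelI)
    fix x y assume "(x, y) \<in> adj G"
    then obtain u v where "(u, v) \<in> B" "{x, y} = {u, v}" by (auto simp: adj_def G_def)
    then show "(x, y) \<in> B" using symB by (auto simp: doubleton_eq_iff)
  qed (auto simp: adj_def G_def)
  have "cycles (k - 2) B = {}"
    by (rule no_short_cycles_blowup[of _ k _ cl]) (use assms(1,2) in \<open>auto simp: B_def\<close>)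
  then have free: "graph_free (cycle_graph (k - 2)) G" using graph_free_cycle_iff[OF simple] adjG by simp
  have "card (cycles k B) = 2 * k * (\<Prod>i<k. card {v \<in> V. cl v = i})"
    unfolding B_def cycles_blowup[OF assms(1) k0(2)] by (rule card_hom_lists[OF assms(1) k0(2) assms(3)])
  also have "(\<Prod>i<k. card {v \<in> V. cl v = i}) = pmax k (card V)"
    using cl assms(3) by (intro prod_balanced[OF k0(1)] sum_card_classes) auto
  finally have "num_copies (cycle_graph k) G = pmax k (card V)"
    using card_cycles_eq_num_copies[OF assms(1) k0(2) simple] adjG k0(1) by simp
  then show ?thesis using simple free by (intro exI[of _ G]) (simp add: G_def)
qed

lemma cycle_free_on_adj:
  assumes "simple_graph G" "graph_free (cycle_graph m) G"
  shows "cycle_free_on m (verts G) (adj G)"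
proof -
  have "finite (verts G)" using assms(1) by (simp add: simple_graph_def)
  then show ?thesis unfolding cycle_free_on_def
    using adj_subset[OF assms(1)] sym_adj irrefl_adj[OF assms(1)] graph_free_cycle_iff[OF assms(1)] assms(2) by blast
qed

lemma balanced_blowup_cycle_graph:
  fixes cl :: "'a \<Rightarrow> nat"
  assumes "simple_graph G" "\<forall>v\<in>verts G. cl v < k"
    "adj G = {(x, y). x \<in> verts G \<and> y \<in> verts G \<and> (cl x, cl y) \<in> cadj k}"
    "\<forall>i<k. \<forall>j<k. card {v \<in> verts G. cl v = i} \<le> card {v \<in> verts G. cl v = j} + 1"
  shows "balanced_blowup (cycle_graph k) G"
proof -
  define A where "A i = {v \<in> verts G. cl v = i}" for i
  have V: "verts (cycle_graph k) = {..<k}" by (simp add: cycle_graph_def)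
  have E: "{u, v} \<in> edges (cycle_graph k) \<longleftrightarrow> (u, v) \<in> cadj k" for u v
    using adj_cycle_graph[of k] by (auto simp: adj_def)
  have fin: "finite (verts G)" using assms(1) by (simp add: simple_graph_def)
  have "edges G = {{x, y} | x y. (x, y) \<in> adj G}" by (rule edges_eq_adj[OF assms(1)])
  also have "\<dots> = {{x, y} | u v x y. {u, v} \<in> edges (cycle_graph k) \<and> x \<in> A u \<and> y \<in> A v}"
    unfolding E assms(3) A_def by blast
  finally show ?thesis unfolding balanced_blowup_def V
    using fin assms(2,4) by (intro exI[of _ A]) (auto simp: A_def)
qed

text \<open>Stated relative to the value \<open>pmax\<close> rather than to a maximum over graphs,
  so that it serves both for extremal graphs on \<open>'a\<close> and for bounding the maximum over
  graphs on \<open>nat\<close>.\<close>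

lemma extremal_graph:
  assumes "odd k" "7 \<le> k"
  shows "\<exists>n0. \<forall>G :: 'a graph. simple_graph G \<and> n0 \<le> card (verts G) \<and> graph_free (cycle_graph (k - 2)) G \<and>
      pmax k (card (verts G)) \<le> num_copies (cycle_graph k) G
    \<longrightarrow> num_copies (cycle_graph k) G = pmax k (card (verts G)) \<and> balanced_blowup (cycle_graph k) G"
proof -
  have k0: "0 < k" "3 \<le> k" using assms(2) by auto
  obtain n0 where n0: "\<forall>(V :: 'a set) R. cycle_free_on (k - 2) V R \<and> n0 \<le> card V \<and> 2 * k * pmax k (card V) \<le> card (cycles k R)
    \<longrightarrow> card (cycles k R) = 2 * k * pmax k (card V) \<and>
      (\<exists>cl. (\<forall>v\<in>V. cl v < k) \<and> R = {(x, y). x \<in> V \<and> y \<in> V \<and> (cl x, cl y) \<in> cadj k} \<and>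
        (\<forall>i<k. \<forall>j<k. card {v \<in> V. cl v = i} \<le> card {v \<in> V. cl v = j} + 1))"
    using extremal_is_blowup[OF assms, where 'a = 'a] by blast
  show ?thesis
  proof (intro exI[of _ n0] allI impI)
    fix G :: "'a graph"
    assume asm: "simple_graph G \<and> n0 \<le> card (verts G) \<and> graph_free (cycle_graph (k - 2)) G \<and>
      pmax k (card (verts G)) \<le> num_copies (cycle_graph k) G"
    have c: "card (cycles k (adj G)) = 2 * k * num_copies (cycle_graph k) G"
      using card_cycles_eq_num_copies[OF assms(1) k0(2)] asm by blast
    have "cycle_free_on (k - 2) (verts G) (adj G)" using asm cycle_free_on_adj by blast
    moreover have "2 * k * pmax k (card (verts G)) \<le> card (cycles k (adj G))" unfolding c using asm by simp
    ultimately have *: "card (cycles k (adj G)) = 2 * k * pmax k (card (verts G))"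
      "\<exists>cl. (\<forall>v\<in>verts G. cl v < k) \<and> adj G = {(x, y). x \<in> verts G \<and> y \<in> verts G \<and> (cl x, cl y) \<in> cadj k} \<and>
        (\<forall>i<k. \<forall>j<k. card {v \<in> verts G. cl v = i} \<le> card {v \<in> verts G. cl v = j} + 1)"
      using n0[THEN spec, THEN spec, of "verts G" "adj G"] asm by blast+
    show "num_copies (cycle_graph k) G = pmax k (card (verts G)) \<and> balanced_blowup (cycle_graph k) G"
    proof
      show "num_copies (cycle_graph k) G = pmax k (card (verts G))" using *(1) c k0(1) by simp
      show "balanced_blowup (cycle_graph k) G" using *(2) asm balanced_blowup_cycle_graph by blast
    qed
  qed
qed

theorem theorem1p1:
  fixes k :: nat
  assumes "odd k" and "k \<ge> 7"
  shows "\<exists>n0 :: nat. \<forall>n \<ge> n0.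
    (\<forall>G :: 'a graph.
       simple_graph G \<and> card (verts G) = n \<and> graph_free (cycle_graph (k - 2)) G \<and>
       (\<forall>G' :: 'a graph.
          simple_graph G' \<and> card (verts G') = n \<and> graph_free (cycle_graph (k - 2)) G' \<longrightarrow>
          num_copies (cycle_graph k) G' \<le> num_copies (cycle_graph k) G) \<longrightarrow>
       balanced_blowup (cycle_graph k) G) \<and>
    real (gen_turan n (cycle_graph k) (cycle_graph (k - 2))) \<le> (real n / real k) ^ k"
proof -
  obtain n1 where n1: "\<And>G :: 'a graph. simple_graph G \<and> n1 \<le> card (verts G) \<and> graph_free (cycle_graph (k - 2)) G \<and>
      pmax k (card (verts G)) \<le> num_copies (cycle_graph k) G
    \<Longrightarrow> num_copies (cycle_graph k) G = pmax k (card (verts G)) \<and> balanced_blowup (cycle_graph k) G"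
    using extremal_graph[OF assms, where 'a = 'a] by blast
  obtain n2 where n2: "\<And>G :: nat graph. simple_graph G \<and> n2 \<le> card (verts G) \<and> graph_free (cycle_graph (k - 2)) G \<and>
      pmax k (card (verts G)) \<le> num_copies (cycle_graph k) G
    \<Longrightarrow> num_copies (cycle_graph k) G = pmax k (card (verts G)) \<and> balanced_blowup (cycle_graph k) G"
    using extremal_graph[OF assms, where 'a = nat] by blast
  show ?thesis
  proof (intro exI[of _ "n1 + n2 + 1"] allI impI conjI)
    fix n and G :: "'a graph" assume n: "n1 + n2 + 1 \<le> n"
      and G: "simple_graph G \<and> card (verts G) = n \<and> graph_free (cycle_graph (k - 2)) G \<and>
       (\<forall>G' :: 'a graph.
          simple_graph G' \<and> card (verts G') = n \<and> graph_free (cycle_graph (k - 2)) G' \<longrightarrow>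
          num_copies (cycle_graph k) G' \<le> num_copies (cycle_graph k) G)"
    then have "finite (verts G)" by (simp add: simple_graph_def)
    \<comment> \<open>The competitor is built on the vertex set of \<open>G\<close> itself and hence
      has the same vertex type.\<close>
    then obtain G' where "simple_graph G'" "verts G' = verts G" "graph_free (cycle_graph (k - 2)) G'"
        "num_copies (cycle_graph k) G' = pmax k (card (verts G))"
      using ex_balanced_blowup_graph[OF assms] by metis
    then have "pmax k (card (verts G)) \<le> num_copies (cycle_graph k) G" using G by metis
    then show "balanced_blowup (cycle_graph k) G" using n1[of G] G n by auto
  next
    fix n assume n: "n1 + n2 + 1 \<le> n"
    define S where "S = {num_copies (cycle_graph k) G |G :: nat graph.
      simple_graph G \<and> verts G = {..<n} \<and> graph_free (cycle_graph (k - 2)) G}"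
    have "S \<subseteq> num_copies (cycle_graph k) ` ({{..<n}} \<times> Pow (Pow {..<n}))"
    proof
      fix c assume "c \<in> S"
      then obtain G :: "nat graph" where G: "simple_graph G" "verts G = {..<n}" "c = num_copies (cycle_graph k) G"
        by (auto simp: S_def)
      then have "G \<in> {{..<n}} \<times> Pow (Pow {..<n})" by (cases G) (auto simp: simple_graph_def)
      then show "c \<in> num_copies (cycle_graph k) ` ({{..<n}} \<times> Pow (Pow {..<n}))" using G(3) by blast
    qed
    then have fin: "finite S" by (rule finite_subset) simp
    have "S \<noteq> {}" using ex_balanced_blowup_graph[OF assms, of "{..<n}"] by (auto simp: S_def)
    moreover have "c \<le> pmax k n" if c: "c \<in> S" for c
    proof -
      obtain G :: "nat graph" where G: "simple_graph G" "verts G = {..<n}" "graph_free (cycle_graph (k - 2)) G"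
          "c = num_copies (cycle_graph k) G" using c unfolding S_def by blast
      \<comment> \<open>A graph with at least \<open>pmax k n\<close> copies has exactly that
        many.\<close>
      then show ?thesis using n2[of G] n by (cases "pmax k n \<le> c") auto
    qed
    ultimately have "Max S \<le> pmax k n" using fin by simp
    then have "real (gen_turan n (cycle_graph k) (cycle_graph (k - 2))) \<le> real (pmax k n)"
      unfolding gen_turan_def S_def by (rule of_nat_mono)
    also have "\<dots> \<le> (real n / real k) ^ k" using assms n by (intro pmax_le_power) auto
    finally show "real (gen_turan n (cycle_graph k) (cycle_graph (k - 2))) \<le> (real n / real k) ^ k" .
  qed
qed

end
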